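(* (1) The length generating function of $2$-sided walks has a unique singularity of minimal modulus, $\rho\simeq0.403$, which is a simple pole and satisfies $1-2\rho-2\rho^2+2\rho^3=0$. The number $p_n$ of $n$-step $2$-sided walks satisfies $$p_n\sim\kappa\mu^n\quad\text{with}\quad\mu=\frac1\rho\simeq2.48\quad\text{and}\quad\kappa=\frac{\rho(3\rho-1)}{(3\rho+1)(5\rho-2)}\simeq2.51.$$ (2) The distance between the endpoint and the NE corner of the box in a random $n$-step $2$-sided walk follows asymptotically a geometric law of parameter $2\rho$ (i.e. for each $k\ge0$ the probability that the distance equals $k$ tends to $(1-2\rho)(2\rho)^k$ as $n\to\infty$). In particular, the average value of this distance is asymptotically constant, equal to $\frac{2\rho}{1-2\rho}\simeq4.15$. (3) Let $X_n$ (resp. $Y_n$) denote the abscissa (resp. ordinate) of the endpoint of a random $n$-step $2$-sided walk. Then the mean and variance of $X_n+Y_n$ satisfy $$\mathbb E(X_n+Y_n)\sim\mathfrak m\,n,\qquad\mathbb V(X_n+Y_n)\sim\mathfrak s^2\,n,$$ where $$\mathfrak m=\frac{\rho+1}{3\rho+1}\simeq0.63\quad\text{and}\quad\mathfrak s^2=\frac{4(\rho+1)^2\rho}{(3\rho+1)^3(1-\rho)}\simeq0.49,$$ and the variable $\dfrac{X_n+Y_n-\mathfrak m\,n}{\mathfrak s\sqrt n}$ converges in law to a standard normal distribution. (4) Finally, $$\mathbb E(X_n-Y_n)=0,\qquad\mathbb V(X_n-Y_n)\sim\mathfrak s_1^2\,n,$$ where $$\mathfrak s_1^2=\frac{\rho(\rho^2-2)(1+\rho)}{(\rho^2+\rho-1)(3\rho-1)(1+3\rho)}\simeq5.17,$$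 and the variable $\dfrac{X_n-Y_n}{\mathfrak s_1\sqrt n}$ converges in law to a standard normal distribution.
   Context: Walks on the square lattice start at the origin and take unit steps N, E, S, W. A walk is prudent if it never takes a step pointing towards a vertex it has already visited (a step from $p$ in direction $d$ is forbidden if some $p+kd$, $k\ge1$, has already been visited). The box of a walk is the smallest (axis-parallel, possibly degenerate) rectangle containing it. A prudent walk is $2$-sided if, as the walk grows, its endpoint always lies on the top or right edge of the box of the walk constructed so far. The length is the number of steps; the length generating function is $\sum_n p_nt^n$. A random $n$-step $2$-sided walk is chosen uniformly among all $2$-sided walks of length $n$. *)

theory Defs
  imports "HOL-Complex_Analysis.Complex_Analysis" "HOL-Probability.Probability"
begin

section \<open>Two-sided prudent walks\<close>

datatype step = North | East | South | West

fun step_vec :: "step \<Rightarrow> int \<times> int" where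
  "step_vec North = (0, 1)"
| "step_vec East = (1, 0)"
| "step_vec South = (0, -1)"
| "step_vec West = (-1, 0)"

definition endpoint :: "step list \<Rightarrow> int \<times> int" where
  "endpoint w = sum_list (map step_vec w)"

definition visited :: "step list \<Rightarrow> (int \<times> int) set" where
  "visited w = (\<lambda>i. endpoint (take i w)) ` {..length w}"

definition ahead :: "int \<times> int \<Rightarrow> step \<Rightarrow> (int \<times> int) set" where
  "ahead p s = {(fst p + k * fst (step_vec s), snd p + k * snd (step_vec s)) | k. k \<ge> 1}"

definition prudent :: "step list \<Rightarrow> bool" where
  "prudent w \<longleftrightarrow>
     (\<forall>i<length w. ahead (endpoint (take i w)) (w ! i) \<inter> visited (take i w) = {})"

definition x_min :: "step list \<Rightarrow> int" where "x_min w = Min (fst ` visited w)"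
definition x_max :: "step list \<Rightarrow> int" where "x_max w = Max (fst ` visited w)"
definition y_min :: "step list \<Rightarrow> int" where "y_min w = Min (snd ` visited w)"
definition y_max :: "step list \<Rightarrow> int" where "y_max w = Max (snd ` visited w)"

text \<open>The lattice points of the box and of its edges.\<close>

definition walk_box :: "step list \<Rightarrow> (int \<times> int) set" where
  "walk_box w = {x_min w..x_max w} \<times> {y_min w..y_max w}"

definition top_edge :: "step list \<Rightarrow> (int \<times> int) set" where
  "top_edge w = {p \<in> walk_box w. snd p = y_max w}"

definition right_edge :: "step list \<Rightarrow> (int \<times> int) set" where
  "right_edge w = {p \<in> walk_box w. fst p = x_max w}"

definition ne_corner :: "step list \<Rightarrow> int \<times> int" where
  "ne_corner w = (x_max w, y_max w)"

definition two_sided :: "step list \<Rightarrow> bool" where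
  "two_sided w \<longleftrightarrow> prudent w \<and>
     (\<forall>i\<le>length w. endpoint (take i w) \<in> top_edge (take i w) \<union> right_edge (take i w))"

definition two_sided_walks :: "nat \<Rightarrow> step list set" where
  "two_sided_walks n = {w. two_sided w \<and> length w = n}"


section \<open>Generating function and its singularities\<close>

definition two_sided_gf :: "complex fps" where
  "two_sided_gf = Abs_fps (\<lambda>n. of_nat (card (two_sided_walks n)))"

definition disc_of_convergence :: "complex fps \<Rightarrow> complex set" where
  "disc_of_convergence f = eball 0 (fps_conv_radius f)"

text \<open>
  The singularities of minimal modulus of the analytic function defined by a power series
  are the points of its circle of convergence at which it has no analytic continuation.
\<close>

definition dominant_singularity :: "complex fps \<Rightarrow> complex \<Rightarrow> bool" where
  "dominant_singularity f z \<longleftrightarrow>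
     ereal (norm z) = fps_conv_radius f \<and>
     \<not> (\<exists>r>0. \<exists>g. g holomorphic_on ball z r \<and>
           (\<forall>u \<in> ball z r \<inter> disc_of_convergence f. g u = eval_fps f u))"

text \<open>
  The continuation \<open>g\<close> is needed because \<^const>\<open>eval_fps\<close> is meaningful only where
  the series converges.
\<close>

definition dominant_simple_pole :: "complex fps \<Rightarrow> complex \<Rightarrow> bool" where
  "dominant_simple_pole f z \<longleftrightarrow>
     ereal (norm z) = fps_conv_radius f \<and>
     (\<exists>r>0. \<exists>g. g holomorphic_on (ball z r - {z}) \<and>
        (\<forall>u \<in> ball z r \<inter> disc_of_convergence f. g u = eval_fps f u) \<and>
        is_pole g z \<and> zorder g z = -1)"


section \<open>Random two-sided walks\<close>

definition random_walk :: "nat \<Rightarrow> step list pmf" where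
  "random_walk n = pmf_of_set (two_sided_walks n)"

definition X :: "step list \<Rightarrow> real" where "X w = of_int (fst (endpoint w))"
definition Y :: "step list \<Rightarrow> real" where "Y w = of_int (snd (endpoint w))"

text \<open>Euclidean distance; it is a natural number, since the endpoint of a two-sided walk
  lies on an edge of the box that contains the NE corner.\<close>

definition corner_dist :: "step list \<Rightarrow> real" where
  "corner_dist w =
     dist (X w, Y w) (of_int (fst (ne_corner w)), of_int (snd (ne_corner w)))"

definition walk_law :: "nat \<Rightarrow> (step list \<Rightarrow> real) \<Rightarrow> real measure" where
  "walk_law n Z = distr (measure_pmf (random_walk n)) borel Z"

text \<open>\<^const>\<open>pmf_of_set\<close> is specified only for finite nonempty sets.\<close>

lemma finite_two_sided_walks: "finite (two_sided_walks n)"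
proof -
  have "(UNIV :: step set) = {North, East, South, West}"
    using step.exhaust by auto
  then have "finite (UNIV :: step set)"
    by (metis finite.emptyI finite.insertI)
  then have "finite {w :: step list. set w \<subseteq> UNIV \<and> length w = n}"
    by (rule finite_lists_length_eq)
  then show ?thesis
    by (rule rev_finite_subset) (auto simp: two_sided_walks_def)
qed

lemma endpoint_replicate_North: "endpoint (replicate n North) = (0, int n)"
  by (induction n) (auto simp: endpoint_def zero_prod_def)

lemma visited_replicate_North: "visited (replicate n North) = (\<lambda>i. (0, int i)) ` {..n}"
  by (auto simp: visited_def endpoint_replicate_North min_def image_iff)

lemma two_sided_walks_nonempty: "two_sided_walks n \<noteq> {}"
proof -
  have fst_im: "fst ` visited (replicate m North) = {0}" for m
    by (auto simp: visited_replicate_North image_image)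
  have snd_im: "snd ` visited (replicate m North) = int ` {..m}" for m
    by (simp add: visited_replicate_North image_image)
  have "x_min (replicate m North) = 0" "x_max (replicate m North) = 0" for m
    by (simp_all add: x_min_def x_max_def fst_im)
  moreover have "y_max (replicate m North) = int m" for m
    unfolding y_max_def by (rule Max_eqI) (auto simp: snd_im)
  moreover have "y_min (replicate m North) = 0" for m
    unfolding y_min_def by (rule Min_eqI) (auto simp: snd_im image_iff)
  moreover have "prudent (replicate n North)"
    by (auto simp: prudent_def ahead_def visited_replicate_North endpoint_replicate_North)
  ultimately have "two_sided (replicate n North)"
    by (auto simp: two_sided_def right_edge_def walk_box_def endpoint_replicate_North min_def)
  then show ?thesis
    by (auto simp: two_sided_walks_def intro!: exI[of _ "replicate n North"])
qed

end

theory Submission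
  imports Defs
begin

text \<open>
  Which steps may extend a two-sided walk depends on very little: its distance to the NE
  corner of the box, the edge it is on, the last move, and, at the corner, whether the row to the
  west and the column to the south are free. Two-sided walks are therefore the words accepted by
  an automaton with a simple infinite set of states (\<open>at_state_snoc\<close>, \<open>two_sided_iff_run\<close>).

  Whenever such a walk is at the corner, it goes on with a step N or E that enlarges the box, possibly
  followed by an excursion along the new top row or right column that comes back to the corner. Let
  \<open>block a t\<close> be the generating function of a step of weight \<open>a\<close> with its optional excursion
  \<open>arch a t\<close>. The walks that end at the corner are then counted by
  \<open>(arch x + arch y - 1) / (1 - block x - block y)\<close>, and a walk that leaves the corner for good pays
  a factor \<open>ratio\<close> for every unit of its final distance. These explicit functions solve the linear
  system of the automaton. That system has only one power series solution, so it suffices to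
  verify the formulas by substitution (\<open>dist_sum_gf\<close>).

  The function \<open>block\<close> is an algebraic function of degree two, holomorphic for \<open>\<bar>t\<bar> < 41/100\<close>, so in
  this disc all singularities come from the zeros of the denominator. With unit weights the denominator
  vanishes where \<open>block = 1/2\<close>, which reduces to the cubic equation with its root \<open>rho\<close>; this gives
  the simple pole and the number of walks. At \<open>rho\<close> the value of \<open>ratio\<close> is \<open>2 rho\<close>, hence the
  geometric law of the distance to the corner.

  For the limit laws a step is weighted by \<open>exp (z)\<close> or \<open>exp (- z)\<close> according to its effect on
  \<open>X + Y\<close> or \<open>X - Y\<close>; the coefficients are then moment generating functions, up to normalisation. For
  small \<open>z\<close> the pole moves to a point \<open>r z\<close> that depends holomorphically on \<open>z\<close>, and the \<open>n\<close>-th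
  coefficient times \<open>r z ^ n\<close> converges uniformly (\<open>simple_pole_perturbation\<close>). So the logarithm of
  the moment generating function is \<open>- n ln (r z / r 0)\<close> up to a convergent term. Cauchy's inequality turns
  this into mean and variance, and Levy's continuity theorem into the Gaussian limit (locale
  \<open>quasi_powers\<close>). The constants come from the first two derivatives of \<open>r\<close> at 0, found by
  differentiating a polynomial equation for \<open>r z\<close> and \<open>exp z\<close>.
\<close>

section \<open>Two-sided walks as words of an automaton\<close>

text \<open>
  Moves along the top edge and along the right edge are mirror images. On either edge, \<open>Forward\<close>
  enlarges the box, \<open>Away\<close> leads away from the NE corner and \<open>Back\<close> towards it. The flags of
  \<open>Corner\<close> say that the rest of the top row, respectively of the right column, is unvisited. The
  state \<open>Edge e i m\<close> is at distance \<open>i + 1\<close> from the corner.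
\<close>

datatype side = OnTop | OnRight
datatype move = Forward | Away | Back
datatype state = Corner bool bool | Edge side nat move

fun forward_step :: "side \<Rightarrow> step" where
  "forward_step OnTop = North" | "forward_step OnRight = East"

fun away_step :: "side \<Rightarrow> step" where
  "away_step OnTop = West" | "away_step OnRight = South"

fun back_step :: "side \<Rightarrow> step" where
  "back_step OnTop = East" | "back_step OnRight = North"

text \<open>
  A walk that comes back to the corner along an edge meets \<open>Corner False False\<close>: vertices visited
  earlier remain in the row and in the column. A forward step from the corner opens a fresh row or
  column, but its own starting point blocks the other direction.
\<close>

fun next_state :: "state \<Rightarrow> step \<Rightarrow> state option" where
  "next_state (Corner a b) North = Some (Corner True False)"
| "next_state (Corner a b) East = Some (Corner False True)"
| "next_state (Corner a b) West = (if a then Some (Edge OnTop 0 Away) else None)"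
| "next_state (Corner a b) South = (if b then Some (Edge OnRight 0 Away) else None)"
| "next_state (Edge e i m) d =
     (if d = forward_step e then Some (Edge e i Forward)
      else if d = away_step e then (if m = Back then None else Some (Edge e (Suc i) Away))
      else if d = back_step e \<and> m \<noteq> Away
        then Some (case i of 0 \<Rightarrow> Corner False False | Suc j \<Rightarrow> Edge e j Back)
      else None)"

definition run :: "step list \<Rightarrow> state option" where
  "run w = foldl (\<lambda>q d. Option.bind q (\<lambda>s. next_state s d)) (Some (Corner True True)) w"

lemma run_Nil [simp]: "run [] = Some (Corner True True)"
  by (simp add: run_def)

lemma run_snoc [simp]: "run (w @ [d]) = Option.bind (run w) (\<lambda>s. next_state s d)"
  by (simp add: run_def)

text \<open>
  The state has to know exactly those visited vertices that decide which steps are prudent: on an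
  edge of the box these are the visited vertices of that edge.
\<close>

fun at_state :: "step list \<Rightarrow> state \<Rightarrow> bool" where
  "at_state w (Corner a b) \<longleftrightarrow> endpoint w = ne_corner w \<and>
     (a \<longleftrightarrow> (\<forall>q\<in>visited w - {endpoint w}. snd q < y_max w)) \<and>
     (b \<longleftrightarrow> (\<forall>q\<in>visited w - {endpoint w}. fst q < x_max w))"
| "at_state w (Edge OnTop i m) \<longleftrightarrow>
     snd (endpoint w) = y_max w \<and> fst (endpoint w) = x_max w - int i - 1 \<and>
     (case m of
        Forward \<Rightarrow> \<forall>q\<in>visited w - {endpoint w}. snd q < y_max w
      | Away \<Rightarrow> (\<forall>q\<in>visited w. fst q < fst (endpoint w) \<longrightarrow> snd q < y_max w) \<and>
          endpoint w + (1, 0) \<in> visited w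
      | Back \<Rightarrow> (\<forall>q\<in>visited w. fst (endpoint w) < fst q \<longrightarrow> snd q < y_max w) \<and>
          endpoint w - (1, 0) \<in> visited w)"
| "at_state w (Edge OnRight i m) \<longleftrightarrow>
     fst (endpoint w) = x_max w \<and> snd (endpoint w) = y_max w - int i - 1 \<and>
     (case m of
        Forward \<Rightarrow> \<forall>q\<in>visited w - {endpoint w}. fst q < x_max w
      | Away \<Rightarrow> (\<forall>q\<in>visited w. snd q < snd (endpoint w) \<longrightarrow> fst q < x_max w) \<and>
          endpoint w + (0, 1) \<in> visited w
      | Back \<Rightarrow> (\<forall>q\<in>visited w. snd (endpoint w) < snd q \<longrightarrow> fst q < x_max w) \<and>
          endpoint w - (0, 1) \<in> visited w)"

lemma endpoint_snoc [simp]: "endpoint (w @ [d]) = endpoint w + step_vec d"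
  by (simp add: endpoint_def)

lemma visited_snoc: "visited (w @ [d]) = insert (endpoint w + step_vec d) (visited w)"
proof -
  have "{..length (w @ [d])} = insert (Suc (length w)) {..length w}"
    by auto
  then have "visited (w @ [d]) = insert (endpoint (w @ [d]))
      ((\<lambda>i. endpoint (take i (w @ [d]))) ` {..length w})"
    by (simp only: visited_def image_insert) simp
  also have "(\<lambda>i. endpoint (take i (w @ [d]))) ` {..length w} = visited w"
    unfolding visited_def by (intro image_cong) auto
  finally show ?thesis
    by simp
qed

lemma finite_visited [simp]: "finite (visited w)"
  by (simp add: visited_def)

lemma endpoint_in_visited [simp]: "endpoint w \<in> visited w"
  by (auto simp: visited_def image_iff intro!: bexI[of _ "length w"])

lemma visited_nonempty [simp]: "visited w \<noteq> {}"
  using endpoint_in_visited by blast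

lemma x_max_snoc: "x_max (w @ [d]) = max (fst (endpoint w + step_vec d)) (x_max w)"
  and y_max_snoc: "y_max (w @ [d]) = max (snd (endpoint w + step_vec d)) (y_max w)"
  by (simp_all add: x_max_def y_max_def visited_snoc)

lemma visited_le_max: "q \<in> visited w \<Longrightarrow> fst q \<le> x_max w" "q \<in> visited w \<Longrightarrow> snd q \<le> y_max w"
  by (simp_all add: x_max_def y_max_def)

lemma max_attained:
  "\<exists>q\<in>visited w. fst q = x_max w" "\<exists>q\<in>visited w. snd q = y_max w"
  using Max_in[of "fst ` visited w"] Max_in[of "snd ` visited w"]
  unfolding x_max_def y_max_def by (simp_all add: image_iff) metis+

lemma endpoint_in_box: "endpoint w \<in> walk_box w"
  by (auto simp: walk_box_def x_min_def y_min_def x_max_def y_max_def mem_Times_iff)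

lemma endpoint_on_edges_iff:
  "endpoint w \<in> top_edge w \<union> right_edge w \<longleftrightarrow>
     snd (endpoint w) = y_max w \<or> fst (endpoint w) = x_max w"
  using endpoint_in_box[of w] by (auto simp: top_edge_def right_edge_def)

lemma two_sided_snoc:
  "two_sided (w @ [d]) \<longleftrightarrow> two_sided w \<and> (\<forall>q\<in>visited w. q \<notin> ahead (endpoint w) d) \<and>
     (snd (endpoint w + step_vec d) \<ge> y_max w \<or> fst (endpoint w + step_vec d) \<ge> x_max w)"
proof -
  have "prudent (w @ [d]) \<longleftrightarrow>
      prudent w \<and> (\<forall>q\<in>visited w. q \<notin> ahead (endpoint w) d)"
    unfolding prudent_def length_append_singleton All_less_Suc
    by (simp add: nth_append disjoint_iff del: split_paired_All cong: conj_cong) blast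
  moreover have "(\<forall>i\<le>length (w @ [d]). endpoint (take i (w @ [d])) \<in>
          top_edge (take i (w @ [d])) \<union> right_edge (take i (w @ [d]))) \<longleftrightarrow>
      (\<forall>i\<le>length w. endpoint (take i w) \<in> top_edge (take i w) \<union> right_edge (take i w)) \<and>
      endpoint (w @ [d]) \<in> top_edge (w @ [d]) \<union> right_edge (w @ [d])"
    unfolding less_Suc_eq_le[symmetric] length_append_singleton All_less_Suc
    by (simp add: conj_commute conj_left_commute cong: conj_cong)
  moreover have "endpoint (w @ [d]) \<in> top_edge (w @ [d]) \<union> right_edge (w @ [d]) \<longleftrightarrow>
      snd (endpoint w + step_vec d) \<ge> y_max w \<or> fst (endpoint w + step_vec d) \<ge> x_max w"
    using endpoint_on_edges_iff[of "w @ [d]"]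
    by (simp add: x_max_snoc y_max_snoc max_def eq_commute)
  ultimately show ?thesis
    unfolding two_sided_def by blast
qed

lemma in_ahead_iff:
  "q \<in> ahead p North \<longleftrightarrow> fst q = fst p \<and> snd q > snd p"
  "q \<in> ahead p East \<longleftrightarrow> snd q = snd p \<and> fst q > fst p"
  "q \<in> ahead p South \<longleftrightarrow> fst q = fst p \<and> snd q < snd p"
  "q \<in> ahead p West \<longleftrightarrow> snd q = snd p \<and> fst q < fst p"
proof -
  obtain a b u v where "p = (a, b)" "q = (u, v)"
    by (cases p, cases q)
  then show "q \<in> ahead p North \<longleftrightarrow> fst q = fst p \<and> snd q > snd p"
    "q \<in> ahead p East \<longleftrightarrow> snd q = snd p \<and> fst q > fst p"
    "q \<in> ahead p South \<longleftrightarrow> fst q = fst p \<and> snd q < snd p"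
    "q \<in> ahead p West \<longleftrightarrow> snd q = snd p \<and> fst q < fst p"
    by (auto simp: ahead_def intro: exI[of _ "v - b"] exI[of _ "u - a"]
        exI[of _ "b - v"] exI[of _ "a - u"])
qed

text \<open>
  A forward step is always prudent since nothing lies beyond the box, and it makes the edge fresh. A
  step back or away stays in a row or column whose relevant part is unvisited unless it undoes the
  last move. The fourth direction leaves both edges.
\<close>

lemma at_state_snoc:
  assumes "two_sided w" "at_state w s"
  shows "case next_state s d of None \<Rightarrow> \<not> two_sided (w @ [d])
         | Some s' \<Rightarrow> two_sided (w @ [d]) \<and> at_state (w @ [d]) s'"
proof -
  obtain a b where p: "endpoint w = (a, b)"
    by fastforce
  define V xm ym where V: "V = visited w" "xm = x_max w" "ym = y_max w"
  have ub2: "u \<le> xm \<and> v \<le> ym" if "(u, v) \<in> V" for u v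
    using visited_le_max[of "(u, v)" w] that V by simp
  obtain x0 y0 where at: "(xm, y0) \<in> V" "(x0, ym) \<in> V"
    using max_attained[of w] V by (metis prod.collapse)
  have pV: "(a, b) \<in> V"
    using endpoint_in_visited[of w] p V by simp
  note rules = two_sided_snoc in_ahead_iff x_max_snoc y_max_snoc visited_snoc p V[symmetric] assms(1)
    ne_corner_def
  show ?thesis
  proof (cases s)
    case (Corner f g)
    have *: "a = xm" "b = ym"
      using assms(2) by (auto simp: Corner rules)
    show ?thesis
      using assms(2) ub2 at pV unfolding Corner
      by (cases d; simp add: rules * Ball_def; smt (verit, best))
  next
    case (Edge e i m)
    have *: "e = OnTop \<Longrightarrow> a = xm - int i - 1 \<and> b = ym" "e = OnRight \<Longrightarrow> b = ym - int i - 1 \<and> a = xm"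
      using assms(2) by (cases e; auto simp: Edge rules)+
    show ?thesis
      using assms(2) ub2 at pV unfolding Edge
      by (cases e; cases m; cases d; cases i; simp add: rules * Ball_def; (smt (z3))?)
  qed
qed

lemma run_characterizes_two_sided:
  "case run w of None \<Rightarrow> \<not> two_sided w | Some s \<Rightarrow> two_sided w \<and> at_state w s"
proof (induction w rule: rev_induct)
  case Nil
  have "two_sided []"
    using two_sided_walks_nonempty[of 0] by (auto simp: two_sided_walks_def)
  then show ?case
    by (simp add: visited_def endpoint_def x_max_def y_max_def ne_corner_def zero_prod_def)
next
  case (snoc d w)
  show ?case
  proof (cases "run w")
    case None
    with snoc show ?thesis
      by (simp add: two_sided_snoc)
  next
    case (Some s)
    with snoc at_state_snoc[of w s d] show ?thesis
      by simp
  qed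
qed

lemma two_sided_iff_run: "two_sided w \<longleftrightarrow> (\<exists>s. run w = Some s)"
  using run_characterizes_two_sided[of w] by (auto split: option.splits)

fun state_dist :: "state \<Rightarrow> nat" where
  "state_dist (Corner a b) = 0"
| "state_dist (Edge e i m) = Suc i"

lemma corner_dist_eq_state_dist:
  assumes "run w = Some s"
  shows "corner_dist w = real (state_dist s)"
proof -
  have "at_state w s"
    using run_characterizes_two_sided[of w] assms by simp
  then show ?thesis
    by (cases s rule: state_dist.cases; cases "endpoint w")
      (auto simp: corner_dist_def X_def Y_def ne_corner_def dist_Pair_Pair dist_real_def elim!: at_state.elims)
qed

lemma state_dist_le_length: "run w = Some s \<Longrightarrow> state_dist s \<le> length w"
proof (induction w arbitrary: s rule: rev_induct)
  case (snoc d w)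
  then obtain s' where "run w = Some s'" and step: "next_state s' d = Some s"
    by (auto simp: bind_eq_Some_conv)
  then have "state_dist s' \<le> length w"
    using snoc by blast
  with step show ?case
    by (cases "(s', d)" rule: next_state.cases) (auto split: if_splits nat.splits)
qed auto

fun step_weight :: "complex \<Rightarrow> complex \<Rightarrow> step \<Rightarrow> complex" where
  "step_weight x y North = y"
| "step_weight x y East = x"
| "step_weight x y South = inverse y"
| "step_weight x y West = inverse x"

definition walk_weight :: "complex \<Rightarrow> complex \<Rightarrow> step list \<Rightarrow> complex" where
  "walk_weight x y w = prod_list (map (step_weight x y) w)"

definition runs_to :: "nat \<Rightarrow> state \<Rightarrow> step list set" where
  "runs_to n s = {w. length w = n \<and> run w = Some s}"

definition state_sum :: "complex \<Rightarrow> complex \<Rightarrow> nat \<Rightarrow> state \<Rightarrow> complex" where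
  "state_sum x y n s = (\<Sum>w\<in>runs_to n s. walk_weight x y w)"

lemma runs_to_subset: "runs_to n s \<subseteq> two_sided_walks n"
  by (auto simp: runs_to_def two_sided_walks_def two_sided_iff_run)

lemma finite_runs_to [simp]: "finite (runs_to n s)"
  using finite_subset[OF runs_to_subset finite_two_sided_walks] .

text \<open>
  The generating function of the words that lead to \<open>s\<close> is determined by those of the
  predecessors of \<open>s\<close>, which are finitely many even though the automaton is infinite.
\<close>

definition preds :: "state \<Rightarrow> (state \<times> step) set" where
  "preds s = {(s', d). next_state s' d = Some s}"

lemma preds_simps:
  "preds (Corner True True) = {}"
  "preds (Corner True False) = {(Corner True True, North), (Corner True False, North),
     (Corner False True, North), (Corner False False, North)}"
  "preds (Corner False True) = {(Corner True True, East), (Corner True False, East),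
     (Corner False True, East), (Corner False False, East)}"
  "preds (Corner False False) = {(Edge OnTop 0 Forward, East), (Edge OnTop 0 Back, East),
     (Edge OnRight 0 Forward, North), (Edge OnRight 0 Back, North)}"
  "preds (Edge e i Forward) = {(Edge e i Forward, forward_step e), (Edge e i Away, forward_step e),
     (Edge e i Back, forward_step e)}"
  "preds (Edge e 0 Away) = {(Corner True True, away_step e),
     (Corner (e = OnTop) (e = OnRight), away_step e)}"
  "preds (Edge e (Suc i) Away) = {(Edge e i Forward, away_step e), (Edge e i Away, away_step e)}"
  "preds (Edge e i Back) = {(Edge e (Suc i) Forward, back_step e), (Edge e (Suc i) Back, back_step e)}"
proof -
  have "(s', d) \<in> preds s \<longleftrightarrow> next_state s' d = Some s" for s' d s
    by (simp add: preds_def)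
  note P = this
  have T: "A = B" if "\<And>a b d. (Corner a b, d) \<in> A \<longleftrightarrow> (Corner a b, d) \<in> B"
    "\<And>e i m d. (Edge e i m, d) \<in> A \<longleftrightarrow> (Edge e i m, d) \<in> B" for A B :: "(state \<times> step) set"
    using that by (auto, (metis state.exhaust)+)
  show "preds (Corner True True) = {}"
    apply (rule T; simp only: P)
    subgoal for a b d by (cases d) auto
    subgoal for e i m d by (auto split: nat.splits)
    done
  show  "preds (Corner True False) = {(Corner True True, North), (Corner True False, North),
     (Corner False True, North), (Corner False False, North)}"
    apply (rule T; simp only: P)
    subgoal for a b d by (cases d) auto
    subgoal for e i m d by (auto split: nat.splits)
    done
  show "preds (Corner False True) = {(Corner True True, East), (Corner True False, East),
     (Corner False True, East), (Corner False False, East)}"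
    apply (rule T; simp only: P)
    subgoal for a b d by (cases d) auto
    subgoal for e i m d by (auto split: nat.splits)
    done
  show "preds (Corner False False) = {(Edge OnTop 0 Forward, East), (Edge OnTop 0 Back, East),
     (Edge OnRight 0 Forward, North), (Edge OnRight 0 Back, North)}"
    apply (rule T; simp only: P)
    subgoal for a b d by (cases d) auto
    subgoal for e i m d by (cases e; cases m) (auto split: nat.splits)
    done
  show "preds (Edge e i Forward) = {(Edge e i Forward, forward_step e), (Edge e i Away, forward_step e),
     (Edge e i Back, forward_step e)}"
    apply (rule T; simp only: P)
    subgoal for a b d by (cases d) auto
    subgoal for e' i' m d by (cases m) (auto split: nat.splits)
    done
  show "preds (Edge e 0 Away) = {(Corner True True, away_step e),
     (Corner (e = OnTop) (e = OnRight), away_step e)}"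
    apply (rule T; simp only: P)
    subgoal for a b d by (cases d; cases e) auto
    subgoal for e' i' m d by (cases m) (auto split: nat.splits)
    done
  show "preds (Edge e (Suc i) Away) = {(Edge e i Forward, away_step e), (Edge e i Away, away_step e)}"
    apply (rule T; simp only: P)
    subgoal for a b d by (cases d) auto
    subgoal for e' i' m d by (cases m; cases e'; cases e; cases d) (auto split: nat.splits)
    done
  show "preds (Edge e i Back) = {(Edge e (Suc i) Forward, back_step e), (Edge e (Suc i) Back, back_step e)}"
    apply (rule T; simp only: P)
    subgoal for a b d by (cases d) auto
    subgoal for e' i' m d by (cases m; cases e'; cases e; cases d) (auto split: nat.splits)
    done
qed

lemma finite_preds [simp]: "finite (preds s)"
proof (cases s)
  case (Corner a b)
  then show ?thesis by (cases a; cases b) (simp_all add: preds_simps)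
next
  case (Edge e i m)
  then show ?thesis by (cases m; cases i) (simp_all add: preds_simps)
qed

lemma state_sum_0: "state_sum x y 0 s = (if s = Corner True True then 1 else 0)"
proof -
  have "runs_to 0 s = (if s = Corner True True then {[]} else {})"
    by (auto simp: runs_to_def)
  then show ?thesis
    by (simp add: state_sum_def walk_weight_def)
qed

lemma state_sum_Suc:
  "state_sum x y (Suc n) s = (\<Sum>(s', d)\<in>preds s. step_weight x y d * state_sum x y n s')"
proof -
  define I :: "(state \<times> step) \<times> step list \<Rightarrow> step list" where "I = (\<lambda>q. snd q @ [snd (fst q)])"
  define J where "J = (\<lambda>w :: step list. ((the (run (butlast w)), last w), butlast w))"
  have "state_sum x y (Suc n) s =
      (\<Sum>q\<in>(SIGMA p:preds s. runs_to n (fst p)). step_weight x y (snd (fst q)) * walk_weight x y (snd q))"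
    unfolding state_sum_def
  proof (rule sum.reindex_bij_witness[where i = I and j = J])
    fix w assume "w \<in> runs_to (Suc n) s"
    then obtain u d where w: "w = u @ [d]" and "length u = n" and "run (u @ [d]) = Some s"
      by (cases w rule: rev_cases) (auto simp: runs_to_def)
    then obtain s' where s': "run u = Some s'" "next_state s' d = Some s"
      by (auto simp: bind_eq_Some_conv)
    then show "J w \<in> (SIGMA p:preds s. runs_to n (fst p))"
      using \<open>length u = n\<close> by (simp add: J_def w preds_def runs_to_def)
    show "I (J w) = w"
      by (simp add: I_def J_def w)
    show "step_weight x y (snd (fst (J w))) * walk_weight x y (snd (J w)) = walk_weight x y w"
      by (simp add: J_def w walk_weight_def mult.commute)
  qed (auto simp: I_def J_def runs_to_def preds_def)
  also have "\<dots> = (\<Sum>(s', d)\<in>preds s. step_weight x y d * state_sum x y n s')"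
    unfolding state_sum_def sum_distrib_left case_prod_unfold
    by (subst sum.Sigma) (simp_all add: case_prod_unfold)
  finally show ?thesis .
qed

text \<open>
  The factor \<open>fps_X\<close> in the system makes its solution unique: each coefficient is determined by
  coefficients of lower degree.
\<close>

lemma state_sum_eq_fps_nth:
  fixes F :: "state \<Rightarrow> complex fps"
  assumes "\<And>s. F s = (if s = Corner True True then 1 else 0) +
              fps_X * (\<Sum>(s', d)\<in>preds s. fps_const (step_weight x y d) * F s')"
  shows "state_sum x y n s = fps_nth (F s) n"
proof (induction n arbitrary: s)
  case 0
  show ?case
    by (subst assms) (simp add: state_sum_0)
next
  case (Suc n)
  show ?case
    by (subst assms) (simp add: state_sum_Suc Suc fps_sum_nth case_prod_unfold)
qed

definition corner_states :: "state set" where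
  "corner_states = {Corner True True, Corner True False, Corner False True, Corner False False}"

definition edge_states :: "nat \<Rightarrow> state set" where
  "edge_states i = (\<lambda>(e, m). Edge e i m) ` ({OnTop, OnRight} \<times> {Forward, Away, Back})"

text \<open>
  For \<open>\<phi> = (\<lambda>_. 1)\<close> this is the total weight of the walks of length \<open>n\<close>. Other functions
  \<open>\<phi>\<close> of the distance to the corner give its distribution and its mean.
\<close>

definition dist_sum :: "(nat \<Rightarrow> complex) \<Rightarrow> complex \<Rightarrow> complex \<Rightarrow> nat \<Rightarrow> complex" where
  "dist_sum \<phi> x y n = (\<Sum>w\<in>two_sided_walks n. \<phi> (state_dist (the (run w))) * walk_weight x y w)"

abbreviation walk_sum :: "complex \<Rightarrow> complex \<Rightarrow> nat \<Rightarrow> complex" where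
  "walk_sum \<equiv> dist_sum (\<lambda>_. 1)"

lemma dist_sum_eq_state_sums:
  "dist_sum \<phi> x y n = \<phi> 0 * (\<Sum>s\<in>corner_states. state_sum x y n s) +
     (\<Sum>i<n. \<phi> (Suc i) * (\<Sum>s\<in>edge_states i. state_sum x y n s))"
proof -
  define S where "S = corner_states \<union> (\<Union>i<n. edge_states i)"
  have fin: "finite corner_states" "finite (edge_states i)" for i
    by (auto simp: corner_states_def edge_states_def)
  have "run w \<in> Some ` S" if "w \<in> two_sided_walks n" for w
  proof -
    obtain s where s: "run w = Some s" "length w = n"
      using \<open>w \<in> two_sided_walks n\<close> by (auto simp: two_sided_walks_def two_sided_iff_run)
    have "s \<in> S"
    proof (cases s)
      case (Corner a b)
      then show ?thesis by (cases a; cases b) (auto simp: S_def corner_states_def)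
    next
      case (Edge e i m)
      moreover have "i < n"
        using state_dist_le_length[OF s(1)] s(2) Edge by simp
      moreover have "e \<in> {OnTop, OnRight}" "m \<in> {Forward, Away, Back}"
        by (cases e; simp) (cases m; simp)
      ultimately show ?thesis
        unfolding S_def edge_states_def by (auto intro!: bexI[of _ i])
    qed
    with s show ?thesis by simp
  qed
  then have U: "two_sided_walks n = (\<Union>s\<in>S. runs_to n s)"
    using runs_to_subset by (fastforce simp: runs_to_def two_sided_walks_def)
  have "dist_sum \<phi> x y n = (\<Sum>s\<in>S. \<Sum>w\<in>runs_to n s. \<phi> (state_dist (the (run w))) * walk_weight x y w)"
    unfolding dist_sum_def U
    by (rule sum.UNION_disjoint) (auto simp: S_def fin, auto simp: runs_to_def)
  also have "\<dots> = (\<Sum>s\<in>S. \<phi> (state_dist s) * state_sum x y n s)"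
    by (intro sum.cong refl) (simp add: state_sum_def sum_distrib_left runs_to_def)
  also have "\<dots> = (\<Sum>s\<in>corner_states. \<phi> (state_dist s) * state_sum x y n s) +
      (\<Sum>s\<in>(\<Union>i<n. edge_states i). \<phi> (state_dist s) * state_sum x y n s)"
    unfolding S_def
    by (rule sum.union_disjoint) (auto simp: fin, auto simp: corner_states_def edge_states_def)
  also have "(\<Sum>s\<in>(\<Union>i<n. edge_states i). \<phi> (state_dist s) * state_sum x y n s) =
      (\<Sum>i<n. \<Sum>s\<in>edge_states i. \<phi> (state_dist s) * state_sum x y n s)"
    by (rule sum.UNION_disjoint) (auto simp: fin, auto simp: edge_states_def)
  also have "\<dots> = (\<Sum>i<n. \<phi> (Suc i) * (\<Sum>s\<in>edge_states i. state_sum x y n s))"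
    by (intro sum.cong refl) (simp add: edge_states_def algebra_simps)
  also have "(\<Sum>s\<in>corner_states. \<phi> (state_dist s) * state_sum x y n s) =
      \<phi> 0 * (\<Sum>s\<in>corner_states. state_sum x y n s)"
    by (simp add: corner_states_def algebra_simps)
  finally show ?thesis .
qed

section \<open>Coefficients of a function with a moving simple pole\<close>

text \<open>
  Multiplication by \<open>a - t\<close> turns the coefficients of \<open>Q t / (a - t)\<close> into the partial sums of the
  Taylor series of \<open>Q\<close> at \<open>a\<close>. Cauchy's inequality on the circle of radius \<open>R\<close> bounds the missing tail,
  and the bound depends on \<open>Q\<close> only through \<open>M\<close>; this is what makes it uniform in a parameter.
\<close>

lemma simple_pole_coefficient_bound:
  fixes Q :: "complex \<Rightarrow> complex"
  assumes hol: "Q holomorphic_on ball 0 R" and cont: "continuous_on (cball 0 R) Q"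
    and M: "\<And>t. norm t = R \<Longrightarrow> norm (Q t) \<le> M"
    and R: "R > 0" and a: "a \<noteq> 0" "norm a \<le> \<theta> * R" and \<theta>: "0 \<le> \<theta>" "\<theta> < 1"
    and F: "(\<lambda>t. Q t / (a - t)) has_fps_expansion F"
  shows "norm (a ^ Suc n * fps_nth F n - Q a) \<le> M * \<theta> ^ Suc n / (1 - \<theta>)"
proof -
  define q where "q = fps_expansion Q 0"
  have Qq: "Q has_fps_expansion q"
    unfolding q_def by (rule has_fps_expansion_fps_expansion[OF _ _ hol]) (use R in auto)
  have "(\<lambda>t. (a - t) * (Q t / (a - t))) has_fps_expansion (fps_const a - fps_X) * F"
    by (intro fps_expansion_intros F)
  moreover have "eventually (\<lambda>t. (a - t) * (Q t / (a - t)) = Q t) (nhds 0)"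
  proof -
    have "eventually (\<lambda>t. t \<in> - {a}) (nhds 0)"
      by (rule eventually_nhds_in_open) (use a in auto)
    then show ?thesis by eventually_elim auto
  qed
  ultimately have "Q has_fps_expansion (fps_const a - fps_X) * F"
    by (simp cong: has_fps_expansion_cong)
  then have q: "q = (fps_const a - fps_X) * F"
    using Qq fps_expansion_unique_complex by blast
  have part: "a ^ Suc n * fps_nth F n = (\<Sum>k\<le>n. fps_nth q k * a ^ k)" for n
  proof (induction n)
    case 0
    show ?case by (simp add: q left_diff_distrib)
  next
    case (Suc n)
    have "a * fps_nth F (Suc n) = fps_nth F n + fps_nth q (Suc n)"
      by (simp add: q left_diff_distrib)
    then have "a ^ Suc n * (a * fps_nth F (Suc n)) = a ^ Suc n * (fps_nth F n + fps_nth q (Suc n))"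
      by simp
    then have "a ^ Suc (Suc n) * fps_nth F (Suc n) = a ^ Suc n * fps_nth F n + fps_nth q (Suc n) * a ^ Suc n"
      by (simp only: power_Suc2[of a "Suc n"] mult.assoc distrib_left mult.commute[of _ "a ^ Suc n"])
    with Suc show ?case by simp
  qed
  have sums: "(\<lambda>k. fps_nth q k * a ^ k) sums Q a"
  proof (rule has_fps_expansion_imp_sums_complex[OF Qq])
    show "Q holomorphic_on eball 0 (ereal R)" using hol by simp
    have "\<theta> * R < R" using \<theta> R by simp
    then show "ereal (norm a) < ereal R" using a by simp
  qed
  have M0: "0 \<le> M"
    using M[of "of_real R"] R norm_ge_zero[of "Q (of_real R)"] by (simp del: norm_ge_zero)
  have coef: "norm (fps_nth q k * a ^ k) \<le> M * \<theta> ^ k" for k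
  proof -
    have "norm ((deriv ^^ k) Q 0) \<le> fact k * M / R ^ k"
      by (rule Cauchy_inequality[OF hol cont R]) (use M in auto)
    then have "norm (fps_nth q k) \<le> M / R ^ k"
      unfolding fps_nth_fps_expansion[OF Qq] by (simp add: norm_divide field_simps)
    then have "norm (fps_nth q k * a ^ k) \<le> (M / R ^ k) * (\<theta> * R) ^ k"
      unfolding norm_mult norm_power using a R M0
      by (intro mult_mono power_mono) auto
    then show ?thesis using R by (simp add: power_mult_distrib)
  qed
  have "(\<lambda>k. fps_nth q (k + Suc n) * a ^ (k + Suc n)) sums (Q a - (\<Sum>k<Suc n. fps_nth q k * a ^ k))"
    by (rule sums_split_initial_segment[OF sums])
  then have tail: "(\<lambda>k. fps_nth q (k + Suc n) * a ^ (k + Suc n)) sums (Q a - a ^ Suc n * fps_nth F n)"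
    unfolding part lessThan_Suc_atMost .
  have geo: "(\<lambda>k. M * \<theta> ^ Suc n * \<theta> ^ k) sums (M * \<theta> ^ Suc n * (1 / (1 - \<theta>)))"
    by (intro sums_mult geometric_sums) (use \<theta> in auto)
  have "norm (Q a - a ^ Suc n * fps_nth F n) \<le> M * \<theta> ^ Suc n * (1 / (1 - \<theta>))"
    unfolding sums_unique[OF tail] sums_unique[OF geo]
  proof (rule norm_suminf_le)
    fix k
    show "norm (fps_nth q (k + Suc n) * a ^ (k + Suc n)) \<le> M * \<theta> ^ Suc n * \<theta> ^ k"
      using coef[of "k + Suc n"] by (simp add: power_add mult_ac)
  qed (use geo sums_summable in blast)
  then show ?thesis
    by (simp add: norm_minus_commute)
qed

lemma uniformly_close_near_0:
  fixes f :: "complex \<Rightarrow> complex \<Rightarrow> complex"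
  assumes cont: "continuous_on (ball 0 \<delta> \<times> S) (\<lambda>(z, t). f z t)" and K: "compact K" "K \<subseteq> S"
    and "\<delta> > 0" "e > 0"
  obtains d where "0 < d" "d \<le> \<delta>" "\<And>z t. norm z < d \<Longrightarrow> t \<in> K \<Longrightarrow> norm (f z t - f 0 t) \<le> e"
proof -
  have "continuous_on (ball 0 \<delta> \<times> K) (\<lambda>(z, t). f z t)"
    by (rule continuous_on_subset[OF cont]) (use K in auto)
  then obtain X0 where X0: "0 \<in> X0" "open X0"
    "\<forall>x\<in>X0 \<inter> ball 0 \<delta>. \<forall>t\<in>K. dist (f x t) (f 0 t) \<le> e"
    using continuous_on_prod_compactE[of "ball 0 \<delta>" K "\<lambda>(z, t). f z t" 0 e] assms by auto
  then obtain d where d: "d > 0" "ball 0 d \<subseteq> X0"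
    using open_contains_ball by blast
  show ?thesis
  proof (rule that[of "min d \<delta>"])
    show "norm (f z t - f 0 t) \<le> e" if "norm z < min d \<delta>" "t \<in> K" for z t
      using X0(3) d that by (auto simp: dist_norm)
  qed (use d assms in auto)
qed

text \<open>
  If \<open>D z\<close> had no zero in the disc, the maximum modulus principle would apply to \<open>1 / D z\<close>. But
  \<open>\<bar>D z\<bar>\<close> is bounded below on the circle and almost vanishes at the centre.
\<close>

lemma zero_persists:
  fixes D :: "complex \<Rightarrow> complex \<Rightarrow> complex"
  assumes cont: "continuous_on (ball 0 \<delta> \<times> S) (\<lambda>(z, t). D z t)" and S: "cball c \<epsilon> \<subseteq> S"
    and hol: "\<And>z. norm z < \<delta> \<Longrightarrow> D z holomorphic_on S"
    and "\<delta> > 0" "\<epsilon> > 0" and c: "D 0 c = 0" and nz: "\<And>t. t \<in> sphere c \<epsilon> \<Longrightarrow> D 0 t \<noteq> 0"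
  obtains d where "0 < d" "d \<le> \<delta>" "\<And>z. norm z < d \<Longrightarrow> \<exists>t\<in>ball c \<epsilon>. D z t = 0"
proof -
  have hol0: "D 0 holomorphic_on S" using hol \<open>\<delta> > 0\<close> by simp
  have contn: "continuous_on (sphere c \<epsilon>) (\<lambda>t. norm (D 0 t))"
    by (intro continuous_on_norm holomorphic_on_imp_continuous_on
        holomorphic_on_subset[OF hol0]) (use S sphere_cball in blast)
  obtain t0 where t0: "t0 \<in> sphere c \<epsilon>" "\<And>t. t \<in> sphere c \<epsilon> \<Longrightarrow> norm (D 0 t0) \<le> norm (D 0 t)"
    using continuous_attains_inf[OF compact_sphere _ contn] \<open>\<epsilon> > 0\<close> by auto
  define m where "m = norm (D 0 t0)"
  have m: "m > 0" using nz[OF t0(1)] by (simp add: m_def)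
  obtain d where d: "0 < d" "d \<le> \<delta>"
    "\<And>z t. norm z < d \<Longrightarrow> t \<in> cball c \<epsilon> \<Longrightarrow> norm (D z t - D 0 t) \<le> m / 3"
    using uniformly_close_near_0[OF cont compact_cball S \<open>\<delta> > 0\<close>, of "m / 3"] m by auto
  have "\<exists>t\<in>ball c \<epsilon>. D z t = 0" if z: "norm z < d" for z
  proof (rule ccontr)
    assume no: "\<not> (\<exists>t\<in>ball c \<epsilon>. D z t = 0)"
    have holz: "D z holomorphic_on S" using hol z d by auto
    have on_sphere: "2 * m / 3 \<le> norm (D z t)" if "t \<in> sphere c \<epsilon>" for t
    proof -
      have "norm (D 0 t) \<le> norm (D z t) + norm (D 0 t - D z t)" by (rule norm_triangle_sub)
      then show ?thesis
        using t0(2)[OF that] d(3)[OF z, of t] that m by (auto simp: m_def norm_minus_commute)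
    qed
    have nz: "D z t \<noteq> 0" if "t \<in> cball c \<epsilon>" for t
    proof (cases "t \<in> sphere c \<epsilon>")
      case True
      then show ?thesis using on_sphere[OF True] m by auto
    next
      case False
      then show ?thesis using no that by (auto simp: less_eq_real_def)
    qed
    have h: "(\<lambda>t. 1 / D z t) holomorphic_on cball c \<epsilon>"
      by (intro holomorphic_intros holomorphic_on_subset[OF holz] S) (use nz in auto)
    have "norm (1 / D z c) \<le> 3 / (2 * m)"
    proof (rule maximum_modulus_frontier[where S = "cball c \<epsilon>" and f = "\<lambda>t. 1 / D z t"])
      show "(\<lambda>t. 1 / D z t) holomorphic_on interior (cball c \<epsilon>)"
        by (rule holomorphic_on_subset[OF h]) (rule interior_subset)
      show "continuous_on (closure (cball c \<epsilon>)) (\<lambda>t. 1 / D z t)"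
        using holomorphic_on_imp_continuous_on[OF h] by simp
      show "norm (1 / D z t) \<le> 3 / (2 * m)" if "t \<in> frontier (cball c \<epsilon>)" for t
      proof -
        have "t \<in> sphere c \<epsilon>" using that by simp
        then have "2 * m / 3 \<le> norm (D z t)" "0 < norm (D z t)"
          using on_sphere[of t] m by auto
        then show ?thesis using m by (simp add: norm_divide divide_le_eq)
      qed
    qed (use \<open>\<epsilon> > 0\<close> in auto)
    then have "2 * m / 3 \<le> norm (D z c)"
      using nz[of c] \<open>\<epsilon> > 0\<close> m by (simp add: norm_divide field_simps)
    moreover have "norm (D z c) \<le> m / 3"
      using d(3)[OF z, of c] c \<open>\<epsilon> > 0\<close> by simp
    ultimately show False using m by simp
  qed
  then show ?thesis using that d by blast
qed

lemma zeros_stay_close: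
  fixes D :: "complex \<Rightarrow> complex \<Rightarrow> complex"
  assumes cont: "continuous_on (ball 0 \<delta> \<times> S) (\<lambda>(z, t). D z t)" and K: "compact K" "K \<subseteq> S"
    and "\<delta> > 0" "\<epsilon> > 0" and uniq: "\<And>t. t \<in> K \<Longrightarrow> D 0 t = 0 \<Longrightarrow> t = \<rho>"
  obtains d where "0 < d" "d \<le> \<delta>"
    "\<And>z t. norm z < d \<Longrightarrow> t \<in> K \<Longrightarrow> D z t = 0 \<Longrightarrow> dist t \<rho> < \<epsilon>"
proof (cases "K - ball \<rho> \<epsilon> = {}")
  case True
  then have "dist t \<rho> < \<epsilon>" if "t \<in> K" for t using that by (auto simp: dist_commute)
  then show ?thesis using that[of \<delta>] \<open>\<delta> > 0\<close> by auto
next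
  case False
  define L where "L = K - ball \<rho> \<epsilon>"
  have L: "compact L" "L \<noteq> {}" "L \<subseteq> S"
    using False K by (auto simp: L_def intro: compact_diff)
  have "continuous_on L (\<lambda>t. (\<lambda>(z, t). D z t) (0, t))"
    by (rule continuous_on_compose2[OF cont]) (use \<open>\<delta> > 0\<close> L in \<open>auto intro!: continuous_intros\<close>)
  then have "continuous_on L (\<lambda>t. norm (D 0 t))"
    by (auto intro: continuous_on_norm)
  from continuous_attains_inf[OF L(1,2) this]
  obtain t0 where t0: "t0 \<in> L" "\<And>t. t \<in> L \<Longrightarrow> norm (D 0 t0) \<le> norm (D 0 t)" by auto
  define m where "m = norm (D 0 t0)"
  have m: "m > 0" using t0 uniq[of t0] \<open>\<epsilon> > 0\<close> by (auto simp: m_def L_def)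
  obtain d where d: "0 < d" "d \<le> \<delta>"
    "\<And>z t. norm z < d \<Longrightarrow> t \<in> L \<Longrightarrow> norm (D z t - D 0 t) \<le> m / 2"
    using uniformly_close_near_0[OF cont L(1,3) \<open>\<delta> > 0\<close>, of "m / 2"] m by auto
  show ?thesis
  proof (rule that[OF d(1,2)])
    fix z t assume zt: "norm z < d" "t \<in> K" "D z t = 0"
    show "dist t \<rho> < \<epsilon>"
    proof (rule ccontr)
      assume "\<not> dist t \<rho> < \<epsilon>"
      then have "t \<in> L" using zt by (auto simp: L_def dist_commute)
      then have "norm (D 0 t) \<le> m / 2" "m \<le> norm (D 0 t)"
        using d(3)[OF zt(1), of t] t0(2)[of t] zt(3) by (auto simp: m_def)
      with m show False by linarith
    qed
  qed
qed

text \<open>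
  The zero \<open>r z\<close> of \<open>D z\<close> exists and tends to \<open>\<rho>\<close>. The quotient \<open>E z t = D z t / (r z - t)\<close> is
  holomorphic in \<open>t\<close>, and on a circle around \<open>\<rho>\<close> it is uniformly close to \<open>E 0\<close>; by the maximum modulus
  principle the same is true inside, so \<open>E z\<close> is bounded away from 0. Hence \<open>N z / E z\<close> is bounded
  uniformly in \<open>z\<close>, and \<open>simple_pole_coefficient_bound\<close> gives the uniform limit. The function \<open>r\<close>
  is holomorphic because it is the uniform limit of \<open>p n z / p (Suc n) z\<close>.
\<close>

lemma simple_pole_perturbation:
  fixes D N :: "complex \<Rightarrow> complex \<Rightarrow> complex" and p :: "nat \<Rightarrow> complex \<Rightarrow> complex" and \<rho> :: complex
  assumes \<delta>: "\<delta> > 0" and \<rho>: "\<rho> \<noteq> 0" "norm \<rho> < R"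
    and contD: "continuous_on (ball 0 \<delta> \<times> ball 0 R) (\<lambda>(z, t). D z t)"
    and contN: "continuous_on (ball 0 \<delta> \<times> ball 0 R) (\<lambda>(z, t). N z t)"
    and holD: "\<And>z. norm z < \<delta> \<Longrightarrow> D z holomorphic_on ball 0 R"
    and holN: "\<And>z. norm z < \<delta> \<Longrightarrow> N z holomorphic_on ball 0 R"
    and zero: "D 0 \<rho> = 0" and simple: "deriv (D 0) \<rho> \<noteq> 0"
    and uniq: "\<And>t. norm t < R \<Longrightarrow> D 0 t = 0 \<Longrightarrow> t = \<rho>" and N0: "N 0 \<rho> \<noteq> 0"
    and expansion: "\<And>z. norm z < \<delta> \<Longrightarrow>
          (\<lambda>t. N z t / D z t) has_fps_expansion Abs_fps (\<lambda>n. p n z)"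
    and holp: "\<And>n. p n holomorphic_on ball 0 \<delta>"
  obtains d r \<kappa> where "0 < d" "d \<le> \<delta>" "r holomorphic_on ball 0 d" "r 0 = \<rho>"
    "\<And>z. norm z < d \<Longrightarrow> norm (r z) < R \<and> D z (r z) = 0"
    "\<kappa> holomorphic_on ball 0 d" "\<kappa> 0 = - N 0 \<rho> / (\<rho> * deriv (D 0) \<rho>)"
    "uniform_limit (ball 0 d) (\<lambda>n z. p n z * r z ^ n) \<kappa> sequentially"
proof -
  define R1 where "R1 = (norm \<rho> + R) / 2"
  have R1: "norm \<rho> < R1" "R1 < R" "R1 > 0"
    using \<rho> norm_ge_zero[of \<rho>] by (auto simp: R1_def simp del: norm_ge_zero)
  have RS: "cball 0 R1 \<subseteq> ball (0::complex) R" using R1 by auto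
  have hol0: "D 0 holomorphic_on ball 0 R" using holD \<delta> by simp
  define \<eta> where "\<eta> = min ((R1 - norm \<rho>) / 2) (norm \<rho> / 2)"
  have \<eta>: "\<eta> > 0" "norm \<rho> + \<eta> < R1" "\<eta> \<le> norm \<rho> / 2" "norm \<rho> + \<eta> \<le> (R1 + norm \<rho>) / 2"
    using R1 \<rho> by (auto simp: \<eta>_def min_def field_simps)
  define r where "r = (\<lambda>z. SOME t. t \<in> cball 0 R1 \<and> D z t = 0)"

  \<comment> \<open>Any zero will do as \<open>r z\<close>: for small \<open>z\<close> all of them are close to \<open>\<rho>\<close>.\<close>
  have close: "\<exists>d>0. d \<le> \<delta> \<and> (\<forall>z. norm z < d \<longrightarrow>
      norm (r z) \<le> R1 \<and> D z (r z) = 0 \<and> dist (r z) \<rho> < e)" if "e > 0" for e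
  proof -
    have sub: "cball \<rho> \<eta> \<subseteq> ball 0 R"
    proof
      fix t assume "t \<in> cball \<rho> \<eta>"
      then show "t \<in> ball 0 R"
        using norm_triangle_sub[of t \<rho>] \<eta> R1 by (auto simp: dist_norm norm_minus_commute)
    qed
    have in_R1: "t \<in> cball 0 R1" if "t \<in> cball \<rho> \<eta>" for t
      using norm_triangle_sub[of t \<rho>] \<eta> that by (auto simp: dist_norm norm_minus_commute)
    obtain d1 where d1: "0 < d1" "d1 \<le> \<delta>" "\<And>z. norm z < d1 \<Longrightarrow> \<exists>t\<in>ball \<rho> \<eta>. D z t = 0"
      by (rule zero_persists[OF contD sub holD \<delta> \<eta>(1) zero]) (use uniq sub \<eta> in \<open>auto\<close>)
    obtain d2 where d2: "0 < d2" "d2 \<le> \<delta>"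
      "\<And>z t. norm z < d2 \<Longrightarrow> t \<in> cball 0 R1 \<Longrightarrow> D z t = 0 \<Longrightarrow> dist t \<rho> < e"
      by (rule zeros_stay_close[OF contD compact_cball RS \<delta> \<open>e > 0\<close>]) (use uniq RS in auto)
    show ?thesis
    proof (intro exI[of _ "min d1 d2"] conjI allI impI)
      fix z :: complex assume z: "norm z < min d1 d2"
      then have "\<exists>t. t \<in> cball 0 R1 \<and> D z t = 0"
        using d1(3)[of z] in_R1 by (force simp: less_imp_le)
      then have "r z \<in> cball 0 R1 \<and> D z (r z) = 0"
        unfolding r_def by (rule someI_ex)
      then show "norm (r z) \<le> R1" "D z (r z) = 0" "dist (r z) \<rho> < e"
        using d2(3)[of z "r z"] z by auto
    qed (use d1 d2 in auto)
  qed
  have r0: "r 0 = \<rho>"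
  proof -
    have "norm (r 0) \<le> R1 \<and> D 0 (r 0) = 0"
      using close[of 1] by force
    then show ?thesis using uniq[of "r 0"] R1 by auto
  qed

  define E where "E = (\<lambda>z t. if t = r z then - deriv (D z) (r z) else D z t / (r z - t))"
  have holE: "E z holomorphic_on ball 0 R"
    if "norm z < \<delta>" "norm (r z) < R" "D z (r z) = 0" for z
  proof -
    have "(\<lambda>t. - E z t) holomorphic_on ball 0 R"
    proof (rule pole_theorem_open_0[OF holD[OF that(1)]])
      show "D z t = (t - r z) * - E z t" if "t \<in> ball 0 R - {r z}" for t
      proof -
        have "E z t = D z t / (r z - t)" "r z - t \<noteq> 0" using that by (auto simp: E_def)
        then have "D z t = (r z - t) * E z t" by simp
        then show ?thesis by (simp add: algebra_simps)
      qed
    qed (use that in \<open>auto simp: E_def\<close>)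
    from holomorphic_on_minus[OF this] show ?thesis by simp
  qed
  have holE0: "E 0 holomorphic_on ball 0 R"
    using holE[of 0] \<delta> \<rho> zero by (simp add: r0)
  have E0_nz: "E 0 t \<noteq> 0" if "norm t < R" for t
    using simple uniq[OF that] by (auto simp: E_def r0)
  have contE0: "continuous_on (cball 0 R1) (\<lambda>t. norm (E 0 t))"
    by (intro continuous_on_norm holomorphic_on_imp_continuous_on holomorphic_on_subset[OF holE0] RS)
  obtain t0 where t0: "t0 \<in> cball 0 R1" "\<And>t. t \<in> cball 0 R1 \<Longrightarrow> norm (E 0 t0) \<le> norm (E 0 t)"
    using continuous_attains_inf[OF compact_cball _ contE0] R1 by auto
  obtain t1 where t1: "t1 \<in> cball 0 R1" "\<And>t. t \<in> cball 0 R1 \<Longrightarrow> norm (E 0 t) \<le> norm (E 0 t1)"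
    using continuous_attains_sup[OF compact_cball _ contE0] R1 by auto
  define m where "m = norm (E 0 t0)"
  have m: "m > 0" using E0_nz[of t0] t0 R1 by (auto simp: m_def)
  have t1_pos: "norm (E 0 t1) > 0" using E0_nz[of t1] t1 R1 by auto

  \<comment> \<open>The quotient depends continuously on the pair \<open>(r z, z)\<close>, which tends to \<open>(\<rho>, 0)\<close>, so compactness of
    the circle gives a uniform estimate.\<close>
  have "continuous_on ((ball \<rho> \<eta> \<times> ball 0 \<delta>) \<times> sphere 0 R1) (\<lambda>(p, t). D (snd p) t / (fst p - t))"
  proof -
    have "continuous_on ((ball \<rho> \<eta> \<times> ball 0 \<delta>) \<times> sphere 0 R1) (\<lambda>q. (\<lambda>(z, t). D z t) (snd (fst q), snd q))"
      by (rule continuous_on_compose2[OF contD]) (use R1 in \<open>auto intro!: continuous_intros\<close>)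
    moreover have "a \<noteq> t" if "a \<in> ball \<rho> \<eta>" "t \<in> sphere 0 R1" for a t
    proof
      assume "a = t"
      then have "R1 \<le> norm \<rho> + dist \<rho> a"
        using that norm_triangle_sub[of a \<rho>] by (simp add: dist_norm norm_minus_commute)
      then show False using that \<eta> by auto
    qed
    ultimately show ?thesis
      by (auto simp: case_prod_unfold intro!: continuous_intros)
  qed
  then obtain X0 where X0: "(\<rho>, 0) \<in> X0" "open X0"
    "\<forall>x\<in>X0 \<inter> (ball \<rho> \<eta> \<times> ball 0 \<delta>). \<forall>t\<in>sphere 0 R1.
        dist (D (snd x) t / (fst x - t)) (D 0 t / (\<rho> - t)) \<le> m / 2"
    using continuous_on_prod_compactE[of "ball \<rho> \<eta> \<times> ball 0 \<delta>" "sphere 0 R1"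
        "\<lambda>(p, t). D (snd p) t / (fst p - t)" "(\<rho>, 0)" "m / 2"] \<eta> \<delta> m by auto
  then obtain A B where AB: "open A" "open B" "(\<rho>, 0) \<in> A \<times> B" "A \<times> B \<subseteq> X0"
    using open_prod_elim by metis
  then obtain ea eb where e: "ea > 0" "ball \<rho> ea \<subseteq> A" "eb > 0" "ball 0 eb \<subseteq> B"
    by (metis SigmaE2 openE)
  have contN0: "continuous_on (ball 0 R) (N 0)"
    using holN[of 0] \<delta> by (auto intro: holomorphic_on_imp_continuous_on)
  have "isCont (\<lambda>(z, t). N z t) (0, \<rho>)"
    using contN \<delta> \<rho> by (subst (asm) continuous_on_eq_continuous_at) (auto intro: open_Times)
  then obtain en where en: "en > 0"
     "\<And>q. dist q (0, \<rho>) < en \<Longrightarrow> dist ((\<lambda>(z, t). N z t) q) (N 0 \<rho>) < norm (N 0 \<rho>) / 2"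
    unfolding continuous_at_eps_delta using N0 by (metis case_prod_conv half_gt_zero zero_less_norm_iff)
  obtain d0 where d0: "0 < d0" "d0 \<le> \<delta>" "\<And>z. norm z < d0 \<Longrightarrow>
      norm (r z) \<le> R1 \<and> D z (r z) = 0 \<and> dist (r z) \<rho> < min (min \<eta> ea) (en / 2)"
    using close[of "min (min \<eta> ea) (en / 2)"] \<eta> e en by auto
  define d where "d = min (min (d0 / 2) (en / 2)) eb"
  have d: "0 < d" "d < \<delta>" "d \<le> \<delta> / 2" and dd0: "d < d0"
    using d0 e en \<delta> by (auto simp: d_def)
  have zr: "norm (r z) < R1" "D z (r z) = 0" "dist (r z) \<rho> < \<eta>" "norm z < \<delta>"
      "norm (r z) \<le> norm \<rho> + \<eta>" "norm \<rho> / 2 \<le> norm (r z)" if "norm z < d" for z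
  proof -
    have a: "norm (r z) \<le> R1" "D z (r z) = 0" "dist (r z) \<rho> < \<eta>" "norm z < \<delta>"
      using d0(3)[of z] that d dd0 by auto
    have "norm (r z) \<le> norm \<rho> + dist (r z) \<rho>"
      using norm_triangle_sub[of "r z" \<rho>] by (simp add: dist_norm)
    then show "norm (r z) \<le> norm \<rho> + \<eta>" "norm (r z) < R1" using a \<eta> by auto
    have "norm \<rho> \<le> norm (r z) + dist (r z) \<rho>"
      using norm_triangle_sub[of \<rho> "r z"] by (simp add: dist_norm norm_minus_commute)
    then show "norm \<rho> / 2 \<le> norm (r z)" using a \<eta> by auto
  qed (use d0(3)[of z] that d dd0 in auto)
  have holE': "E z holomorphic_on ball 0 R" if "norm z < d" for z
    using holE[of z] zr[OF that] R1 by simp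
  have E_close: "norm (E z t - E 0 t) \<le> m / 2" if z: "norm z < d" and t: "norm t \<le> R1" for z t
  proof (rule maximum_modulus_frontier[where S = "cball 0 R1" and f = "\<lambda>t. E z t - E 0 t"])
    show "(\<lambda>t. E z t - E 0 t) holomorphic_on interior (cball 0 R1)"
      by (intro holomorphic_intros holomorphic_on_subset[OF holE'[OF z]]
          holomorphic_on_subset[OF holE0]) (use R1 in auto)
    show "continuous_on (closure (cball 0 R1)) (\<lambda>t. E z t - E 0 t)"
      using RS by (intro continuous_intros holomorphic_on_imp_continuous_on
          holomorphic_on_subset[OF holE'[OF z]] holomorphic_on_subset[OF holE0]) auto
    fix t assume "t \<in> frontier (cball (0::complex) R1)"
    then have t: "t \<in> sphere 0 R1" using R1 by auto
    have "dist (r z) \<rho> < ea" "norm z < eb" "dist (r z) \<rho> < \<eta>"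
      using d0(3)[of z] z dd0 by (auto simp: d_def)
    then have "(r z, z) \<in> A \<times> B" "(r z, z) \<in> ball \<rho> \<eta> \<times> ball 0 \<delta>"
      using e zr[OF z] by (auto simp: dist_commute subset_iff)
    then have "(r z, z) \<in> X0 \<inter> (ball \<rho> \<eta> \<times> ball 0 \<delta>)"
      using AB(4) by blast
    then have "dist (D z t / (r z - t)) (D 0 t / (\<rho> - t)) \<le> m / 2"
      using bspec[OF bspec[OF X0(3)] t] by fastforce
    moreover have "t \<noteq> r z" "t \<noteq> \<rho>" using zr(1)[OF z] t R1 by auto
    ultimately show "norm (E z t - E 0 t) \<le> m / 2"
      by (simp add: E_def r0 dist_norm)
  qed (use t in auto)
  have E_lower: "m / 2 \<le> norm (E z t)" if "norm z < d" "norm t \<le> R1" for z t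
    using E_close[OF that] t0(2)[of t] that norm_triangle_sub[of "E 0 t" "E z t"]
    by (simp add: m_def norm_minus_commute)
  have E_upper: "norm (E z t) \<le> norm (E 0 t1) + m / 2" if "norm z < d" "norm t \<le> R1" for z t
    using E_close[OF that] t1(2)[of t] that norm_triangle_sub[of "E z t" "E 0 t"]
    by (simp add: m_def norm_minus_commute)

  have "continuous_on (cball 0 (\<delta> / 2) \<times> cball 0 R1) (\<lambda>q. norm ((\<lambda>(z, t). N z t) q))"
    by (intro continuous_on_norm continuous_on_subset[OF contN]) (use \<delta> RS in auto)
  from continuous_attains_sup[OF _ _ this]
  obtain q1 where q1: "\<And>q. q \<in> cball 0 (\<delta> / 2) \<times> cball 0 R1 \<Longrightarrow>
      norm ((\<lambda>(z, t). N z t) q) \<le> norm ((\<lambda>(z, t). N z t) q1)"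
    using \<delta> R1 by (auto simp: compact_Times)
  define M1 where "M1 = norm ((\<lambda>(z, t). N z t) q1)"
  have N_upper: "norm (N z t) \<le> M1" if "norm z < d" "norm t \<le> R1" for z t
    using q1[of "(z, t)"] that d by (simp add: M1_def)
  define Q where "Q = (\<lambda>z t. N z t / E z t)"
  define M where "M = M1 / (m / 2)"
  have Q_upper: "norm (Q z t) \<le> M" if "norm z < d" "norm t \<le> R1" for z t
    unfolding Q_def M_def norm_divide
    by (rule frac_le)
      (use N_upper[OF that] E_lower[OF that] m norm_ge_zero[of "N z t"] in \<open>auto simp del: norm_ge_zero\<close>)
  have E_nz: "E z t \<noteq> 0" if "norm z < d" "norm t \<le> R1" for z t
    using E_lower[OF that] m by auto
  have holQ: "Q z holomorphic_on cball 0 R1" if "norm z < d" for z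
    unfolding Q_def
    by (intro holomorphic_intros holomorphic_on_subset[OF holE'[OF that]]
        holomorphic_on_subset[OF holN] RS) (use that zr E_nz in auto)
  define \<theta> where "\<theta> = (R1 + norm \<rho>) / 2 / R1"
  have \<theta>: "0 \<le> \<theta>" "\<theta> < 1" "\<theta> * R1 = (R1 + norm \<rho>) / 2"
    using R1 by (auto simp: \<theta>_def field_simps)
  define \<kappa>1 where "\<kappa>1 = (\<lambda>z. Q z (r z))"
  define u where "u = (\<lambda>n z. r z ^ Suc n * p n z)"
  have rate: "norm (u n z - \<kappa>1 z) \<le> M / (1 - \<theta>) * \<theta> ^ Suc n" if z: "norm z < d" for n z
  proof -
    have "norm (r z ^ Suc n * fps_nth (Abs_fps (\<lambda>n. p n z)) n - Q z (r z)) \<le> M * \<theta> ^ Suc n / (1 - \<theta>)"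
    proof (rule simple_pole_coefficient_bound[where R = R1])
      show "Q z holomorphic_on ball 0 R1" "continuous_on (cball 0 R1) (Q z)"
        using holQ[OF z] by (auto intro: holomorphic_on_subset holomorphic_on_imp_continuous_on)
      show "norm (Q z t) \<le> M" if "norm t = R1" for t
        using Q_upper[OF z, of t] that by simp
      show "norm (r z) \<le> \<theta> * R1" using zr(5)[OF z] \<eta> \<theta> by simp
      show "r z \<noteq> 0" using zr(6)[OF z] \<rho> by auto
      have "eventually (\<lambda>t. t \<in> - {r z}) (nhds 0)"
        by (rule eventually_nhds_in_open) (use \<open>r z \<noteq> 0\<close> in auto)
      then have "eventually (\<lambda>t. N z t / D z t = Q z t / (r z - t)) (nhds 0)"
        by eventually_elim (auto simp: Q_def E_def)
      then show "(\<lambda>t. Q z t / (r z - t)) has_fps_expansion Abs_fps (\<lambda>n. p n z)"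
        using expansion[OF zr(4)[OF z]] by (subst (asm) has_fps_expansion_cong[OF _ refl]) auto
    qed (use R1 \<theta> in auto)
    then show ?thesis by (simp add: u_def \<kappa>1_def)
  qed
  have lim0: "(\<lambda>n. M / (1 - \<theta>) * \<theta> ^ Suc n) \<longlonglongrightarrow> 0"
    using LIMSEQ_Suc[OF LIMSEQ_realpow_zero[OF \<theta>(1,2)]] by (rule tendsto_mult_right_zero)
  have ul: "uniform_limit (ball 0 d) u \<kappa>1 sequentially"
  proof (rule uniform_limitI)
    fix e :: real assume "e > 0"
    then have "\<forall>\<^sub>F n in sequentially. M / (1 - \<theta>) * \<theta> ^ Suc n < e"
      using order_tendstoD(2)[OF lim0] by blast
    then show "\<forall>\<^sub>F n in sequentially. \<forall>z\<in>ball 0 d. dist (u n z) (\<kappa>1 z) < e"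
      proof eventually_elim
      case (elim n)
      show ?case
      proof
        fix z :: complex assume "z \<in> ball 0 d"
        then have "norm (u n z - \<kappa>1 z) < e"
          using rate[of z n] elim by simp
        then show "dist (u n z) (\<kappa>1 z) < e" by (simp add: dist_norm)
      qed
    qed
  qed
  have r_nz: "r z \<noteq> 0" if "norm z < d" for z
    using zr(6)[OF that] \<rho> by auto
  \<comment> \<open>The limit \<open>\<kappa>1\<close> must stay away from 0 before quotients of consecutive \<open>u n\<close> may be formed.\<close>
  define c where "c = norm (N 0 \<rho>) / 2 / (norm (E 0 t1) + m / 2)"
  have c: "c > 0" using N0 t1_pos m by (auto simp: c_def intro!: divide_pos_pos add_pos_pos)
  have \<kappa>1_lower: "c \<le> norm (\<kappa>1 z)" if z: "z \<in> ball 0 d" for z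
  proof -
    have z': "norm z < d" using z by simp
    have "dist (z, r z) (0, \<rho>) \<le> norm z + dist (r z) \<rho>"
      using sqrt_sum_squares_le_sum[of "norm z" "dist (r z) \<rho>"] by (simp add: dist_Pair_Pair)
    also have "\<dots> < en"
      using d0(3)[of z] z' dd0 by (auto simp: d_def)
    finally have "dist (N z (r z)) (N 0 \<rho>) < norm (N 0 \<rho>) / 2"
      using en(2)[of "(z, r z)"] by simp
    then have "norm (N 0 \<rho>) / 2 \<le> norm (N z (r z))"
      using norm_triangle_sub[of "N 0 \<rho>" "N z (r z)"] by (simp add: dist_norm norm_minus_commute)
    then show ?thesis
      unfolding c_def \<kappa>1_def Q_def norm_divide
      using E_upper[OF z', of "r z"] E_nz[OF z', of "r z"] zr[OF z'] by (intro frac_le) auto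
  qed
  have \<kappa>1_upper: "norm (\<kappa>1 z) \<le> M" if "z \<in> ball 0 d" for z
    using Q_upper[of z "r z"] zr[of z] that by (auto simp: \<kappa>1_def)
  have bd: "bounded (\<kappa>1 ` ball 0 d)" "bounded (r ` ball 0 d)"
    by (rule boundedI[of _ M], use \<kappa>1_upper in auto)
      (rule boundedI[of _ "norm \<rho> + \<eta>"], use zr(5) in auto)
  have ulSuc: "uniform_limit (ball 0 d) (\<lambda>n. u (Suc n)) \<kappa>1 sequentially"
    by (rule filterlim_compose[OF ul filterlim_Suc])
  have "uniform_limit (ball 0 d) (\<lambda>n z. r z * (u n z / u (Suc n) z)) (\<lambda>z. r z * (\<kappa>1 z / \<kappa>1 z)) sequentially"
  proof (rule uniform_lim_mult[OF uniform_limit_const uniform_lim_divide[OF ul ulSuc bd(1) \<kappa>1_lower c] bd(2)])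
    show "bounded ((\<lambda>z. \<kappa>1 z / \<kappa>1 z) ` ball 0 d)"
      by (rule boundedI[of _ 1]) auto
  qed
  then have ratio: "uniform_limit (ball 0 d) (\<lambda>n z. p n z / p (Suc n) z) r sequentially"
  proof (rule uniform_limit_cong[THEN iffD1, rotated 2])
    show "\<forall>\<^sub>F n in sequentially. \<forall>z\<in>ball 0 d. r z * (u n z / u (Suc n) z) = p n z / p (Suc n) z"
      using r_nz by (intro always_eventually) (simp add: u_def)
    show "r z * (\<kappa>1 z / \<kappa>1 z) = r z" if "z \<in> ball 0 d" for z
      using \<kappa>1_lower[OF that] c by auto
  qed
  have "\<forall>\<^sub>F n in sequentially. \<forall>z\<in>ball 0 d. dist (u n z) (\<kappa>1 z) < c"
    using uniform_limitD[OF ul c] .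
  then obtain n0 where n0: "\<And>n z. n \<ge> n0 \<Longrightarrow> z \<in> ball 0 d \<Longrightarrow> dist (u n z) (\<kappa>1 z) < c"
    unfolding eventually_sequentially by blast
  have p_nz: "p n z \<noteq> 0" if "n \<ge> n0" "z \<in> ball 0 d" for n z
    using n0[OF that] \<kappa>1_lower[OF that(2)] by (auto simp: u_def dist_norm)
  have holpd: "p n holomorphic_on ball 0 d" for n
    by (rule holomorphic_on_subset[OF holp]) (use d in auto)
  have hol_r: "r holomorphic_on ball 0 d"
  proof (rule holomorphic_uniform_sequence)
    show "(\<lambda>z. p (n + n0) z / p (Suc (n + n0)) z) holomorphic_on ball 0 d" for n
      by (intro holomorphic_intros holpd) (use p_nz in auto)
    fix z :: complex assume "z \<in> ball 0 d"
    then obtain e where "e > 0" "cball z e \<subseteq> ball 0 d"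
      using open_contains_cball by (metis open_ball)
    moreover have "uniform_limit (ball 0 d) (\<lambda>n z. p (n + n0) z / p (Suc (n + n0)) z) r sequentially"
      using ratio unfolding uniform_limit_iff
      by (auto intro: sequentially_offset)
    ultimately show "\<exists>e. 0 < e \<and> cball z e \<subseteq> ball 0 d \<and>
        uniform_limit (cball z e) (\<lambda>n z. p (n + n0) z / p (Suc (n + n0)) z) r sequentially"
      using uniform_limit_on_subset by blast
  qed auto
  define \<kappa> where "\<kappa> = (\<lambda>z. \<kappa>1 z / r z)"
  have "uniform_limit (ball 0 d) (\<lambda>n z. u n z / r z) \<kappa> sequentially"
    unfolding \<kappa>_def
    by (rule uniform_lim_divide[OF ul uniform_limit_const bd(1), where b = "norm \<rho> / 2"])
      (use zr(6) \<rho> in auto)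
  then have lim: "uniform_limit (ball 0 d) (\<lambda>n z. p n z * r z ^ n) \<kappa> sequentially"
  proof (rule uniform_limit_cong[THEN iffD1, rotated 2])
    show "\<forall>\<^sub>F n in sequentially. \<forall>z\<in>ball 0 d. u n z / r z = p n z * r z ^ n"
      using r_nz by (intro always_eventually) (simp add: u_def)
  qed auto
  have hol_\<kappa>: "\<kappa> holomorphic_on ball 0 d"
  proof (rule holomorphic_uniform_sequence)
    show "(\<lambda>z. p n z * r z ^ n) holomorphic_on ball 0 d" for n
      by (intro holomorphic_intros holpd hol_r)
    fix z :: complex assume "z \<in> ball 0 d"
    then obtain e where "e > 0" "cball z e \<subseteq> ball 0 d"
      using open_contains_cball by (metis open_ball)
    with lim show "\<exists>e. 0 < e \<and> cball z e \<subseteq> ball 0 d \<and>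
        uniform_limit (cball z e) (\<lambda>n z. p n z * r z ^ n) \<kappa> sequentially"
      using uniform_limit_on_subset by blast
  qed auto
  show ?thesis
  proof (rule that[OF d(1) _ hol_r r0 _ hol_\<kappa> _ lim])
    show "\<kappa> 0 = - N 0 \<rho> / (\<rho> * deriv (D 0) \<rho>)"
    proof -
      have "E 0 \<rho> = - deriv (D 0) \<rho>" by (simp add: E_def r0)
      then show ?thesis by (simp add: \<kappa>_def \<kappa>1_def Q_def r0 mult.commute[of \<rho>])
    qed
    show "norm (r z) < R \<and> D z (r z) = 0" if "norm z < d" for z
      using zr(1,2)[OF that] R1 by auto
  qed (use d in auto)
qed

section \<open>Quasi-powers: mean, variance and Gaussian limit\<close>

definition mgf_sum :: "(nat \<Rightarrow> 'a set) \<Rightarrow> ('a \<Rightarrow> real) \<Rightarrow> nat \<Rightarrow> complex \<Rightarrow> complex" where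
  "mgf_sum S Z n z = (\<Sum>w\<in>S n. exp (z * of_real (Z w)))"

text \<open>
  The setting of the quasi-power theorem of Hwang. For a random element \<open>w\<close> of \<open>S n\<close>, the function
  \<open>mgf_sum S Z n z / card (S n)\<close> is the moment generating function of \<open>Z w\<close>; it behaves like
  \<open>\<kappa> z / \<kappa> 0\<close> times the \<open>n\<close>-th power of \<open>r 0 / r z\<close>. The numbers \<open>m\<close> and \<open>v\<close> are the first two
  derivatives at 0 of \<open>- ln (r z / r 0)\<close>.
\<close>

locale quasi_powers =
  fixes S :: "nat \<Rightarrow> 'a set" and Z :: "'a \<Rightarrow> real"
    and r \<kappa> :: "complex \<Rightarrow> complex" and \<delta> m v :: real
  assumes fin: "finite (S n)" and nonempty: "S n \<noteq> {}"
    and \<delta>: "\<delta> > 0" and hol_r: "r holomorphic_on ball 0 \<delta>" and r0: "r 0 \<noteq> 0"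
    and hol_\<kappa>: "\<kappa> holomorphic_on ball 0 \<delta>" and \<kappa>0: "\<kappa> 0 \<noteq> 0"
    and limit: "uniform_limit (ball 0 \<delta>) (\<lambda>n z. mgf_sum S Z n z * r z ^ n) \<kappa> sequentially"
    and m_eq: "deriv r 0 / r 0 = - of_real m"
    and v_eq: "deriv (deriv r) 0 / r 0 - (deriv r 0 / r 0)\<^sup>2 = - of_real v"
begin

abbreviation "P n z \<equiv> mgf_sum S Z n z"

lemma P0: "P n 0 = of_nat (card (S n))" "card (S n) > 0"
  using fin[of n] nonempty[of n] by (auto simp: mgf_sum_def card_gt_0_iff)

lemma expectation_eq:
  fixes f :: "'a \<Rightarrow> 'b :: {banach, second_countable_topology}"
  shows "(LINT w|measure_pmf (pmf_of_set (S n)). f w) = (\<Sum>w\<in>S n. f w) /\<^sub>R real (card (S n))"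
  by (subst integral_measure_pmf[of "S n"])
    (auto simp: fin nonempty scaleR_right.sum divide_inverse)

text \<open>
  The factor by which the moment generating function differs from an exact \<open>n\<close>-th power.
\<close>

definition q :: "nat \<Rightarrow> complex \<Rightarrow> complex" where
  "q n z = (P n z * r z ^ n) / (P n 0 * r 0 ^ n)"

text \<open>On this disc \<open>r z / r 0\<close> has a holomorphic logarithm and the functions \<open>q n\<close> are bounded.\<close>

definition good_radius :: "real \<Rightarrow> bool" where
  "good_radius e \<longleftrightarrow> 0 < e \<and> e < \<delta> \<and>
     (\<forall>z. norm z \<le> e \<longrightarrow> norm (r z / r 0 - 1) < 1 \<and> norm (\<kappa> z - \<kappa> 0) \<le> 1)"

lemma good_radius_exists: "\<exists>e. good_radius e"
proof -
  have "continuous_on (ball 0 \<delta>) (\<lambda>z. r z / r 0 - 1)" "continuous_on (ball 0 \<delta>) (\<lambda>z. \<kappa> z - \<kappa> 0)"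
    using hol_r hol_\<kappa> r0 by (auto intro!: holomorphic_intros holomorphic_on_imp_continuous_on)
  then have c: "isCont (\<lambda>z. r z / r 0 - 1) 0" "isCont (\<lambda>z. \<kappa> z - \<kappa> 0) 0"
    using \<delta> by (auto simp: continuous_on_eq_continuous_at)
  obtain e1 where e1: "e1 > 0" "\<And>z. dist z 0 < e1 \<Longrightarrow> dist (r z / r 0 - 1) (r 0 / r 0 - 1) < 1"
    using c(1) unfolding continuous_at_eps_delta by (metis zero_less_one)
  obtain e2 where e2: "e2 > 0" "\<And>z. dist z 0 < e2 \<Longrightarrow> dist (\<kappa> z - \<kappa> 0) (\<kappa> 0 - \<kappa> 0) < 1"
    using c(2) unfolding continuous_at_eps_delta by (metis zero_less_one)
  have "good_radius (min (min e1 e2) \<delta> / 2)"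
    unfolding good_radius_def
  proof (intro conjI allI impI)
    fix z :: complex assume "norm z \<le> min (min e1 e2) \<delta> / 2"
    then have "dist z 0 < e1" "dist z 0 < e2" using e1 e2 \<delta> by auto
    then show "norm (r z / r 0 - 1) < 1" "norm (\<kappa> z - \<kappa> 0) \<le> 1"
      using e1(2)[of z] e2(2)[of z] r0 by (auto simp: dist_norm)
  qed (use e1 e2 \<delta> in auto)
  then show ?thesis ..
qed

definition e :: real where "e = (SOME e. good_radius e)"

lemma good_e: "good_radius e"
  unfolding e_def using good_radius_exists by (rule someI_ex)

lemma e: "0 < e" "e < \<delta>" "norm z \<le> e \<Longrightarrow> norm (r z / r 0 - 1) < 1"
  "norm z \<le> e \<Longrightarrow> norm (\<kappa> z - \<kappa> 0) \<le> 1"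
  using good_e by (auto simp: good_radius_def)

lemma r_nz: "norm z \<le> e \<Longrightarrow> r z \<noteq> 0"
  using e(3)[of z] by auto

definition L :: "complex \<Rightarrow> complex" where "L z = Ln (r z / r 0)"

lemma r_near_r0: "norm z \<le> e \<Longrightarrow> r z / r 0 \<notin> \<real>\<^sub>\<le>\<^sub>0"
proof
  assume z: "norm z \<le> e" and "r z / r 0 \<in> \<real>\<^sub>\<le>\<^sub>0"
  then have "Re (r z / r 0) \<le> 0" by (auto simp: complex_nonpos_Reals_iff)
  moreover have "\<bar>Re (r z / r 0 - 1)\<bar> < 1"
    using abs_Re_le_cmod[of "r z / r 0 - 1"] e(3)[OF z] by linarith
  ultimately show False by simp
qed

lemma hol_L: "L holomorphic_on ball 0 e"
  unfolding L_def
  by (intro holomorphic_intros holomorphic_on_subset[OF hol_r] r_near_r0) (use e r0 in auto)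

lemma exp_L: "norm z \<le> e \<Longrightarrow> exp (L z) = r z / r 0"
  unfolding L_def using r_nz r0 by (intro exp_Ln) auto

lemma L0: "L 0 = 0"
  using r0 by (simp add: L_def)

lemma hol_q: "q n holomorphic_on ball 0 e"
  unfolding q_def mgf_sum_def
  by (intro holomorphic_intros holomorphic_on_subset[OF hol_r])
    (use e r0 P0[of n] in \<open>auto simp: mgf_sum_def\<close>)

lemma mgf_eq: "norm z \<le> e \<Longrightarrow> P n z / P n 0 = q n z * exp (- of_nat n * L z)"
  by (simp add: q_def exp_minus exp_of_nat_mult exp_L power_divide r_nz r0 field_simps)

lemma q0: "q n 0 = 1"
  using P0[of n] r0 by (simp add: q_def)

lemma P_limit: "(\<lambda>n. P n 0 * r 0 ^ n) \<longlonglongrightarrow> \<kappa> 0"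
  by (rule tendsto_uniform_limitI[OF limit]) (use \<delta> in simp)

lemma q_bounded: "\<exists>B. \<forall>\<^sub>F n in sequentially. \<forall>z\<in>ball 0 e. norm (q n z) \<le> B"
proof -
  have "\<forall>\<^sub>F n in sequentially. \<forall>z\<in>ball 0 \<delta>. dist (P n z * r z ^ n) (\<kappa> z) < 1"
    by (rule uniform_limitD[OF limit]) simp
  moreover have "\<forall>\<^sub>F n in sequentially. norm (\<kappa> 0) / 2 < norm (P n 0 * r 0 ^ n)"
    using order_tendstoD(1)[OF tendsto_norm[OF P_limit], of "norm (\<kappa> 0) / 2"] \<kappa>0 by simp
  ultimately have "\<forall>\<^sub>F n in sequentially. \<forall>z\<in>ball 0 e.
      norm (q n z) \<le> (norm (\<kappa> 0) + 2) / (norm (\<kappa> 0) / 2)"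
  proof eventually_elim
    case (elim n)
    show ?case
    proof
      fix z :: complex assume z: "z \<in> ball 0 e"
      then have "dist (P n z * r z ^ n) (\<kappa> z) < 1" "norm (\<kappa> z - \<kappa> 0) \<le> 1"
        using elim(1) e(2,4) by auto
      then have "norm (P n z * r z ^ n) \<le> norm (\<kappa> 0) + 2"
        using norm_triangle_sub[of "P n z * r z ^ n" "\<kappa> z"] norm_triangle_sub[of "\<kappa> z" "\<kappa> 0"]
        by (simp add: dist_norm)
      then show "norm (q n z) \<le> (norm (\<kappa> 0) + 2) / (norm (\<kappa> 0) / 2)"
        unfolding q_def norm_divide using elim(2) \<kappa>0 by (intro frac_le) auto
    qed
  qed
  then show ?thesis by blast
qed

text \<open>
  Cauchy's inequality on a circle inside the disc on which the \<open>q n\<close> are bounded.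
\<close>

lemma deriv_q_bounded:
  "\<exists>B. \<forall>\<^sub>F n in sequentially. norm (deriv (q n) 0) \<le> B \<and> norm (deriv (deriv (q n)) 0) \<le> B"
proof -
  obtain B where B: "\<forall>\<^sub>F n in sequentially. \<forall>z\<in>ball 0 e. norm (q n z) \<le> B"
    using q_bounded by blast
  define c where "c = e / 2"
  have c: "0 < c" "cball (0::complex) c \<subseteq> ball 0 e" using e(1) by (auto simp: c_def)
  from B have "\<forall>\<^sub>F n in sequentially. norm (deriv (q n) 0) \<le> max (B / c) (2 * B / c\<^sup>2) \<and>
      norm (deriv (deriv (q n)) 0) \<le> max (B / c) (2 * B / c\<^sup>2)"
  proof eventually_elim
    case (elim n)
    have *: "norm ((deriv ^^ k) (q n) 0) \<le> fact k * B / c ^ k" for k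
    proof (rule Cauchy_inequality)
      show "q n holomorphic_on ball 0 c"
        by (rule holomorphic_on_subset[OF hol_q]) (use c in auto)
      show "continuous_on (cball 0 c) (q n)"
        by (rule continuous_on_subset[OF holomorphic_on_imp_continuous_on[OF hol_q]]) (use c in auto)
      show "norm (q n x) \<le> B" if "norm (0 - x) = c" for x
        using elim c that by (auto simp: subset_iff)
    qed (use c in auto)
    from *[of 1] *[of 2] show ?case
      by (simp add: numeral_2_eq_2 le_max_iff_disj)
  qed
  then show ?thesis by blast
qed

lemma deriv_L: "norm z < e \<Longrightarrow> deriv L z = deriv r z / r z"
proof -
  assume z: "norm z < e"
  have "(r has_field_derivative deriv r z) (at z)"
    using holomorphic_derivI[OF hol_r open_ball, of z] z e by simp
  then have "(L has_field_derivative (1 / (r z / r 0)) * (deriv r z / r 0)) (at z)"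
    unfolding L_def using r_near_r0[of z] z
    by (auto intro!: derivative_eq_intros)
  then show ?thesis using r0 by (simp add: DERIV_imp_deriv)
qed

lemma deriv_L0: "deriv L 0 = - of_real m" "deriv (deriv L) 0 = - of_real v"
proof -
  show "deriv L 0 = - of_real m" using deriv_L[of 0] e m_eq by simp
  have "deriv (deriv L) 0 = deriv (\<lambda>z. deriv r z / r z) 0"
  proof (rule deriv_cong_ev)
    have "\<forall>\<^sub>F z in nhds 0. z \<in> ball (0::complex) e"
      by (rule eventually_nhds_in_open) (use e in auto)
    then show "\<forall>\<^sub>F z in nhds 0. deriv L z = deriv r z / r z"
      by eventually_elim (simp add: deriv_L)
  qed simp
  also have "\<dots> = (deriv (deriv r) 0 * r 0 - deriv r 0 * deriv r 0) / (r 0 * r 0)"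
    by (rule DERIV_imp_deriv, rule DERIV_divide)
      (use r0 \<delta> hol_r holomorphic_deriv[OF hol_r] in \<open>auto intro!: holomorphic_derivI[where S = "ball 0 \<delta>"]\<close>)
  also have "\<dots> = deriv (deriv r) 0 / r 0 - (deriv r 0 / r 0)\<^sup>2"
    using r0 by (simp add: field_simps power2_eq_square)
  finally show "deriv (deriv L) 0 = - of_real v" using v_eq by simp
qed

text \<open>
  Both sides of \<open>mgf_eq\<close> are differentiated twice at 0.
\<close>

lemma moments:
  "of_real (measure_pmf.expectation (pmf_of_set (S n)) Z) = deriv (q n) 0 + of_nat n * of_real m"
  "of_real (measure_pmf.variance (pmf_of_set (S n)) Z) =
     deriv (deriv (q n)) 0 - (deriv (q n) 0)\<^sup>2 + of_nat n * of_real v"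
proof -
  define c where "c = of_nat (card (S n)) * (1 :: complex)"
  have c: "c \<noteq> 0" "P n 0 = c" using P0[of n] by (auto simp: c_def)
  define A where "A = (\<lambda>z. (\<Sum>w\<in>S n. of_real (Z w) * exp (z * of_real (Z w))) / c)"
  define B where "B = (\<Sum>w\<in>S n. of_real (Z w)^2) / c"
  define \<phi> where "\<phi> = (\<lambda>z. P n z / P n 0)"
  have \<phi>': "(\<phi> has_field_derivative A z) (at z)" for z
    unfolding \<phi>_def A_def mgf_sum_def c(2)[unfolded mgf_sum_def]
    by (intro DERIV_cdivide DERIV_sum) (auto intro!: derivative_eq_intros)
  have A': "(A has_field_derivative B) (at 0)"
    unfolding A_def B_def by (rule DERIV_cdivide, rule DERIV_sum)
      (auto intro!: derivative_eq_intros simp: power2_eq_square)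
  have dq: "(q n has_field_derivative deriv (q n) z) (at z)"
    and dL: "(L has_field_derivative deriv L z) (at z)"
    and ddq: "(deriv (q n) has_field_derivative deriv (deriv (q n)) z) (at z)"
    and ddL: "(deriv L has_field_derivative deriv (deriv L) z) (at z)" if "z \<in> ball 0 e" for z
    using that hol_q[of n] hol_L holomorphic_deriv[OF hol_q[of n]] holomorphic_deriv[OF hol_L]
    by (auto intro!: holomorphic_derivI[where S = "ball 0 e"])
  define G where "G = (\<lambda>z. deriv (q n) z * exp (- of_nat n * L z) -
      of_nat n * deriv L z * (q n z * exp (- of_nat n * L z)))"
  have "A z = G z" if z: "z \<in> ball 0 e" for z
  proof -
    have "((\<lambda>z. q n z * exp (- of_nat n * L z)) has_field_derivative G z) (at z)"
      unfolding G_def by (rule derivative_eq_intros dq[OF z] dL[OF z] refl)+ (simp add: algebra_simps)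
    then have "(\<phi> has_field_derivative G z) (at z)"
      by (rule has_field_derivative_transform_within_open[OF _ open_ball z])
        (simp add: \<phi>_def mgf_eq)
    then show ?thesis using \<phi>' DERIV_unique by blast
  qed
  note AG = this
  have e0: "0 \<in> ball (0::complex) e" using e by simp
  define q1 q2 where "q1 = deriv (q n) 0" and "q2 = deriv (deriv (q n)) 0"
  have "(G has_field_derivative (q2 + 2 * of_nat n * of_real m * q1 +
      (of_nat n * of_real m)^2 + of_nat n * of_real v)) (at 0)"
    unfolding G_def
    by (rule derivative_eq_intros dq[OF e0] dL[OF e0] ddq[OF e0] ddL[OF e0] refl)+
      (simp add: L0 q0 deriv_L0 q1_def q2_def algebra_simps power2_eq_square)
  then have "(A has_field_derivative (q2 + 2 * of_nat n * of_real m * q1 +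
      (of_nat n * of_real m)^2 + of_nat n * of_real v)) (at 0)"
    by (rule has_field_derivative_transform_within_open[OF _ open_ball e0]) (simp add: AG)
  then have B: "B = q2 + 2 * of_nat n * of_real m * q1 + (of_nat n * of_real m)^2 + of_nat n * of_real v"
    using A' DERIV_unique by blast
  have A0: "A 0 = q1 + of_nat n * of_real m"
    using AG[OF e0] by (simp add: G_def L0 q0 deriv_L0 q1_def)
  have E: "of_real (measure_pmf.expectation (pmf_of_set (S n)) Z) = A 0"
    by (simp add: expectation_eq A_def c_def divide_inverse)
  have E2: "of_real (measure_pmf.expectation (pmf_of_set (S n)) (\<lambda>w. (Z w)^2)) = B"
    by (simp add: expectation_eq B_def c_def divide_inverse)
  have V: "measure_pmf.variance (pmf_of_set (S n)) Z =
      measure_pmf.expectation (pmf_of_set (S n)) (\<lambda>w. (Z w)^2) -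
      (measure_pmf.expectation (pmf_of_set (S n)) Z)^2"
    by (rule measure_pmf.variance_eq)
      (auto intro!: integrable_measure_pmf_finite simp: fin nonempty)
  show "of_real (measure_pmf.expectation (pmf_of_set (S n)) Z) = deriv (q n) 0 + of_nat n * of_real m"
    using E A0 by (simp add: q1_def)
  have "of_real (measure_pmf.variance (pmf_of_set (S n)) Z) = B - (A 0)^2"
    unfolding V of_real_diff of_real_power E E2 ..
  then show "of_real (measure_pmf.variance (pmf_of_set (S n)) Z) =
     deriv (deriv (q n)) 0 - (deriv (q n) 0)\<^sup>2 + of_nat n * of_real v"
    by (simp add: B A0 q1_def q2_def power2_eq_square algebra_simps)
qed

theorem mean_linear:
  "\<exists>B. \<forall>\<^sub>F n in sequentially. \<bar>measure_pmf.expectation (pmf_of_set (S n)) Z - m * real n\<bar> \<le> B"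
proof -
  obtain B where "\<forall>\<^sub>F n in sequentially. norm (deriv (q n) 0) \<le> B \<and> norm (deriv (deriv (q n)) 0) \<le> B"
    using deriv_q_bounded by blast
  then have "\<forall>\<^sub>F n in sequentially. \<bar>measure_pmf.expectation (pmf_of_set (S n)) Z - m * real n\<bar> \<le> B"
  proof eventually_elim
    case (elim n)
    have "of_real (measure_pmf.expectation (pmf_of_set (S n)) Z - m * real n) = deriv (q n) 0"
      using moments(1)[of n] by simp
    then have "\<bar>measure_pmf.expectation (pmf_of_set (S n)) Z - m * real n\<bar> = norm (deriv (q n) 0)"
      by (metis norm_of_real)
    then show ?case using elim by simp
  qed
  then show ?thesis by blast
qed

theorem variance_linear:
  "\<exists>B. \<forall>\<^sub>F n in sequentially. \<bar>measure_pmf.variance (pmf_of_set (S n)) Z - v * real n\<bar> \<le> B"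
proof -
  obtain B where "\<forall>\<^sub>F n in sequentially. norm (deriv (q n) 0) \<le> B \<and> norm (deriv (deriv (q n)) 0) \<le> B"
    using deriv_q_bounded by blast
  then have "\<forall>\<^sub>F n in sequentially. \<bar>measure_pmf.variance (pmf_of_set (S n)) Z - v * real n\<bar> \<le> B + B^2"
  proof eventually_elim
    case (elim n)
    have "of_real (measure_pmf.variance (pmf_of_set (S n)) Z - v * real n) =
        deriv (deriv (q n)) 0 - (deriv (q n) 0)\<^sup>2"
      using moments(2)[of n] by simp
    then have "\<bar>measure_pmf.variance (pmf_of_set (S n)) Z - v * real n\<bar> =
        norm (deriv (deriv (q n)) 0 - (deriv (q n) 0)\<^sup>2)"
      by (metis norm_of_real)
    also have "\<dots> \<le> norm (deriv (deriv (q n)) 0) + norm (deriv (q n) 0) ^ 2"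
      using norm_triangle_ineq4 by (simp flip: norm_power)
    also have "\<dots> \<le> B + B^2"
      using elim by (intro add_mono power_mono) auto
    finally show ?case .
  qed
  then show ?thesis by blast
qed

lemma L_Taylor:
  obtains B where "\<And>z. norm z \<le> e / 2 \<Longrightarrow>
    norm (L z + of_real m * z + of_real v * z\<^sup>2 / 2) \<le> B * norm z ^ 3"
proof -
  have hol: "(deriv ^^ k) L holomorphic_on ball 0 e" for k
    by (rule holomorphic_higher_deriv[OF hol_L]) auto
  have "continuous_on (cball 0 (e / 2)) (\<lambda>z. norm ((deriv ^^ 3) L z))"
    by (intro continuous_on_norm holomorphic_on_imp_continuous_on holomorphic_on_subset[OF hol])
      (use e in auto)
  from continuous_attains_sup[OF compact_cball _ this]
  obtain z1 where z1: "\<And>z. z \<in> cball 0 (e / 2) \<Longrightarrow> norm ((deriv ^^ 3) L z) \<le> norm ((deriv ^^ 3) L z1)"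
    using e(1) by (metis cball_eq_empty half_gt_zero not_less_iff_gr_or_eq)
  define B where "B = norm ((deriv ^^ 3) L z1)"
  have "norm (L z + of_real m * z + of_real v * z\<^sup>2 / 2) \<le> B / 2 * norm z ^ 3" if z: "norm z \<le> e / 2" for z
  proof -
    have "norm ((deriv ^^ 0) L z - (\<Sum>i\<le>2. (deriv ^^ i) L 0 * (z - 0) ^ i / fact i))
        \<le> B * norm (z - 0) ^ Suc 2 / fact 2"
    proof (rule complex_Taylor)
      show "((deriv ^^ i) L has_field_derivative (deriv ^^ Suc i) L x) (at x within cball 0 (e / 2))"
        if "x \<in> cball 0 (e / 2)" for i x
        using holomorphic_derivI[OF hol open_ball, of x i] that e
        by (auto intro: has_field_derivative_at_within)
      show "norm ((deriv ^^ Suc 2) L x) \<le> B" if "x \<in> cball 0 (e / 2)" for x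
        using z1[OF that] by (simp add: B_def eval_nat_numeral)
    qed (use z e in auto)
    then show ?thesis
      by (simp add: eval_nat_numeral L0 deriv_L0 algebra_simps)
  qed
  then show ?thesis using that by blast
qed

abbreviation std_law :: "real \<Rightarrow> nat \<Rightarrow> real measure" where
  "std_law s n \<equiv> distr (measure_pmf (pmf_of_set (S n))) borel
     (\<lambda>w. (Z w - m * real n) / (s * sqrt (real n)))"

lemma char_eq:
  assumes "s > 0" "n > 0"
  shows "char (std_law s n) \<theta> =
     P n (\<i> * of_real (\<theta> / (s * sqrt (real n)))) / P n 0 *
     exp (- of_nat n * (of_real m * (\<i> * of_real (\<theta> / (s * sqrt (real n))))))"
proof -
  define h where "h = \<theta> / (s * sqrt (real n))"
  have "char (std_law s n) \<theta> =
      (LINT w|measure_pmf (pmf_of_set (S n)). iexp (\<theta> * ((Z w - m * real n) / (s * sqrt (real n)))))"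
    unfolding char_def by (rule integral_distr) auto
  also have "(\<lambda>w. iexp (\<theta> * ((Z w - m * real n) / (s * sqrt (real n))))) =
      (\<lambda>w. exp (\<i> * of_real h * of_real (Z w)) * exp (- of_nat n * (of_real m * (\<i> * of_real h))))"
    by (auto simp: h_def exp_add[symmetric] algebra_simps diff_divide_distrib)
  also have "(LINT w|measure_pmf (pmf_of_set (S n)). exp (\<i> * of_real h * of_real (Z w)) *
      exp (- of_nat n * (of_real m * (\<i> * of_real h)))) =
      P n (\<i> * of_real h) / P n 0 * exp (- of_nat n * (of_real m * (\<i> * of_real h)))"
    unfolding expectation_eq P0 mgf_sum_def
    by (simp add: sum_distrib_right[symmetric] scaleR_conv_of_real divide_inverse mult_ac)
  finally show ?thesis by (simp add: h_def)
qed

text \<open>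
  At \<open>h n = \<i> \<theta> / (s sqrt n)\<close> the factor \<open>q n (h n)\<close> tends to 1. The linear term of \<open>L\<close> cancels
  against the centring by \<open>m n\<close>, the quadratic term contributes \<open>- \<theta>\<^sup>2 / 2\<close> to the exponent, and the
  Taylor remainder is \<open>n O(n powr (- 3 / 2))\<close>.
\<close>

theorem gaussian_limit:
  assumes s: "s > 0" "s\<^sup>2 = v"
  shows "weak_conv_m (\<lambda>n. std_law s n) std_normal_distribution"
proof (rule levy_continuity)
  show "real_distribution (std_law s n)" for n
    by (rule prob_space.real_distribution_distr[OF measure_pmf.prob_space_axioms]) simp
  show "real_distribution std_normal_distribution" by (rule real_dist_normal_dist)
  fix \<theta> :: real
  define h where "h = (\<lambda>n. \<i> * of_real (\<theta> / (s * sqrt (real n))) :: complex)"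
  have norm_h: "norm (h n) = \<bar>\<theta>\<bar> / s * (1 / sqrt (real n))" for n
    using s by (simp add: h_def norm_mult norm_divide abs_mult)
  have "(\<lambda>n. norm (h n)) \<longlonglongrightarrow> \<bar>\<theta>\<bar> / s * 0"
    unfolding norm_h
    by (intro tendsto_intros tendsto_divide_0[OF tendsto_const] filterlim_at_top_imp_at_infinity
        filterlim_compose[OF sqrt_at_top] filterlim_real_sequentially)
  then have h0: "h \<longlonglongrightarrow> 0" by (simp add: tendsto_norm_zero_iff)
  have "\<forall>\<^sub>F n in sequentially. norm (h n) < e / 2"
    using order_tendstoD(2)[OF tendsto_norm[OF h0], of "e / 2"] e by simp
  moreover have "\<forall>\<^sub>F n in sequentially. n > (0::nat)" by (rule eventually_gt_at_top)
  ultimately have small: "\<forall>\<^sub>F n in sequentially. norm (h n) < e / 2 \<and> n > 0"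
    by eventually_elim auto

  have "(\<lambda>n. P n (h n) * r (h n) ^ n - \<kappa> (h n)) \<longlonglongrightarrow> 0"
  proof (rule tendstoI)
    fix \<epsilon> :: real assume "\<epsilon> > 0"
    from uniform_limitD[OF limit this] small
    show "\<forall>\<^sub>F n in sequentially. dist (P n (h n) * r (h n) ^ n - \<kappa> (h n)) 0 < \<epsilon>"
    proof eventually_elim
      case (elim n)
      then have "h n \<in> ball 0 \<delta>" using e by auto
      with elim(1) show ?case by (simp add: dist_norm)
    qed
  qed
  moreover have "(\<lambda>n. \<kappa> (h n)) \<longlonglongrightarrow> \<kappa> 0"
  proof (rule isCont_tendsto_compose[OF _ h0])
    show "isCont \<kappa> 0"
      using holomorphic_on_imp_continuous_on[OF hol_\<kappa>] \<delta> by (simp add: continuous_on_eq_continuous_at)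
  qed
  ultimately have "(\<lambda>n. (P n (h n) * r (h n) ^ n - \<kappa> (h n)) + \<kappa> (h n)) \<longlonglongrightarrow> 0 + \<kappa> 0"
    by (rule tendsto_add)
  then have "(\<lambda>n. P n (h n) * r (h n) ^ n) \<longlonglongrightarrow> \<kappa> 0" by simp
  then have "(\<lambda>n. q n (h n)) \<longlonglongrightarrow> \<kappa> 0 / \<kappa> 0"
    unfolding q_def by (rule tendsto_divide[OF _ P_limit \<kappa>0])
  then have lim_q: "(\<lambda>n. q n (h n)) \<longlonglongrightarrow> 1" using \<kappa>0 by simp

  obtain B where B: "\<And>z. norm z \<le> e / 2 \<Longrightarrow>
      norm (L z + of_real m * z + of_real v * z\<^sup>2 / 2) \<le> B * norm z ^ 3"
    using L_Taylor by metis
  define R where "R = (\<lambda>z. L z + of_real m * z + of_real v * z\<^sup>2 / 2)"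
  have R0: "(\<lambda>n. of_nat n * R (h n)) \<longlonglongrightarrow> 0"
  proof (rule Lim_null_comparison)
    show "\<forall>\<^sub>F n in sequentially. norm (of_nat n * R (h n)) \<le> B * (\<bar>\<theta>\<bar> / s)\<^sup>2 * norm (h n)"
      using small
    proof eventually_elim
      case (elim n)
      have "norm (of_nat n * R (h n)) \<le> real n * (B * norm (h n) ^ 3)"
        using B[of "h n"] elim by (simp add: norm_mult R_def mult_left_mono)
      also have "\<dots> = B * (real n * (norm (h n))\<^sup>2) * norm (h n)"
        by (simp add: eval_nat_numeral algebra_simps)
      also have "real n * (norm (h n))\<^sup>2 = (\<bar>\<theta>\<bar> / s)\<^sup>2"
        unfolding norm_h using elim by (simp add: power_mult_distrib power_divide)
      finally show ?case .
    qed
    show "(\<lambda>n. B * (\<bar>\<theta>\<bar> / s)\<^sup>2 * norm (h n)) \<longlonglongrightarrow> 0"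
      using tendsto_mult_right_zero[OF tendsto_norm_zero[OF h0]] by blast
  qed
  have "(\<lambda>n. q n (h n) * exp (- (of_nat n * R (h n)) - of_real (\<theta>\<^sup>2 / 2))) \<longlonglongrightarrow>
      1 * exp (- 0 - of_real (\<theta>\<^sup>2 / 2))"
    by (intro tendsto_intros lim_q R0)
  moreover have "\<forall>\<^sub>F n in sequentially. q n (h n) * exp (- (of_nat n * R (h n)) - of_real (\<theta>\<^sup>2 / 2)) =
      char (std_law s n) \<theta>"
    using small
  proof eventually_elim
    case (elim n)
    have "of_nat n * (of_real v * (h n)\<^sup>2 / 2) = - of_real (\<theta>\<^sup>2 / 2)"
    proof -
      have "(h n)\<^sup>2 = - of_real (\<theta>\<^sup>2 / (v * real n))"
        by (simp add: h_def power_mult_distrib power_divide s(2)[symmetric] flip: of_real_power)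
      moreover have "v \<noteq> 0" using s by auto
      ultimately show ?thesis using elim by simp
    qed
    then have "- (of_nat n * R (h n)) - of_real (\<theta>\<^sup>2 / 2) =
        - of_nat n * L (h n) + - of_nat n * (of_real m * h n)"
      by (simp add: R_def algebra_simps)
    then have "exp (- (of_nat n * R (h n)) - of_real (\<theta>\<^sup>2 / 2)) =
        exp (- of_nat n * L (h n)) * exp (- of_nat n * (of_real m * h n))"
      by (simp only: exp_add)
    moreover have "q n (h n) * exp (- of_nat n * L (h n)) = P n (h n) / P n 0"
      using mgf_eq[of "h n" n] elim e by simp
    ultimately have "q n (h n) * exp (- (of_nat n * R (h n)) - of_real (\<theta>\<^sup>2 / 2)) =
        P n (h n) / P n 0 * exp (- of_nat n * (of_real m * h n))"
      by (simp only: mult.assoc[symmetric])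
    then show ?case
      unfolding char_eq[OF s(1) conjunct2[OF elim]] h_def .
  qed
  ultimately have "(\<lambda>n. char (std_law s n) \<theta>) \<longlonglongrightarrow> 1 * exp (- 0 - of_real (\<theta>\<^sup>2 / 2))"
    by (rule Lim_transform_eventually)
  then show "(\<lambda>n. char (std_law s n) \<theta>) \<longlonglongrightarrow> char std_normal_distribution \<theta>"
    by (simp add: char_std_normal_distribution exp_of_real[symmetric])
qed

end

section \<open>The generating function of weighted walks\<close>

text \<open>
  A square root of the discriminant of the quadratic equation for \<open>block\<close>. For \<open>\<bar>a\<bar> \<le> 201/200\<close>
  and \<open>\<bar>t\<bar> < 41/100\<close> each of the three factors has positive real part, so that the product of the
  principal roots is holomorphic.
\<close>

definition disc_root :: "complex \<Rightarrow> complex \<Rightarrow> complex" where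
  "disc_root a t = csqrt (1 - t\<^sup>2) * csqrt (1 - t - t * a - t\<^sup>2 * a) * csqrt (1 + t - t * a + t\<^sup>2 * a)"

text \<open>
  An excursion consists of a step away, a nonempty sequence of forward steps and excursions one level
  further out without two consecutive excursions, and a step back. With \<open>q = t\<^sup>2\<close> for the
  two outer steps and \<open>n = t a\<close> for a forward step, the series \<open>b\<close> of possibly empty excursions thus satisfies
  \<open>(b - 1) (1 - n b) = q ((1 + n) b - 1)\<close>. This is \<open>arch\<close>, and \<open>block = n b\<close> is the root of the
  resulting quadratic that vanishes at \<open>t = 0\<close>. The formula of \<open>arch\<close> is free of division by \<open>t\<close>.
\<close>

definition block :: "complex \<Rightarrow> complex \<Rightarrow> complex" where
  "block a t = ((1 + t * a) * (1 - t\<^sup>2) - disc_root a t) / 2"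

definition arch :: "complex \<Rightarrow> complex \<Rightarrow> complex" where
  "arch a t = 2 * (1 - t\<^sup>2) / ((1 + t * a) * (1 - t\<^sup>2) + disc_root a t)"

text \<open>
  Weights so close to 1 that no denominator other than \<open>Den\<close> vanishes for \<open>\<bar>t\<bar> < 41/100\<close>. The
  radius has to lie between \<open>rho\<close>, which is about 0.4030, and the zero \<open>sqrt 2 - 1\<close> of the discriminant for
  \<open>a = 1\<close>, which is about 0.4142.
\<close>

definition tame :: "complex \<Rightarrow> bool" where
  "tame a \<longleftrightarrow> a \<noteq> 0 \<and> norm a \<le> 201 / 200 \<and> norm (a + inverse a - 2) \<le> 1 / 100"

abbreviation R0 :: real where "R0 \<equiv> 41 / 100"

lemma norm_bounds:
  fixes a t :: complex
  assumes "norm a \<le> 201 / 200" "norm t < R0"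
  shows "norm t + norm (t * a) + norm (t\<^sup>2 * a) \<le> 991 / 1000" "norm (t\<^sup>2) < 1"
proof -
  have 1: "norm (t * a) \<le> R0 * (201 / 200)"
    unfolding norm_mult using assms by (intro mult_mono) auto
  have 2: "norm (t\<^sup>2) \<le> R0\<^sup>2"
    unfolding norm_power using assms by (intro power_mono) auto
  have "norm (t\<^sup>2 * a) \<le> R0\<^sup>2 * (201 / 200)"
    unfolding norm_mult using assms 2 by (intro mult_mono) auto
  with 1 assms(2) show "norm t + norm (t * a) + norm (t\<^sup>2 * a) \<le> 991 / 1000"
    by (simp add: power2_eq_square)
  show "norm (t\<^sup>2) < 1"
    using 2 by (simp add: power2_eq_square)
qed

lemma Re_pos_1_minus: "norm z < 1 \<Longrightarrow> Re (1 - z) > 0"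
  using abs_Re_le_cmod[of z] by simp

lemma disc_factors_Re_pos:
  fixes a t :: complex
  assumes "norm a \<le> 201 / 200" "norm t < R0"
  shows "Re (1 - t\<^sup>2) > 0" "Re (1 - t - t * a - t\<^sup>2 * a) > 0" "Re (1 + t - t * a + t\<^sup>2 * a) > 0"
proof -
  note b = norm_bounds[OF assms]
  show "Re (1 - t\<^sup>2) > 0" using b by (intro Re_pos_1_minus)
  have "norm (t + t * a + t\<^sup>2 * a) < 1"
    using b norm_triangle_ineq[of "t + t * a" "t\<^sup>2 * a"] norm_triangle_ineq[of t "t * a"] by linarith
  from Re_pos_1_minus[OF this] show "Re (1 - t - t * a - t\<^sup>2 * a) > 0" by (simp add: algebra_simps)
  have "norm (t * a - t - t\<^sup>2 * a) < 1"
    using b norm_triangle_ineq4[of "t * a - t" "t\<^sup>2 * a"] norm_triangle_ineq4[of "t * a" t] by linarith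
  from Re_pos_1_minus[OF this] show "Re (1 + t - t * a + t\<^sup>2 * a) > 0" by (simp add: algebra_simps)
qed

lemma disc_factors_not_nonpos:
  fixes a t :: complex
  assumes "norm a \<le> 201 / 200" "norm t < R0"
  shows "1 - t\<^sup>2 \<notin> \<real>\<^sub>\<le>\<^sub>0" "1 - t - t * a - t\<^sup>2 * a \<notin> \<real>\<^sub>\<le>\<^sub>0" "1 + t - t * a + t\<^sup>2 * a \<notin> \<real>\<^sub>\<le>\<^sub>0"
  using disc_factors_Re_pos[OF assms] by (auto simp: complex_nonpos_Reals_iff)

lemma disc_root_squared:
  "(disc_root a t)\<^sup>2 = (1 - t\<^sup>2) * ((1 - t * a)\<^sup>2 - t\<^sup>2 * (1 + t * a)\<^sup>2)"
  unfolding disc_root_def power_mult_distrib power2_csqrt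
  by (simp add: algebra_simps power2_eq_square)

lemma block_quadratic: "(block a t)\<^sup>2 - (1 + t * a) * (1 - t\<^sup>2) * block a t + t * a * (1 - t\<^sup>2) = 0"
proof -
  define h where "h = disc_root a t"
  have h: "h\<^sup>2 = (1 - t\<^sup>2) * ((1 - t * a)\<^sup>2 - t\<^sup>2 * (1 + t * a)\<^sup>2)"
    unfolding h_def by (rule disc_root_squared)
  define X where "X = (block a t)\<^sup>2 - (1 + t * a) * (1 - t\<^sup>2) * block a t + t * a * (1 - t\<^sup>2)"
  have "4 * X =
      h\<^sup>2 - ((1 + t * a) * (1 - t\<^sup>2))\<^sup>2 + 4 * t * a * (1 - t\<^sup>2)"
    by (simp add: X_def block_def h_def[symmetric] field_simps power2_eq_square)
  also have "\<dots> = 0"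
    unfolding h by (simp add: algebra_simps power2_eq_square)
  finally have "X = 0" by simp
  then show ?thesis by (simp add: X_def)
qed

lemma one_minus_square_nz: "norm t < R0 \<Longrightarrow> 1 - t\<^sup>2 \<noteq> (0 :: complex)"
  using norm_bounds(2)[of 0 t] by auto

lemma arch_denominator_nz:
  assumes "tame a" "norm t < R0"
  shows "(1 + t * a) * (1 - t\<^sup>2) + disc_root a t \<noteq> 0"
proof
  assume *: "(1 + t * a) * (1 - t\<^sup>2) + disc_root a t = 0"
  have "((1 + t * a) * (1 - t\<^sup>2) + disc_root a t) * ((1 + t * a) * (1 - t\<^sup>2) - disc_root a t) =
      ((1 + t * a) * (1 - t\<^sup>2))\<^sup>2 - (disc_root a t)\<^sup>2"
    by (simp add: algebra_simps power2_eq_square)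
  also have "\<dots> = 4 * (t * a) * (1 - t\<^sup>2)"
    unfolding disc_root_squared by (simp add: algebra_simps power2_eq_square)
  finally have "t = 0"
    using * one_minus_square_nz[OF assms(2)] assms(1) by (simp add: tame_def)
  with * show False by (simp add: disc_root_def)
qed

lemma block_eq_arch:
  assumes "tame a" "norm t < R0"
  shows "block a t = t * a * arch a t"
proof -
  define h where "h = disc_root a t"
  have nz: "(1 + t * a) * (1 - t\<^sup>2) + h \<noteq> 0"
    unfolding h_def by (rule arch_denominator_nz[OF assms])
  have "((1 + t * a) * (1 - t\<^sup>2) - h) * ((1 + t * a) * (1 - t\<^sup>2) + h) =
      ((1 + t * a) * (1 - t\<^sup>2))\<^sup>2 - h\<^sup>2"
    by (simp add: algebra_simps power2_eq_square)
  also have "\<dots> = 4 * (t * a) * (1 - t\<^sup>2)"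
    unfolding h_def disc_root_squared by (simp add: algebra_simps power2_eq_square)
  finally have "(1 + t * a) * (1 - t\<^sup>2) - h = 4 * (t * a) * (1 - t\<^sup>2) / ((1 + t * a) * (1 - t\<^sup>2) + h)"
    using nz by (simp add: eq_divide_eq)
  then have "block a t = 4 * (t * a) * (1 - t\<^sup>2) / ((1 + t * a) * (1 - t\<^sup>2) + h) / 2"
    by (simp add: block_def h_def)
  also have "\<dots> = t * a * (2 * (1 - t\<^sup>2) / ((1 + t * a) * (1 - t\<^sup>2) + h))"
  proof -
    have "4 * u * c / Q / 2 = u * (2 * c / Q)" for u c Q :: complex by simp
    then show ?thesis .
  qed
  finally show ?thesis
    by (simp add: arch_def h_def)
qed

lemma arch_equation:
  assumes "tame a" "norm t < R0"
  shows "(arch a t - 1) * (1 - block a t) = t\<^sup>2 * (arch a t - 1 + block a t)"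
proof (cases "t = 0")
  case True
  then show ?thesis by (simp add: arch_def block_def disc_root_def)
next
  case False
  then have "t * a \<noteq> 0" using assms by (auto simp: tame_def)
  moreover have "t * a * ((arch a t - 1) * (1 - block a t) - t\<^sup>2 * (arch a t - 1 + block a t)) =
      - ((block a t)\<^sup>2 - (1 + t * a) * (1 - t\<^sup>2) * block a t + t * a * (1 - t\<^sup>2))"
    unfolding block_eq_arch[OF assms] by (simp add: algebra_simps power2_eq_square)
  ultimately show ?thesis unfolding block_quadratic by simp
qed

lemma block_at_0 [simp]: "block a 0 = 0" and arch_at_0 [simp]: "arch a 0 = 1"
  by (simp_all add: block_def arch_def disc_root_def)

lemma block_ne_1:
  assumes "norm t < R0"
  shows "1 - block a t \<noteq> 0"
proof
  assume "1 - block a t = 0"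
  then have "block a t = 1" by simp
  moreover from this have "t\<^sup>2 = 0" using block_quadratic[of a t] by (simp add: algebra_simps)
  ultimately show False by simp
qed

text \<open>
  The last passage at each level splits off one step away of weight \<open>t / b\<close> and a
  sequence of blocks.
\<close>

definition ratio :: "complex \<Rightarrow> complex \<Rightarrow> complex \<Rightarrow> complex" where
  "ratio a b t = t * inverse b / (1 - block a t)"

text \<open>
  The equation \<open>ratio a b t = 1\<close> would imply
  \<open>(1 - t) (1 - t - t a - t\<^sup>2 a) = t (b + 1 / b - 2)\<close>, but the right-hand side is smaller in modulus than the
  left-hand side.
\<close>

lemma ratio_ne_1:
  assumes "tame a" "tame b" "norm t < R0"
  shows "1 - ratio a b t \<noteq> 0"
proof
  assume "1 - ratio a b t = 0"
  then have block: "block a t = 1 - t * inverse b"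
    using block_ne_1[OF assms(3), of a] by (simp add: ratio_def field_simps)
  have "t \<noteq> 0" using block by auto
  have b: "b \<noteq> 0" "inverse b \<noteq> 0" using assms by (auto simp: tame_def)
  have "0 = (1 - t * inverse b)\<^sup>2 - (1 + t * a) * (1 - t\<^sup>2) * (1 - t * inverse b) + t * a * (1 - t\<^sup>2)"
    using block_quadratic[of a t] unfolding block by simp
  also have "\<dots> = t * inverse b * (t * (b + inverse b - 2) - (1 - t) * (1 - t - t * a - t\<^sup>2 * a))"
    using b by (simp add: field_simps power2_eq_square)
  finally have eq: "(1 - t) * (1 - t - t * a - t\<^sup>2 * a) = t * (b + inverse b - 2)"
    using \<open>t \<noteq> 0\<close> b by simp
  have a: "norm a \<le> 201 / 200" and b': "norm (b + inverse b - 2) \<le> 1 / 100"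
    using assms by (auto simp: tame_def)
  have 1: "59 / 100 \<le> norm (1 - t)"
    using norm_triangle_ineq2[of 1 t] assms(3) by simp
  have "norm (t + t * a + t\<^sup>2 * a) \<le> 991 / 1000"
    using norm_bounds(1)[OF a assms(3)] norm_triangle_ineq[of "t + t * a" "t\<^sup>2 * a"]
      norm_triangle_ineq[of t "t * a"] by linarith
  then have 2: "9 / 1000 \<le> norm (1 - t - t * a - t\<^sup>2 * a)"
    using norm_triangle_ineq2[of 1 "t + t * a + t\<^sup>2 * a"] by (simp add: diff_diff_eq)
  have "(59 / 100) * (9 / 1000) \<le> norm ((1 - t) * (1 - t - t * a - t\<^sup>2 * a))"
    unfolding norm_mult using 1 2 by (intro mult_mono) auto
  also have "\<dots> \<le> R0 * (1 / 100)"
    unfolding eq norm_mult using assms(3) b' by (intro mult_mono) auto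
  finally show False by simp
qed

lemma holomorphic_disc_root: "norm a \<le> 201 / 200 \<Longrightarrow> disc_root a holomorphic_on ball 0 R0"
  unfolding disc_root_def using disc_factors_not_nonpos[of a]
  by (intro holomorphic_intros) auto

lemma holomorphic_block_arch:
  assumes "tame a"
  shows "block a holomorphic_on ball 0 R0" "arch a holomorphic_on ball 0 R0"
  unfolding block_def arch_def using arch_denominator_nz[OF assms] assms
  by (auto intro!: holomorphic_intros holomorphic_disc_root simp: tame_def)

lemma holomorphic_ratio:
  assumes "tame a" "tame b"
  shows "ratio a b holomorphic_on ball 0 R0"
  unfolding ratio_def using block_ne_1 by (auto intro!: holomorphic_intros holomorphic_block_arch assms)

text \<open>
  The factor \<open>1 / Den\<close> counts the sequences of blocks; \<open>Init\<close> accounts for the excursion that may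
  start at the origin, where both directions are free. In \<open>Num\<close>, the series \<open>f\<close> is the generating
  function of a function of the final distance to the corner.
\<close>

definition Den :: "complex \<Rightarrow> complex \<Rightarrow> complex \<Rightarrow> complex" where
  "Den x y t = 1 - block x t - block y t"

definition Init :: "complex \<Rightarrow> complex \<Rightarrow> complex \<Rightarrow> complex" where
  "Init x y t = arch x t + arch y t - 1"

definition Num :: "(complex \<Rightarrow> complex) \<Rightarrow> complex \<Rightarrow> complex \<Rightarrow> complex \<Rightarrow> complex" where
  "Num f x y t = f 0 * Init x y t +
     arch y t * (Den x y t + t * y * Init x y t) * (f (ratio y x t) - f 0) +
     arch x t * (Den x y t + t * x * Init x y t) * (f (ratio x y t) - f 0)"

abbreviation Num_all :: "complex \<Rightarrow> complex \<Rightarrow> complex \<Rightarrow> complex" where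
  "Num_all \<equiv> Num (\<lambda>u. 1 / (1 - u))"

fun side_forward :: "complex \<Rightarrow> complex \<Rightarrow> side \<Rightarrow> complex" where
  "side_forward x y OnTop = y" | "side_forward x y OnRight = x"

fun side_back :: "complex \<Rightarrow> complex \<Rightarrow> side \<Rightarrow> complex" where
  "side_back x y OnTop = x" | "side_back x y OnRight = y"

lemma step_weight_side:
  "step_weight x y (forward_step e) = side_forward x y e"
  "step_weight x y (back_step e) = side_back x y e"
  "step_weight x y (away_step e) = inverse (side_back x y e)"
  by (cases e; simp)+

definition corner_gf :: "complex \<Rightarrow> complex \<Rightarrow> complex \<Rightarrow> complex" where
  "corner_gf x y t = Init x y t / Den x y t"

text \<open>
  Walks after which an excursion along the edge can start: the empty walk, and walks to the corner
  with a forward step appended.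
\<close>

definition launch_gf :: "complex \<Rightarrow> complex \<Rightarrow> side \<Rightarrow> complex \<Rightarrow> complex" where
  "launch_gf x y e t = 1 + t * side_forward x y e * corner_gf x y t"

text \<open>
  For the three moves the first factors in the \<open>Edge\<close> case add up to \<open>arch\<close>.
\<close>

fun state_gf :: "complex \<Rightarrow> complex \<Rightarrow> state \<Rightarrow> complex \<Rightarrow> complex" where
  "state_gf x y (Corner True True) t = 1"
| "state_gf x y (Corner True False) t = t * y * corner_gf x y t"
| "state_gf x y (Corner False True) t = t * x * corner_gf x y t"
| "state_gf x y (Corner False False) t =
     (arch y t - 1) * launch_gf x y OnTop t + (arch x t - 1) * launch_gf x y OnRight t"
| "state_gf x y (Edge e i m) t =
     (case m of Forward \<Rightarrow> block (side_forward x y e) t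
        | Away \<Rightarrow> 1 - block (side_forward x y e) t
        | Back \<Rightarrow> arch (side_forward x y e) t - 1) *
     ratio (side_forward x y e) (side_back x y e) t ^ Suc i * launch_gf x y e t"

locale tame_weights =
  fixes x y :: complex
  assumes tame: "tame x" "tame y"
begin

lemma tame_side [simp]: "tame (side_forward x y e)" "tame (side_back x y e)"
  using tame by (cases e; simp)+

text \<open>
  A neighbourhood of 0 on which all quotients in \<open>state_gf\<close> are defined.
\<close>

definition U :: "complex set" where "U = {t \<in> ball 0 R0. Den x y t \<noteq> 0}"

lemma holomorphic_Den: "Den x y holomorphic_on ball 0 R0"
  unfolding Den_def by (intro holomorphic_intros holomorphic_block_arch tame)

lemma holomorphic_Init: "Init x y holomorphic_on ball 0 R0"
  unfolding Init_def by (intro holomorphic_intros holomorphic_block_arch tame)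

lemma open_U: "open U"
proof -
  have "U = ball 0 R0 \<inter> Den x y -` (- {0})" by (auto simp: U_def)
  then show ?thesis
    using continuous_open_preimage[OF holomorphic_on_imp_continuous_on[OF holomorphic_Den] open_ball,
        of "- {0}"] by (simp add: open_Compl)
qed

lemma zero_in_U: "0 \<in> U"
  by (simp add: U_def Den_def)

lemma U_subset: "U \<subseteq> ball 0 R0"
  by (auto simp: U_def)

lemma holomorphic_corner_gf: "corner_gf x y holomorphic_on U"
  unfolding corner_gf_def
  by (intro holomorphic_intros holomorphic_on_subset[OF holomorphic_Den U_subset]
      holomorphic_on_subset[OF holomorphic_Init U_subset]) (auto simp: U_def)

lemma holomorphic_launch_gf: "launch_gf x y e holomorphic_on U"
  unfolding launch_gf_def by (intro holomorphic_intros holomorphic_corner_gf)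

lemma holomorphic_state_gf: "state_gf x y s holomorphic_on U"
proof -
  note hol = holomorphic_on_subset[OF _ U_subset]
  have "(\<lambda>t. state_gf x y s t) holomorphic_on U"
    by (cases "(x, y, s, 0 :: complex)" rule: state_gf.cases; cases "case s of Edge e i m \<Rightarrow> m | _ \<Rightarrow> Away"; simp only: state_gf.simps state.case move.case prod.inject)
      (auto intro!: holomorphic_intros holomorphic_corner_gf holomorphic_launch_gf
          hol[OF holomorphic_block_arch(1)] hol[OF holomorphic_block_arch(2)] hol[OF holomorphic_ratio] tame
        simp del: power_Suc)
  then show ?thesis .
qed

lemma ratio_eq:
  assumes "t \<in> U"
  shows "ratio (side_forward x y e) (side_back x y e) t * (1 - block (side_forward x y e) t) =
     t * inverse (side_back x y e)"
  using block_ne_1[of t] assms by (simp add: ratio_def U_def)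

lemma return_eq:
  assumes "t \<in> U"
  shows "arch (side_forward x y e) t - 1 = t * side_back x y e *
     ratio (side_forward x y e) (side_back x y e) t *
     (arch (side_forward x y e) t - 1 + block (side_forward x y e) t)"
proof -
  have nz: "1 - block (side_forward x y e) t \<noteq> 0"
    using block_ne_1[of t] assms by (simp add: U_def)
  have "(arch (side_forward x y e) t - 1) * (1 - block (side_forward x y e) t) =
      t\<^sup>2 * (arch (side_forward x y e) t - 1 + block (side_forward x y e) t)"
    by (rule arch_equation) (use assms in \<open>auto simp: U_def\<close>)
  moreover have "side_back x y e \<noteq> 0" using tame_side(2)[of e] by (auto simp: tame_def)
  ultimately show ?thesis
    unfolding ratio_def using nz by (simp add: divide_simps power2_eq_square)
qed

lemma corner_eq:
  assumes "t \<in> U"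
  shows "corner_gf x y t = (\<Sum>s\<in>corner_states. state_gf x y s t)"
proof -
  have "corner_gf x y t * (1 - t * x * arch x t - t * y * arch y t) = arch x t + arch y t - 1"
    using assms block_eq_arch[OF tame(1), of t] block_eq_arch[OF tame(2), of t]
    by (simp add: corner_gf_def Den_def Init_def U_def)
  then show ?thesis
    by (simp add: corner_states_def launch_gf_def algebra_simps)
qed

text \<open>
  Each equation of the system reduces to one of four identities: \<open>corner_eq\<close>, \<open>ratio_eq\<close>,
  \<open>return_eq\<close> and \<open>block_eq_arch\<close>.
\<close>

lemma state_gf_system:
  assumes "t \<in> U"
  shows "state_gf x y s t = (if s = Corner True True then 1 else 0) +
     t * (\<Sum>(s', d)\<in>preds s. step_weight x y d * state_gf x y s' t)"
proof (cases s)
  case (Corner a b)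
  have C: "1 + t * y * corner_gf x y t + t * x * corner_gf x y t + state_gf x y (Corner False False) t =
      corner_gf x y t"
    using corner_eq[OF assms] by (simp add: corner_states_def add.assoc)
  consider "a \<and> b" | "a \<and> \<not> b" | "\<not> a \<and> b" | "\<not> a \<and> \<not> b" by blast
  then show ?thesis
  proof cases
    case 1
    then show ?thesis by (simp add: Corner preds_simps)
  next
    case 2
    have "t * y * corner_gf x y t = t * (y * (1 + t * y * corner_gf x y t + t * x * corner_gf x y t +
        state_gf x y (Corner False False) t))"
      unfolding C by simp
    with 2 show ?thesis
      by (simp add: Corner preds_simps distrib_left add.assoc del: state_gf.simps(4))
  next
    case 3
    have "t * x * corner_gf x y t = t * (x * (1 + t * y * corner_gf x y t + t * x * corner_gf x y t +
        state_gf x y (Corner False False) t))"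
      unfolding C by simp
    with 3 show ?thesis
      by (simp add: Corner preds_simps distrib_left add.assoc del: state_gf.simps(4))
  next
    case 4
    have "(arch y t - 1) * launch_gf x y OnTop t = t * x * ratio y x t * (arch y t - 1 + block y t) * launch_gf x y OnTop t"
      "(arch x t - 1) * launch_gf x y OnRight t = t * y * ratio x y t * (arch x t - 1 + block x t) * launch_gf x y OnRight t"
      using return_eq[OF assms, of OnTop] return_eq[OF assms, of OnRight] by simp_all
    then have "(arch y t - 1) * launch_gf x y OnTop t + (arch x t - 1) * launch_gf x y OnRight t =
        t * x * ratio y x t * (arch y t - 1 + block y t) * launch_gf x y OnTop t +
        t * y * ratio x y t * (arch x t - 1 + block x t) * launch_gf x y OnRight t"
      by (rule arg_cong2)
    with 4 show ?thesis
      by (simp add: Corner preds_simps algebra_simps)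
  qed
next
  case (Edge e i m)
  define a where "a = side_forward x y e"
  define b where "b = side_back x y e"
  define r where "r = ratio a b t"
  define K where "K = launch_gf x y e t"
  have block: "block a t = t * a * arch a t"
    unfolding a_def by (rule block_eq_arch) (use assms in \<open>auto simp: U_def\<close>)
  have ret: "arch a t - 1 = t * b * r * (arch a t - 1 + block a t)"
    unfolding a_def b_def r_def by (rule return_eq[OF assms])
  have rat: "r * (1 - block a t) = t * inverse b"
    unfolding a_def b_def r_def by (rule ratio_eq[OF assms])
  show ?thesis
  proof (cases m)
    case Forward
    then show ?thesis
      using block by (simp add: Edge preds_simps step_weight_side a_def[symmetric] b_def[symmetric]
          r_def[symmetric] K_def[symmetric] algebra_simps)
  next
    case Back
    have "(arch a t - 1) * r ^ Suc i * K = t * b * r * (arch a t - 1 + block a t) * r ^ Suc i * K"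
      using ret by simp
    then show ?thesis
      by (simp add: Back Edge preds_simps step_weight_side a_def[symmetric] b_def[symmetric]
          r_def[symmetric] K_def[symmetric] algebra_simps)
  next
    case Away
    have c: "state_gf x y (Corner (e = OnTop) (e = OnRight)) t = t * a * corner_gf x y t"
      by (cases e) (simp_all add: a_def)
    have K: "K = 1 + t * a * corner_gf x y t"
      by (simp add: K_def launch_gf_def a_def)
    have ne: "Corner True True \<noteq> Corner (e = OnTop) (e = OnRight)"
      by (cases e) auto
    show ?thesis
    proof (cases i)
      case 0
      have "state_gf x y s t = r * (1 - block a t) * K"
        by (simp add: 0 Away Edge a_def b_def r_def K_def)
      also have "\<dots> = t * (inverse b * 1 + inverse b * (t * a * corner_gf x y t))"
        unfolding rat by (simp add: K distrib_left mult.assoc)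
      also have "\<dots> = (if s = Corner True True then 1 else 0) +
          t * (\<Sum>(s', d)\<in>preds s. step_weight x y d * state_gf x y s' t)"
        using ne by (simp add: 0 Away Edge preds_simps step_weight_side b_def[symmetric] c)
      finally show ?thesis .
    next
      case (Suc j)
      have "(1 - block a t) * r ^ Suc (Suc j) * K = r * (1 - block a t) * r ^ Suc j * K"
        by (simp add: algebra_simps)
      also have "\<dots> = t * inverse b * r ^ Suc j * K"
        unfolding rat ..
      finally show ?thesis
        by (simp add: Suc Away Edge preds_simps step_weight_side a_def[symmetric] b_def[symmetric]
            r_def[symmetric] K_def[symmetric] algebra_simps)
    qed
  qed
qed

lemma state_sum_gf: "state_gf x y s has_fps_expansion Abs_fps (\<lambda>n. state_sum x y n s)"
proof -
  define F where "F = (\<lambda>s. fps_expansion (state_gf x y s) 0)"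
  have F: "state_gf x y s has_fps_expansion F s" for s
    unfolding F_def by (rule has_fps_expansion_fps_expansion[OF open_U zero_in_U holomorphic_state_gf])
  have "F s = (if s = Corner True True then 1 else 0) +
      fps_X * (\<Sum>(s', d)\<in>preds s. fps_const (step_weight x y d) * F s')" (is "_ = ?rhs") for s
  proof -
    have "(\<lambda>t. (if s = Corner True True then 1 else 0) +
        t * (\<Sum>(s', d)\<in>preds s. step_weight x y d * state_gf x y s' t)) has_fps_expansion ?rhs"
      unfolding case_prod_unfold by (auto intro!: fps_expansion_intros F)
    moreover have "\<forall>\<^sub>F t in nhds 0. state_gf x y s t = (if s = Corner True True then 1 else 0) +
        t * (\<Sum>(s', d)\<in>preds s. step_weight x y d * state_gf x y s' t)"
      using eventually_nhds_in_open[OF open_U zero_in_U]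
      by eventually_elim (rule state_gf_system)
    ultimately have "state_gf x y s has_fps_expansion ?rhs"
      by (subst has_fps_expansion_cong[OF _ refl]) auto
    then show ?thesis using F[of s] fps_expansion_unique_complex by blast
  qed
  then have "state_sum x y n s = fps_nth (F s) n" for n s
    by (rule state_sum_eq_fps_nth)
  then have "Abs_fps (\<lambda>n. state_sum x y n s) = F s"
    by (simp add: fps_eq_iff)
  then show ?thesis using F by simp
qed

text \<open>
  The states at distance \<open>i\<close> contribute \<open>\<phi> i\<close> times the \<open>i\<close>-th power of \<open>ratio\<close>; the sum over all
  levels is the composition of \<open>f\<close> with \<open>ratio\<close>.
\<close>

theorem dist_sum_gf:
  assumes f: "f has_fps_expansion Abs_fps \<phi>"
  shows "(\<lambda>t. Num f x y t / Den x y t) has_fps_expansion Abs_fps (dist_sum \<phi> x y)"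
proof -
  define r where "r = (\<lambda>e. fps_expansion (ratio (side_forward x y e) (side_back x y e)) 0)"
  define M where "M = (\<lambda>e t. arch (side_forward x y e) t * launch_gf x y e t)"
  define H where "H = (\<lambda>e. fps_expansion (M e) 0)"
  define C where "C = fps_expansion (corner_gf x y) 0"
  have r: "ratio (side_forward x y e) (side_back x y e) has_fps_expansion r e" for e
    unfolding r_def
    by (rule has_fps_expansion_fps_expansion[OF open_ball _ holomorphic_ratio[OF tame_side]]) auto
  have r0: "fps_nth (r e) 0 = 0" for e
    using has_fps_expansion_imp_0_eq_fps_nth_0[OF r[of e]] by (simp add: ratio_def)
  have H: "M e has_fps_expansion H e" for e
    unfolding H_def
  proof (rule has_fps_expansion_fps_expansion[OF open_U zero_in_U])
    show "M e holomorphic_on U"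
      unfolding M_def by (intro holomorphic_intros holomorphic_launch_gf
          holomorphic_on_subset[OF holomorphic_block_arch(2) U_subset] tame_side)
  qed
  have C: "corner_gf x y has_fps_expansion C"
    unfolding C_def by (rule has_fps_expansion_fps_expansion[OF open_U zero_in_U holomorphic_corner_gf])
  have f0: "f 0 = \<phi> 0"
    using has_fps_expansion_imp_0_eq_fps_nth_0[OF f] by simp

  have corners: "(\<Sum>s\<in>corner_states. state_sum x y n s) = fps_nth C n" for n
  proof -
    have "(\<lambda>t. \<Sum>s\<in>corner_states. state_gf x y s t) has_fps_expansion
        (\<Sum>s\<in>corner_states. Abs_fps (\<lambda>n. state_sum x y n s))"
      by (intro fps_expansion_intros state_sum_gf)
    moreover have "\<forall>\<^sub>F t in nhds 0. corner_gf x y t = (\<Sum>s\<in>corner_states. state_gf x y s t)"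
      using eventually_nhds_in_open[OF open_U zero_in_U] by eventually_elim (rule corner_eq)
    ultimately have "corner_gf x y has_fps_expansion (\<Sum>s\<in>corner_states. Abs_fps (\<lambda>n. state_sum x y n s))"
      by (subst has_fps_expansion_cong[OF _ refl]) auto
    then have "C = (\<Sum>s\<in>corner_states. Abs_fps (\<lambda>n. state_sum x y n s))"
      using C fps_expansion_unique_complex by blast
    then show ?thesis by (simp add: fps_sum_nth)
  qed
  have edges: "(\<Sum>s\<in>edge_states i. state_sum x y n s) =
      fps_nth (r OnTop ^ Suc i * H OnTop + r OnRight ^ Suc i * H OnRight) n" for i n
  proof -
    have sides: "(\<Sum>s\<in>edge_states i. g s) = (\<Sum>e\<in>{OnTop, OnRight}. \<Sum>m\<in>{Forward, Away, Back}. g (Edge e i m))"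
      for g :: "state \<Rightarrow> 'z :: comm_monoid_add"
      by (simp add: edge_states_def add.assoc)
    have "(\<lambda>t. \<Sum>s\<in>edge_states i. state_gf x y s t) has_fps_expansion
        (\<Sum>s\<in>edge_states i. Abs_fps (\<lambda>n. state_sum x y n s))"
      by (intro fps_expansion_intros state_sum_gf)
    moreover have "(\<Sum>s\<in>edge_states i. state_gf x y s t) =
        ratio (side_forward x y OnTop) (side_back x y OnTop) t ^ Suc i * M OnTop t +
        ratio (side_forward x y OnRight) (side_back x y OnRight) t ^ Suc i * M OnRight t" for t
      unfolding sides by (simp add: M_def algebra_simps)
    ultimately have "(\<lambda>t. ratio (side_forward x y OnTop) (side_back x y OnTop) t ^ Suc i * M OnTop t +
        ratio (side_forward x y OnRight) (side_back x y OnRight) t ^ Suc i * M OnRight t)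
        has_fps_expansion (\<Sum>s\<in>edge_states i. Abs_fps (\<lambda>n. state_sum x y n s))"
      by simp
    moreover have "(\<lambda>t. ratio (side_forward x y OnTop) (side_back x y OnTop) t ^ Suc i * M OnTop t +
        ratio (side_forward x y OnRight) (side_back x y OnRight) t ^ Suc i * M OnRight t)
        has_fps_expansion (r OnTop ^ Suc i * H OnTop + r OnRight ^ Suc i * H OnRight)"
      by (intro fps_expansion_intros r H)
    ultimately have "(\<Sum>s\<in>edge_states i. Abs_fps (\<lambda>n. state_sum x y n s)) =
        r OnTop ^ Suc i * H OnTop + r OnRight ^ Suc i * H OnRight"
      using fps_expansion_unique_complex by blast
    then show ?thesis by (metis (no_types, lifting) fps_nth_Abs_fps fps_sum_nth sum.cong)
  qed
  \<comment> \<open>\<open>ratio\<close> vanishes at 0, so levels beyond \<open>n\<close> do not reach the \<open>n\<close>-th coefficient.\<close>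
  define T where "T = (\<lambda>e. (Abs_fps \<phi> oo r e) - fps_const (\<phi> 0))"
  have T: "fps_nth (T e * H e) n = (\<Sum>i<n. \<phi> (Suc i) * fps_nth (r e ^ Suc i * H e) n)" for e n
  proof -
    have Tj: "fps_nth (T e) j = (\<Sum>i<n. \<phi> (Suc i) * fps_nth (r e ^ Suc i) j)" if "j \<le> n" for j
    proof -
      have "fps_nth (Abs_fps \<phi> oo r e) j = (\<Sum>i=0..j. \<phi> i * fps_nth (r e ^ i) j)"
        by (simp add: fps_compose_nth)
      also have "\<dots> = (\<Sum>i\<le>n. \<phi> i * fps_nth (r e ^ i) j)"
        by (rule sum.mono_neutral_left)
          (use that r0 in \<open>auto simp: startsby_zero_power_prefix\<close>)
      also have "\<dots> = \<phi> 0 * fps_nth (fps_const 1) j + (\<Sum>i<n. \<phi> (Suc i) * fps_nth (r e ^ Suc i) j)"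
        by (simp only: lessThan_Suc_atMost[symmetric] sum.lessThan_Suc_shift) simp
      finally show ?thesis by (simp add: T_def)
    qed
    have "fps_nth (T e * H e) n = (\<Sum>j=0..n. fps_nth (T e) j * fps_nth (H e) (n - j))"
      by (rule fps_mult_nth)
    also have "\<dots> = (\<Sum>j=0..n. \<Sum>i<n. \<phi> (Suc i) * (fps_nth (r e ^ Suc i) j * fps_nth (H e) (n - j)))"
      by (intro sum.cong refl) (simp add: Tj sum_distrib_right mult.assoc)
    also have "\<dots> = (\<Sum>i<n. \<phi> (Suc i) * fps_nth (r e ^ Suc i * H e) n)"
      by (subst sum.swap) (simp add: fps_mult_nth sum_distrib_left del: power_Suc)
    finally show ?thesis .
  qed
  have "Abs_fps (dist_sum \<phi> x y) = fps_const (\<phi> 0) * C + T OnTop * H OnTop + T OnRight * H OnRight"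
  proof (rule fps_ext)
    fix n
    show "fps_nth (Abs_fps (dist_sum \<phi> x y)) n =
        fps_nth (fps_const (\<phi> 0) * C + T OnTop * H OnTop + T OnRight * H OnRight) n"
      by (simp add: dist_sum_eq_state_sums corners edges T distrib_left sum.distrib del: power_Suc)
  qed
  moreover have "(\<lambda>t. f 0 * corner_gf x y t +
      ((f \<circ> ratio (side_forward x y OnTop) (side_back x y OnTop)) t - \<phi> 0) * M OnTop t +
      ((f \<circ> ratio (side_forward x y OnRight) (side_back x y OnRight)) t - \<phi> 0) * M OnRight t)
      has_fps_expansion (fps_const (\<phi> 0) * C + T OnTop * H OnTop + T OnRight * H OnRight)"
    unfolding T_def f0 by (intro fps_expansion_intros has_fps_expansion_compose[OF f r] r0 H C)
  moreover have "\<forall>\<^sub>F t in nhds 0. Num f x y t / Den x y t = f 0 * corner_gf x y t +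
      ((f \<circ> ratio (side_forward x y OnTop) (side_back x y OnTop)) t - \<phi> 0) * M OnTop t +
      ((f \<circ> ratio (side_forward x y OnRight) (side_back x y OnRight)) t - \<phi> 0) * M OnRight t"
    using eventually_nhds_in_open[OF open_U zero_in_U]
  proof eventually_elim
    case (elim t)
    then have "Den x y t \<noteq> 0" by (simp add: U_def)
    then show ?case
      by (simp add: Num_def M_def launch_gf_def corner_gf_def f0 divide_simps)
  qed
  ultimately show ?thesis
    by (subst has_fps_expansion_cong[OF _ refl]) auto
qed

end

section \<open>Unweighted walks: the cubic and the corner distance\<close>

lemma cubic_root_exists:
  "\<exists>x::real. 0.4030317 \<le> x \<and> x \<le> 0.4030318 \<and> 1 - 2 * x - 2 * x\<^sup>2 + 2 * x ^ 3 = 0"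
proof -
  have "\<exists>x::real\<ge>0.4030317. x \<le> 0.4030318 \<and> 1 - 2 * x - 2 * x\<^sup>2 + 2 * x ^ 3 = 0"
    by (rule IVT2') (auto simp: eval_nat_numeral intro!: continuous_intros)
  then show ?thesis by blast
qed

text \<open>
  The interval is short because some constants of the theorem are sensitive to \<open>rho\<close>: the denominator
  of \<open>\<kappa>\<close> contains \<open>5 rho - 2\<close>, which is about 0.015.
\<close>

definition rho :: real where
  "rho = (SOME x. 0.4030317 \<le> x \<and> x \<le> 0.4030318 \<and> 1 - 2 * x - 2 * x\<^sup>2 + 2 * x ^ 3 = 0)"

lemma rho: "0.4030317 \<le> rho" "rho \<le> 0.4030318" "1 - 2 * rho - 2 * rho\<^sup>2 + 2 * rho ^ 3 = 0"
  using someI_ex[OF cubic_root_exists] unfolding rho_def by blast+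

lemma rho_powers:
  "0.16243455 \<le> rho\<^sup>2" "rho\<^sup>2 \<le> 0.16243464"
  "0.06546627 \<le> rho ^ 3" "rho ^ 3 \<le> 0.06546633"
  "0.02638498 \<le> rho ^ 4" "rho ^ 4 \<le> 0.02638502"
proof -
  have l: "0.4030317 ^ k \<le> rho ^ k" and u: "rho ^ k \<le> 0.4030318 ^ k" for k
    using rho by (auto intro!: power_mono)
  show "0.16243455 \<le> rho\<^sup>2" "rho\<^sup>2 \<le> 0.16243464"
    "0.06546627 \<le> rho ^ 3" "rho ^ 3 \<le> 0.06546633"
    "0.02638498 \<le> rho ^ 4" "rho ^ 4 \<le> 0.02638502"
    using l[of 2] u[of 2] l[of 3] u[of 3] l[of 4] u[of 4] by (simp_all add: eval_nat_numeral)
qed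

lemma cubic_complex: "1 - 2 * of_real rho - 2 * (of_real rho)\<^sup>2 + 2 * (of_real rho) ^ 3 = (0 :: complex)"
proof -
  have "of_real (1 - 2 * rho - 2 * rho\<^sup>2 + 2 * rho ^ 3) = (0 :: complex)"
    unfolding rho(3) by simp
  then show ?thesis by simp
qed

text \<open>
  After division by \<open>t - rho\<close> a quadratic remains, whose constant term dominates in the disc.
\<close>

lemma cubic_unique:
  fixes t :: complex
  assumes "norm t < R0" "1 - 2 * t - 2 * t\<^sup>2 + 2 * t ^ 3 = 0"
  shows "t = of_real rho"
proof -
  define p where "p = complex_of_real rho"
  have "(t - p) * (2 * t\<^sup>2 + (2 * p - 2) * t + (2 * p\<^sup>2 - 2 * p - 2)) =
      (1 - 2 * t - 2 * t\<^sup>2 + 2 * t ^ 3) - (1 - 2 * p - 2 * p\<^sup>2 + 2 * p ^ 3)"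
    by (simp add: algebra_simps eval_nat_numeral)
  also have "\<dots> = 0"
    unfolding assms(2) p_def cubic_complex by simp
  finally have or: "t = p \<or> 2 * t\<^sup>2 + (2 * p - 2) * t + (2 * p\<^sup>2 - 2 * p - 2) = 0"
    by simp
  have "2 * t\<^sup>2 + (2 * p - 2) * t + (2 * p\<^sup>2 - 2 * p - 2) \<noteq> 0"
  proof
    assume "2 * t\<^sup>2 + (2 * p - 2) * t + (2 * p\<^sup>2 - 2 * p - 2) = 0"
    then have "2 * t\<^sup>2 + (2 * p - 2) * t = - (2 * p\<^sup>2 - 2 * p - 2)"
      by (simp only: eq_neg_iff_add_eq_0)
    also have "\<dots> = of_real (2 + 2 * rho - 2 * rho\<^sup>2)"
      by (simp add: p_def)
    finally have eq: "norm (2 * t\<^sup>2 + (2 * p - 2) * t) = \<bar>2 + 2 * rho - 2 * rho\<^sup>2\<bar>"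
      by (simp only: norm_of_real)
    have "norm (2 * t\<^sup>2 + (2 * p - 2) * t) \<le> norm (2 * t\<^sup>2) + norm ((2 * p - 2) * t)"
      by (rule norm_triangle_ineq)
    also have "\<dots> \<le> 2 * R0\<^sup>2 + 2 * R0"
    proof (rule add_mono)
      show "norm (2 * t\<^sup>2) \<le> 2 * R0\<^sup>2"
        using power_mono[of "norm t" R0 2] assms(1) by (simp add: norm_mult norm_power)
      have "2 * p - 2 = of_real (2 * rho - 2)" by (simp add: p_def)
      then have "norm (2 * p - 2) = \<bar>2 * rho - 2\<bar>" by (simp only: norm_of_real)
      then have "norm (2 * p - 2) \<le> 2" using rho by simp
      then show "norm ((2 * p - 2) * t) \<le> 2 * R0"
        unfolding norm_mult using assms(1) by (intro mult_mono) auto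
    qed
    finally show False unfolding eq using rho rho_powers by (simp add: power2_eq_square)
  qed
  with or show ?thesis by (simp add: p_def)
qed

abbreviation crho :: complex where "crho \<equiv> complex_of_real rho"

lemma norm_crho: "norm crho < R0" and crho_nz: "crho \<noteq> 0"
  using rho by auto

lemma tame_1: "tame 1"
  by (simp add: tame_def)

lemma block_half_imp:
  assumes "block a t = 1 / 2"
  shows "2 * (1 - t\<^sup>2) * (1 - t * a) = 1"
proof -
  have "(1 / 2)\<^sup>2 - (1 + t * a) * (1 - t\<^sup>2) * (1 / 2) + t * a * (1 - t\<^sup>2) = 0"
    using block_quadratic[of a t] unfolding assms .
  then show ?thesis by (simp add: field_simps power2_eq_square)
qed

text \<open>
  The cubic makes 1/2 a root of the quadratic equation. The other root cannot be the value of
  \<open>block\<close>, since then \<open>disc_root\<close>, a product of positive real square roots, would be negative.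
\<close>

lemma block_1_rho: "block 1 crho = 1 / 2"
proof -
  define S where "S = (1 + crho) * (1 - crho\<^sup>2)"
  define h where "h = sqrt (1 - rho\<^sup>2) * sqrt (1 - rho - rho - rho\<^sup>2) * sqrt (1 + rho - rho + rho\<^sup>2)"
  have pos: "1 - rho\<^sup>2 > 0" "1 - rho - rho - rho\<^sup>2 > 0" "1 + rho - rho + rho\<^sup>2 > 0"
    using rho rho_powers by auto
  have factors: "1 - crho\<^sup>2 = of_real (1 - rho\<^sup>2)"
    "1 - crho - crho * 1 - crho\<^sup>2 * 1 = of_real (1 - rho - rho - rho\<^sup>2)"
    "1 + crho - crho * 1 + crho\<^sup>2 * 1 = of_real (1 + rho - rho + rho\<^sup>2)"
    by simp_all
  have sq: "csqrt (of_real u) = of_real (sqrt u)" if "u > 0" for u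
    using csqrt_of_real_nonneg[of "of_real u"] that by simp
  have "disc_root 1 crho = of_real h"
    unfolding disc_root_def factors h_def of_real_mult
    by (simp only: sq[OF pos(1)] sq[OF pos(2)] sq[OF pos(3)])
  then have block: "block 1 crho = (S - of_real h) / 2"
    by (simp add: block_def S_def)
  have "h > 0" using pos by (simp add: h_def)
  have "(block 1 crho - 1 / 2) * (block 1 crho - (S - 1 / 2)) =
      ((block 1 crho)\<^sup>2 - (1 + crho * 1) * (1 - crho\<^sup>2) * block 1 crho + crho * 1 * (1 - crho\<^sup>2)) -
      (1 - 2 * crho - 2 * crho\<^sup>2 + 2 * crho ^ 3) / 4 * -1 * 1"
    unfolding S_def by (simp add: field_simps eval_nat_numeral)
  also have "\<dots> = 0"
    unfolding block_quadratic cubic_complex by simp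
  finally consider "block 1 crho = 1 / 2" | "block 1 crho = S - 1 / 2" by fastforce
  then show ?thesis
  proof cases
    case 2
    have half: "u = u / 2 * 2" for u :: complex by simp
    have "S - of_real h = (S - of_real h) / 2 * 2" by (rule half)
    also have "\<dots> = (S - 1 / 2) * 2" using 2 unfolding block by (simp only:)
    also have "\<dots> = 2 * S - 1" by (simp add: algebra_simps)
    finally have S: "S - of_real h = 2 * S - 1" .
    have "complex_of_real h = S - (S - of_real h)" by simp
    also have "\<dots> = 1 - S" unfolding S by simp
    also have "\<dots> = of_real (1 - (1 + rho) * (1 - rho\<^sup>2))" by (simp add: S_def)
    finally have "h = 1 - (1 + rho) * (1 - rho\<^sup>2)" by (simp only: of_real_eq_iff)
    also have "\<dots> < 0" using rho rho_powers by (simp add: algebra_simps eval_nat_numeral)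
    finally show ?thesis using \<open>h > 0\<close> by simp
  qed
qed

lemma Den_11: "Den 1 1 t = 1 - 2 * block 1 t"
  by (simp add: Den_def)

lemma Den_zero: "Den 1 1 crho = 0"
  by (simp add: Den_11 block_1_rho)

lemma Den_unique:
  assumes "norm t < R0" "Den 1 1 t = 0"
  shows "t = crho"
proof -
  have "2 * block 1 t = 1"
    using assms by (simp add: Den_11)
  then have "block 1 t = 1 / 2"
    by (metis nonzero_mult_div_cancel_left zero_neq_numeral)
  then have "2 * (1 - t\<^sup>2) * (1 - t * 1) = 1"
    by (rule block_half_imp)
  then have "1 - 2 * t - 2 * t\<^sup>2 + 2 * t ^ 3 = 0"
    by (simp add: algebra_simps eval_nat_numeral)
  then show ?thesis using cubic_unique assms(1) by blast
qed

text \<open>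
  Implicit differentiation of \<open>block_quadratic\<close>.
\<close>

lemma deriv_Den: "deriv (Den 1 1) crho = - (1 - crho) * (1 + 3 * crho) / (crho * (1 - crho - crho\<^sup>2))"
proof -
  have D: "(block 1 has_field_derivative deriv (block 1) crho) (at crho)"
    using holomorphic_derivI[OF holomorphic_block_arch(1)[OF tame_1] open_ball] norm_crho by simp
  define g where "g = deriv (block 1) crho"
  define p where "p = crho"
  have "((\<lambda>t. (block 1 t)\<^sup>2 - (1 + t * 1) * (1 - t\<^sup>2) * block 1 t + t * 1 * (1 - t\<^sup>2)) has_field_derivative
      (g - ((1 - p\<^sup>2) - 2 * p * (1 + p)) / 2 - (1 + p) * (1 - p\<^sup>2) * g + (1 - p\<^sup>2) - 2 * p\<^sup>2)) (at crho)"
    by (rule derivative_eq_intros D refl)+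
      (simp add: block_1_rho g_def[symmetric] p_def field_simps power2_eq_square)
  then have "g - ((1 - p\<^sup>2) - 2 * p * (1 + p)) / 2 - (1 + p) * (1 - p\<^sup>2) * g + (1 - p\<^sup>2) - 2 * p\<^sup>2 = 0"
    unfolding block_quadratic using DERIV_const DERIV_unique by blast
  then have eq: "2 * g * (p * (1 - p - p\<^sup>2)) = (1 - p) * (1 + 3 * p)"
    by (simp add: field_simps power2_eq_square)
  have nz: "p * (1 - p - p\<^sup>2) \<noteq> 0"
  proof -
    have "1 - p - p\<^sup>2 = of_real (1 - rho - rho\<^sup>2)" by (simp add: p_def)
    moreover have "1 - rho - rho\<^sup>2 \<noteq> 0" using rho rho_powers by auto
    ultimately show ?thesis using crho_nz by (simp only: p_def mult_eq_0_iff of_real_eq_0_iff) simp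
  qed
  have "deriv (Den 1 1) crho = - 2 * g"
  proof (rule DERIV_imp_deriv)
    have "((\<lambda>t. 1 - 2 * block 1 t) has_field_derivative - 2 * g) (at crho)"
      by (rule derivative_eq_intros D refl)+ (simp add: g_def)
    then show "(Den 1 1 has_field_derivative - 2 * g) (at crho)"
      by (simp add: Den_11[abs_def])
  qed
  also have "\<dots> = - (1 - p) * (1 + 3 * p) / (p * (1 - p - p\<^sup>2))"
    using eq nz by (simp add: eq_divide_eq algebra_simps)
  finally show ?thesis by (simp add: p_def)
qed

lemma deriv_Den_nz: "deriv (Den 1 1) crho \<noteq> 0"
proof -
  have "1 - crho = of_real (1 - rho)" "1 + 3 * crho = of_real (1 + 3 * rho)"
    "1 - crho - crho\<^sup>2 = of_real (1 - rho - rho\<^sup>2)" by simp_all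
  moreover have "1 - rho \<noteq> 0" "1 + 3 * rho \<noteq> 0" "1 - rho - rho\<^sup>2 \<noteq> 0"
    using rho rho_powers by auto
  ultimately show ?thesis
    unfolding deriv_Den using crho_nz
    by (simp only: divide_eq_0_iff mult_eq_0_iff neg_equal_0_iff_equal minus_mult_left[symmetric] of_real_eq_0_iff)
      simp
qed

lemma Num_rho: "Num f 1 1 crho = (1 - crho) / crho * f (2 * crho)"
proof -
  have arch: "arch 1 crho = 1 / (2 * crho)"
    using block_eq_arch[OF tame_1 norm_crho] crho_nz by (simp add: block_1_rho field_simps)
  have r: "ratio 1 1 crho = 2 * crho"
    by (simp add: ratio_def block_1_rho)
  show ?thesis
    unfolding Num_def r Den_zero Init_def arch using crho_nz by (simp add: field_simps)
qed

lemma holomorphic_Num: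
  assumes "tame x" "tame y" "f holomorphic_on - {1}"
  shows "Num f x y holomorphic_on ball 0 R0"
proof -
  have comp: "(\<lambda>t. f (ratio a b t)) holomorphic_on ball 0 R0" if "tame a" "tame b" for a b
    by (rule holomorphic_on_compose_gen[OF holomorphic_ratio[OF that] assms(3), unfolded o_def])
      (use ratio_ne_1[OF that] in auto)
  show ?thesis
    unfolding Num_def Den_def Init_def
    by (intro holomorphic_intros comp holomorphic_block_arch assms)
qed

text \<open>
  The residue of the generating function at \<open>rho\<close>, divided by \<open>- rho\<close>, is \<open>amplitude * f (2 rho)\<close>.
\<close>

definition amplitude :: real where "amplitude = (1 - rho - rho\<^sup>2) / (rho * (1 + 3 * rho))"

lemma amplitude_pos: "amplitude > 0"
  unfolding amplitude_def using rho rho_powers by (intro divide_pos_pos mult_pos_pos) auto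

lemma residue_eq: "- Num f 1 1 crho / (crho * deriv (Den 1 1) crho) = of_real amplitude * f (2 * crho)"
proof -
  have "1 - crho = of_real (1 - rho)" "1 + 3 * crho = of_real (1 + 3 * rho)"
    "1 - crho - crho\<^sup>2 = of_real (1 - rho - rho\<^sup>2)" by simp_all
  moreover have "1 - rho \<noteq> 0" "1 + 3 * rho \<noteq> 0" "1 - rho - rho\<^sup>2 \<noteq> 0"
    using rho rho_powers by auto
  ultimately have nz: "1 - crho \<noteq> 0" "1 + 3 * crho \<noteq> 0" "1 - crho - crho\<^sup>2 \<noteq> 0"
    by (metis of_real_eq_0_iff)+
  have "- ((1 - p) / p * u) / (p * (- (1 - p) * q / (p * s))) = s / (p * q) * u"
    if "p \<noteq> 0" "1 - p \<noteq> 0" "q \<noteq> 0" "s \<noteq> 0" for p q s u :: complex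
    using that by (simp add: divide_simps) (simp add: algebra_simps)
  from this[OF crho_nz nz] show ?thesis
    by (simp add: Num_rho deriv_Den amplitude_def)
qed

lemma dist_sum_limit:
  assumes f: "f has_fps_expansion Abs_fps \<phi>" "f holomorphic_on - {1}" "f (2 * crho) \<noteq> 0"
  shows "(\<lambda>n. dist_sum \<phi> 1 1 n * crho ^ n) \<longlonglongrightarrow> of_real amplitude * f (2 * crho)"
proof -
  interpret tame_weights 1 1
    by standard (simp_all add: tame_1)
  have "1 - crho = of_real (1 - rho)" by simp
  then have "1 - crho \<noteq> 0" using rho by (simp only: of_real_eq_0_iff) simp
  then have N0: "Num f 1 1 crho \<noteq> 0" using f(3) crho_nz by (simp add: Num_rho)
  have cD: "continuous_on (ball 0 1 \<times> ball 0 R0) (\<lambda>(z :: complex, t). Den 1 1 t)"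
    and cN: "continuous_on (ball 0 1 \<times> ball 0 R0) (\<lambda>(z :: complex, t). Num f 1 1 t)"
    unfolding case_prod_unfold
    by (rule continuous_on_compose2[OF holomorphic_on_imp_continuous_on[OF holomorphic_Den]]
        continuous_on_compose2[OF holomorphic_on_imp_continuous_on[OF holomorphic_Num[OF tame f(2)]]],
        auto intro!: continuous_intros)+
  have *: "\<exists>d r \<kappa>. 0 < d \<and> r 0 = crho \<and> \<kappa> 0 = - Num f 1 1 crho / (crho * deriv (Den 1 1) crho) \<and>
      uniform_limit (ball 0 d) (\<lambda>n z :: complex. dist_sum \<phi> 1 1 n * r z ^ n) \<kappa> sequentially"
    by (rule simple_pole_perturbation[where D = "\<lambda>_. Den 1 1" and N = "\<lambda>_. Num f 1 1" and
          p = "\<lambda>n _. dist_sum \<phi> 1 1 n", OF zero_less_one crho_nz norm_crho cD cN holomorphic_Den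
          holomorphic_Num[OF tame f(2)] Den_zero deriv_Den_nz Den_unique N0 dist_sum_gf[OF f(1)]
          holomorphic_on_const]) (assumption+, blast)
  then obtain d r \<kappa> where d: "0 < d" and r: "r 0 = crho"
    and \<kappa>: "\<kappa> 0 = - Num f 1 1 crho / (crho * deriv (Den 1 1) crho)"
    and lim: "uniform_limit (ball 0 d) (\<lambda>n z :: complex. dist_sum \<phi> 1 1 n * r z ^ n) \<kappa> sequentially"
    by blast
  have "(\<lambda>n. dist_sum \<phi> 1 1 n * r 0 ^ n) \<longlonglongrightarrow> \<kappa> 0"
    by (rule tendsto_uniform_limitI[OF lim]) (use d in simp)
  then show ?thesis
    unfolding r \<kappa> residue_eq .
qed

lemma geometric_fps: "(\<lambda>u::complex. 1 / (1 - u)) has_fps_expansion Abs_fps (\<lambda>_. 1)"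
proof -
  have "(1 - fps_X) * Abs_fps (\<lambda>_. 1 :: complex) = 1"
    by (rule fps_ext) (auto simp: left_diff_distrib fps_X_mult_nth)
  then have "Abs_fps (\<lambda>_. 1 :: complex) = inverse (1 - fps_X)"
    by (metis fps_inverse_unique mult.commute)
  moreover have "(\<lambda>u::complex. inverse (1 - u)) has_fps_expansion inverse (1 - fps_X)"
    by (intro fps_expansion_intros) auto
  ultimately show ?thesis by (simp add: inverse_eq_divide)
qed

lemma power_fps: "(\<lambda>u::complex. u ^ k) has_fps_expansion Abs_fps (\<lambda>n. if n = k then 1 else 0)"
proof -
  have "Abs_fps (\<lambda>n. if n = k then 1 else 0) = (fps_X :: complex fps) ^ k"
    by (rule fps_ext) (simp add: fps_X_power_nth)
  then show ?thesis by (simp add: fps_expansion_intros)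
qed

lemma mean_fps: "(\<lambda>u::complex. u * (1 / (1 - u)) * (1 / (1 - u))) has_fps_expansion Abs_fps of_nat"
proof -
  have sq: "Abs_fps (\<lambda>_. 1 :: complex) * Abs_fps (\<lambda>_. 1) = Abs_fps (\<lambda>n. of_nat (Suc n))"
    by (rule fps_ext) (simp add: fps_mult_nth)
  have "Abs_fps of_nat = fps_X * (Abs_fps (\<lambda>_. 1 :: complex) * Abs_fps (\<lambda>_. 1))"
    unfolding sq by (rule fps_ext) (auto simp: fps_X_mult_nth)
  moreover have "(\<lambda>u::complex. u * (1 / (1 - u)) * (1 / (1 - u))) has_fps_expansion
      fps_X * Abs_fps (\<lambda>_. 1) * Abs_fps (\<lambda>_. 1)"
    by (intro has_fps_expansion_mult has_fps_expansion_fps_X geometric_fps)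
  ultimately show ?thesis by (simp only: mult.assoc)
qed

lemma dist_sum_11: "dist_sum \<phi> 1 1 n = (\<Sum>w\<in>two_sided_walks n. \<phi> (state_dist (the (run w))))"
proof -
  have "step_weight 1 1 = (\<lambda>_. 1)"
    by (rule ext) (metis inverse_1 step_weight.simps step.exhaust)
  then have "walk_weight 1 1 w = 1" for w
    by (simp add: walk_weight_def) (induction w; simp)
  then show ?thesis by (simp add: dist_sum_def)
qed

lemma corner_dist_eq: "w \<in> two_sided_walks n \<Longrightarrow> corner_dist w = real (state_dist (the (run w)))"
  using corner_dist_eq_state_dist by (auto simp: two_sided_walks_def two_sided_iff_run)

lemma card_eq: "walk_sum 1 1 n = of_nat (card (two_sided_walks n))"
  by (simp add: dist_sum_11)

lemma prob_eq: "dist_sum (\<lambda>n. if n = k then 1 else 0) 1 1 n / walk_sum 1 1 n =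
    of_real (measure_pmf.prob (random_walk n) {w. corner_dist w = real k})"
proof -
  have "dist_sum (\<lambda>n. if n = k then 1 else 0) 1 1 n =
      of_nat (card (two_sided_walks n \<inter> {w. corner_dist w = real k}))"
    unfolding dist_sum_11
    by (subst sum.inter_filter[symmetric, OF finite_two_sided_walks])
      (auto simp: corner_dist_eq intro!: arg_cong[where f = card])
  then show ?thesis
    by (simp add: card_eq random_walk_def measure_pmf_of_set finite_two_sided_walks two_sided_walks_nonempty)
qed

lemma mean_eq: "dist_sum of_nat 1 1 n / walk_sum 1 1 n =
    of_real (measure_pmf.expectation (random_walk n) corner_dist)"
proof -
  have "dist_sum of_nat 1 1 n = of_real (\<Sum>w\<in>two_sided_walks n. corner_dist w)"
    unfolding dist_sum_11 of_real_sum by (intro sum.cong refl) (simp add: corner_dist_eq)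
  then show ?thesis
    by (simp add: card_eq random_walk_def integral_pmf_of_set finite_two_sided_walks two_sided_walks_nonempty)
qed

lemma two_crho_ne_1: "1 - 2 * crho \<noteq> 0"
proof -
  have "1 - 2 * crho = of_real (1 - 2 * rho)" by simp
  then show ?thesis using rho by (simp only: of_real_eq_0_iff) simp
qed

lemma card_limit: "(\<lambda>n. walk_sum 1 1 n * crho ^ n) \<longlonglongrightarrow> of_real (amplitude / (1 - 2 * rho))"
proof -
  have "(\<lambda>u::complex. 1 / (1 - u)) holomorphic_on - {1}"
    by (auto intro!: holomorphic_intros)
  from dist_sum_limit[OF geometric_fps this] two_crho_ne_1 show ?thesis by simp
qed

text \<open>
  All generating functions of this form have the same pole, so that only the values \<open>f (2 rho)\<close> matter; for
  \<open>1 / (1 - u)\<close> the value is \<open>1 / (1 - 2 rho)\<close>.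
\<close>

lemma dist_limit:
  assumes f: "f has_fps_expansion Abs_fps \<phi>" "f holomorphic_on - {1}" "f (2 * crho) \<noteq> 0"
  shows "(\<lambda>n. dist_sum \<phi> 1 1 n / walk_sum 1 1 n) \<longlonglongrightarrow> f (2 * crho) * (1 - 2 * crho)"
proof -
  have nz: "of_real (amplitude / (1 - 2 * rho)) \<noteq> (0 :: complex)"
  proof -
    have "amplitude / (1 - 2 * rho) \<noteq> 0" using amplitude_pos rho by simp
    then show ?thesis by (simp only: of_real_eq_0_iff) simp
  qed
  have "(\<lambda>n. (dist_sum \<phi> 1 1 n * crho ^ n) / (walk_sum 1 1 n * crho ^ n)) \<longlonglongrightarrow>
      of_real amplitude * f (2 * crho) / of_real (amplitude / (1 - 2 * rho))"
    by (rule tendsto_divide[OF dist_sum_limit[OF f] card_limit nz])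
  then show ?thesis using crho_nz amplitude_pos by (simp add: mult.commute)
qed

theorem corner_distance_geometric:
  "(\<lambda>n. measure_pmf.prob (random_walk n) {w. corner_dist w = real k}) \<longlonglongrightarrow> (1 - 2 * rho) * (2 * rho) ^ k"
proof -
  have "(\<lambda>n. complex_of_real (measure_pmf.prob (random_walk n) {w. corner_dist w = real k})) \<longlonglongrightarrow>
      (2 * crho) ^ k * (1 - 2 * crho)"
    unfolding prob_eq[symmetric]
    by (rule dist_limit[OF power_fps]) (use crho_nz in \<open>auto intro!: holomorphic_intros\<close>)
  also have "(2 * crho) ^ k * (1 - 2 * crho) = of_real ((1 - 2 * rho) * (2 * rho) ^ k)"
    by simp
  finally show ?thesis by (simp only: tendsto_of_real_iff)
qed

theorem corner_distance_mean:
  "(\<lambda>n. measure_pmf.expectation (random_walk n) corner_dist) \<longlonglongrightarrow> 2 * rho / (1 - 2 * rho)"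
proof -
  have "(\<lambda>n. complex_of_real (measure_pmf.expectation (random_walk n) corner_dist)) \<longlonglongrightarrow>
      2 * crho * (1 / (1 - 2 * crho)) * (1 / (1 - 2 * crho)) * (1 - 2 * crho)"
    unfolding mean_eq[symmetric]
    by (rule dist_limit[OF mean_fps]) (use crho_nz two_crho_ne_1 in \<open>auto intro!: holomorphic_intros\<close>)
  also have "2 * crho * (1 / (1 - 2 * crho)) * (1 / (1 - 2 * crho)) * (1 - 2 * crho) =
      of_real (2 * rho / (1 - 2 * rho))"
    using two_crho_ne_1 by simp
  finally show ?thesis by (simp only: tendsto_of_real_iff)
qed

theorem card_asymptotics:
  "(\<lambda>n. real (card (two_sided_walks n))) \<sim>[at_top] (\<lambda>n. amplitude / (1 - 2 * rho) * (1 / rho) ^ n)"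
proof (rule asymp_equivI')
  have "(\<lambda>n. complex_of_real (real (card (two_sided_walks n)) * rho ^ n)) \<longlonglongrightarrow> of_real (amplitude / (1 - 2 * rho))"
    using card_limit by (simp add: card_eq)
  then have "(\<lambda>n. real (card (two_sided_walks n)) * rho ^ n) \<longlonglongrightarrow> amplitude / (1 - 2 * rho)"
    by (simp only: tendsto_of_real_iff)
  then have "(\<lambda>n. real (card (two_sided_walks n)) * rho ^ n / (amplitude / (1 - 2 * rho))) \<longlonglongrightarrow>
      amplitude / (1 - 2 * rho) / (amplitude / (1 - 2 * rho))"
    by (intro tendsto_intros) (use amplitude_pos rho in auto)
  then show "(\<lambda>n. real (card (two_sided_walks n)) / (amplitude / (1 - 2 * rho) * (1 / rho) ^ n)) \<longlonglongrightarrow> 1"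
    using amplitude_pos rho by (simp add: field_simps)
qed

section \<open>The dominant singularity\<close>

abbreviation walk_gf :: "complex \<Rightarrow> complex" where
  "walk_gf t \<equiv> Num_all 1 1 t / Den 1 1 t"

interpretation unit_weights: tame_weights 1 1
  by standard (simp_all add: tame_1)

lemma holomorphic_Num_1: "Num_all 1 1 holomorphic_on ball 0 R0"
  by (rule holomorphic_Num[OF tame_1 tame_1]) (auto intro!: holomorphic_intros)

lemma Num_1_rho_nz: "Num_all 1 1 crho \<noteq> 0"
proof -
  have "1 - crho = of_real (1 - rho)" by simp
  then have "1 - crho \<noteq> 0" using rho by (simp only: of_real_eq_0_iff) simp
  then show ?thesis using crho_nz two_crho_ne_1 by (simp add: Num_rho)
qed

lemma walk_gf_expansion: "walk_gf has_fps_expansion two_sided_gf"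
  using unit_weights.dist_sum_gf[OF geometric_fps]
  by (simp add: two_sided_gf_def card_eq[abs_def])

lemma holomorphic_walk_gf: "walk_gf holomorphic_on ball 0 R0 - {crho}"
  using Den_unique
  by (intro holomorphic_intros holomorphic_on_subset[OF holomorphic_Num_1]
      holomorphic_on_subset[OF unit_weights.holomorphic_Den]) auto

lemma conv_radius_two_sided_gf: "fps_conv_radius two_sided_gf = ereal rho"
proof (rule antisym)
  show "ereal rho \<le> fps_conv_radius two_sided_gf"
  proof (rule holomorphic_on_imp_fps_conv_radius_ge[OF walk_gf_expansion])
    show "walk_gf holomorphic_on eball 0 (ereal rho)"
      by (rule holomorphic_on_subset[OF holomorphic_walk_gf]) (use rho in auto)
  qed
  show "fps_conv_radius two_sided_gf \<le> ereal rho"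
  proof (rule ccontr)
    assume "\<not> fps_conv_radius two_sided_gf \<le> ereal rho"
    then have "ereal (norm crho) < fps_conv_radius two_sided_gf" using rho by simp
    then have "summable (\<lambda>n. fps_nth two_sided_gf n * crho ^ n)" by (rule summable_fps)
    then have "(\<lambda>n. fps_nth two_sided_gf n * crho ^ n) \<longlonglongrightarrow> 0" by (rule summable_LIMSEQ_zero)
    then have "(\<lambda>n. walk_sum 1 1 n * crho ^ n) \<longlonglongrightarrow> 0"
      by (simp add: two_sided_gf_def card_eq)
    then have "of_real (amplitude / (1 - 2 * rho)) = (0 :: complex)"
      using card_limit LIMSEQ_unique by blast
    then have "amplitude / (1 - 2 * rho) = 0" by (simp only: of_real_eq_0_iff)
    then show False using amplitude_pos rho by simp
  qed
qed

lemma eval_two_sided_gf: "u \<in> disc_of_convergence two_sided_gf \<Longrightarrow> eval_fps two_sided_gf u = walk_gf u"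
proof -
  assume "u \<in> disc_of_convergence two_sided_gf"
  then have u: "norm u < rho" by (simp add: disc_of_convergence_def conv_radius_two_sided_gf)
  show ?thesis
    by (rule has_fps_expansion_imp_eval_fps_eq[OF walk_gf_expansion u],
        rule holomorphic_on_subset[OF holomorphic_walk_gf]) (use rho in auto)
qed

lemma in_disc_iff: "u \<in> disc_of_convergence two_sided_gf \<longleftrightarrow> norm u < rho"
  by (simp add: disc_of_convergence_def conv_radius_two_sided_gf)

text \<open>
  For an analytic continuation \<open>g\<close> the identity \<open>g * Den = Num\<close> would hold on the real segment below
  \<open>rho\<close>, hence by continuity at \<open>rho\<close>, where \<open>Den\<close> vanishes and \<open>Num\<close> does not.
\<close>

lemma not_analytic_at_rho:
  assumes "e > 0" "g holomorphic_on ball crho e"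
    "\<And>u. u \<in> ball crho e \<inter> disc_of_convergence two_sided_gf \<Longrightarrow> g u = eval_fps two_sided_gf u"
  shows False
proof -
  define u where "u = (\<lambda>n. of_real (rho * (1 - 1 / real (n + 2))) :: complex)"
  have "(\<lambda>n. rho * (1 - 1 / real (n + 2))) \<longlonglongrightarrow> rho * (1 - 0)"
    by (intro tendsto_intros LIMSEQ_ignore_initial_segment[OF lim_1_over_n])
  then have u: "u \<longlonglongrightarrow> crho" unfolding u_def by (intro tendsto_of_real) simp
  have small: "norm (u n) < rho" for n
  proof -
    have "0 \<le> 1 - 1 / real (n + 2)" "1 - 1 / real (n + 2) < 1" by (auto simp: field_simps)
    then show ?thesis unfolding u_def norm_of_real using rho by (simp add: abs_mult)
  qed
  have contg: "isCont g crho"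
    using holomorphic_on_imp_continuous_on[OF assms(2)] \<open>e > 0\<close>
    by (simp add: continuous_on_eq_continuous_at)
  have contN: "isCont (Num_all 1 1) crho" and contD: "isCont (Den 1 1) crho"
    using holomorphic_on_imp_continuous_on[OF holomorphic_Num_1] norm_crho
      holomorphic_on_imp_continuous_on[OF unit_weights.holomorphic_Den]
    by (simp_all add: continuous_on_eq_continuous_at)
  have "(\<lambda>n. g (u n) * Den 1 1 (u n)) \<longlonglongrightarrow> g crho * Den 1 1 crho"
    by (intro tendsto_mult isCont_tendsto_compose[OF contg u] isCont_tendsto_compose[OF contD u])
  then have lim0: "(\<lambda>n. g (u n) * Den 1 1 (u n)) \<longlonglongrightarrow> 0" by (simp add: Den_zero)
  have limN: "(\<lambda>n. Num_all 1 1 (u n)) \<longlonglongrightarrow> Num_all 1 1 crho"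
    by (rule isCont_tendsto_compose[OF contN u])
  have ev: "\<forall>\<^sub>F n in sequentially. g (u n) * Den 1 1 (u n) = Num_all 1 1 (u n)"
  proof -
    have "\<forall>\<^sub>F n in sequentially. dist (u n) crho < e"
      using u \<open>e > 0\<close> by (rule tendstoD)
    then show ?thesis
    proof eventually_elim
      case (elim n)
      then have "u n \<in> ball crho e \<inter> disc_of_convergence two_sided_gf"
        using small[of n] by (simp add: in_disc_iff dist_commute)
      then have "g (u n) = walk_gf (u n)" using assms(3) eval_two_sided_gf by auto
      moreover have "Den 1 1 (u n) \<noteq> 0"
        using Den_unique[of "u n"] small[of n] rho by auto
      ultimately show ?case by simp
    qed
  qed
  have "Num_all 1 1 crho = 0"
    by (rule LIMSEQ_unique[OF limN Lim_transform_eventually[OF lim0 ev]])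
  then show False using Num_1_rho_nz by simp
qed

theorem dominant_singularity_iff: "{z. dominant_singularity two_sided_gf z} = {crho}"
proof (intro equalityI subsetI)
  fix z assume "z \<in> {crho}"
  then show "z \<in> {z. dominant_singularity two_sided_gf z}"
  proof -
    have "\<not> (\<exists>r>0. \<exists>g. g holomorphic_on ball crho r \<and>
        (\<forall>u \<in> ball crho r \<inter> disc_of_convergence two_sided_gf. g u = eval_fps two_sided_gf u))"
      using not_analytic_at_rho by blast
    moreover have "ereal (norm crho) = fps_conv_radius two_sided_gf"
      using rho by (simp add: conv_radius_two_sided_gf)
    moreover have "z = crho" using \<open>z \<in> {crho}\<close> by simp
    ultimately show ?thesis unfolding dominant_singularity_def by blast
  qed
next
  fix z assume "z \<in> {z. dominant_singularity two_sided_gf z}"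
  then have z: "norm z = rho" and no: "\<not> (\<exists>r>0. \<exists>g. g holomorphic_on ball z r \<and>
           (\<forall>u \<in> ball z r \<inter> disc_of_convergence two_sided_gf. g u = eval_fps two_sided_gf u))"
    by (auto simp: dominant_singularity_def conv_radius_two_sided_gf)
  show "z \<in> {crho}"
  proof (rule ccontr)
    assume "z \<notin> {crho}"
    define e where "e = min (dist z crho) (R0 - rho)"
    have e: "e > 0" using \<open>z \<notin> {crho}\<close> rho by (simp add: e_def)
    have "ball z e \<subseteq> ball 0 R0 - {crho}"
    proof
      fix u assume u: "u \<in> ball z e"
      then have "norm u < R0"
        using norm_triangle_sub[of u z] z by (simp add: e_def dist_norm norm_minus_commute)
      then show "u \<in> ball 0 R0 - {crho}" using u by (auto simp: e_def)
    qed
    then have "walk_gf holomorphic_on ball z e"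
      by (rule holomorphic_on_subset[OF holomorphic_walk_gf])
    moreover have "\<forall>u \<in> ball z e \<inter> disc_of_convergence two_sided_gf. walk_gf u = eval_fps two_sided_gf u"
      using eval_two_sided_gf by simp
    ultimately have "\<exists>r>0. \<exists>g. g holomorphic_on ball z r \<and>
        (\<forall>u \<in> ball z r \<inter> disc_of_convergence two_sided_gf. g u = eval_fps two_sided_gf u)"
      using e by (intro exI[of _ e] conjI exI[of _ walk_gf])
    with no show False by contradiction
  qed
qed

theorem dominant_pole: "dominant_simple_pole two_sided_gf crho"
proof -
  define N where "N = Num_all 1 1"
  define E where "E = (\<lambda>t. if t = crho then deriv (Den 1 1) crho else Den 1 1 t / (t - crho))"
  have holE: "E holomorphic_on ball 0 R0"
    by (rule pole_theorem_open_0[OF unit_weights.holomorphic_Den])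
      (auto simp: E_def Den_zero)
  have E_nz: "E t \<noteq> 0" if "t \<in> ball 0 R0" for t
    using that Den_unique[of t] deriv_Den_nz by (auto simp: E_def)
  have sub: "ball crho (R0 - rho) \<subseteq> ball 0 R0"
  proof
    fix u assume "u \<in> ball crho (R0 - rho)"
    then show "u \<in> ball 0 R0"
      using norm_triangle_sub[of u crho] rho by (simp add: dist_norm norm_minus_commute)
  qed
  have rad: "R0 - rho > 0" using rho by simp
  have contN: "isCont N crho" and contD: "isCont (Den 1 1) crho"
    using holomorphic_on_imp_continuous_on[OF holomorphic_Num_1] norm_crho
      holomorphic_on_imp_continuous_on[OF unit_weights.holomorphic_Den]
    by (simp_all add: N_def continuous_on_eq_continuous_at)
  show ?thesis
    unfolding dominant_simple_pole_def
  proof (intro conjI exI[of _ "R0 - rho"] exI[of _ walk_gf] ballI)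
    show "ereal (norm crho) = fps_conv_radius two_sided_gf"
      using rho by (simp add: conv_radius_two_sided_gf)
    show "walk_gf holomorphic_on ball crho (R0 - rho) - {crho}"
      by (rule holomorphic_on_subset[OF holomorphic_walk_gf]) (use sub in auto)
    show "walk_gf u = eval_fps two_sided_gf u"
      if "u \<in> ball crho (R0 - rho) \<inter> disc_of_convergence two_sided_gf" for u
      using that eval_two_sided_gf by simp
    show "is_pole walk_gf crho"
    proof (rule is_pole_divide)
      show "isCont (Num_all 1 1) crho" using contN by (simp add: N_def)
      show "Num_all 1 1 crho \<noteq> 0" by (rule Num_1_rho_nz)
      have "\<forall>\<^sub>F t in at crho. Den 1 1 t \<noteq> 0"
      proof -
        have "\<forall>\<^sub>F t in at crho. t \<in> ball 0 R0 - {crho}"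
          by (rule eventually_at_in_open) (use norm_crho in auto)
        then show ?thesis by eventually_elim (use Den_unique in auto)
      qed
      moreover have "(Den 1 1 \<longlongrightarrow> 0) (at crho)"
        using contD by (simp add: isCont_def Den_zero)
      ultimately show "filterlim (Den 1 1) (at 0) (at crho)"
        by (simp add: filterlim_at)
    qed
    show "zorder walk_gf crho = - 1"
    proof (rule zorder_eqI)
      show "open (ball crho (R0 - rho))" "crho \<in> ball crho (R0 - rho)" using rad by auto
      show "(\<lambda>t. N t / E t) holomorphic_on ball crho (R0 - rho)"
        by (intro holomorphic_intros holomorphic_on_subset[OF holE sub]
            holomorphic_on_subset[OF holomorphic_Num_1[folded N_def] sub]) (use E_nz sub in auto)
      show "N crho / E crho \<noteq> 0"
        using Num_1_rho_nz E_nz norm_crho by (simp add: N_def)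
      show "walk_gf w = N w / E w * (w - crho) powi - 1" if "w \<noteq> crho" for w
        using that by (simp add: N_def E_def power_int_minus divide_simps)
    qed
  qed (use rad in auto)
qed

section \<open>The pole of the weighted generating functions\<close>

lemma endpoint_Cons: "endpoint (d # w) = step_vec d + endpoint w"
  by (simp add: endpoint_def)

lemma walk_weight_exp: "walk_weight (exp a) (exp b) w = exp (a * of_real (X w) + b * of_real (Y w))"
proof (induction w)
  case Nil
  then show ?case by (simp add: walk_weight_def X_def Y_def endpoint_def)
next
  case (Cons d w)
  have "walk_weight (exp a) (exp b) (d # w) = step_weight (exp a) (exp b) d * walk_weight (exp a) (exp b) w"
    by (simp add: walk_weight_def)
  also have "\<dots> = exp (a * of_real (X (d # w)) + b * of_real (Y (d # w)))"
    unfolding Cons.IH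
    by (cases d) (simp_all add: X_def Y_def endpoint_Cons exp_minus[symmetric] exp_add[symmetric] algebra_simps)
  finally show ?case .
qed

lemma mgf_sum_eq_dist_sum:
  "mgf_sum two_sided_walks (\<lambda>w. X w + Y w) n z = walk_sum (exp z) (exp z) n"
  "mgf_sum two_sided_walks (\<lambda>w. X w - Y w) n z = walk_sum (exp z) (exp (- z)) n"
  by (simp_all add: mgf_sum_def dist_sum_def walk_weight_exp algebra_simps)

lemma tame_near_1:
  obtains \<delta> where "\<delta> > 0" "\<And>z. norm z < \<delta> \<Longrightarrow> tame (exp z) \<and> tame (exp (- z))"
proof -
  have "\<forall>\<^sub>F z in nhds (0::complex). norm (exp z) < 201 / 200"
    "\<forall>\<^sub>F z in nhds (0::complex). norm (exp (- z)) < 201 / 200"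
    "\<forall>\<^sub>F z in nhds (0::complex). norm (exp z + exp (- z) - 2) < 1 / 100"
    by (rule order_tendstoD(2)[where y = "norm (exp (0::complex))"]
        order_tendstoD(2)[where y = "norm (exp (- 0::complex))"]
        order_tendstoD(2)[where y = "norm (exp (0::complex) + exp (- 0) - 2)"],
        (intro tendsto_intros filterlim_ident; simp), simp)+
  then have "\<forall>\<^sub>F z in nhds (0::complex). tame (exp z) \<and> tame (exp (- z))"
    by eventually_elim (simp add: tame_def exp_minus add.commute)
  then obtain \<delta> where "\<delta> > 0" "\<And>z::complex. dist z 0 < \<delta> \<Longrightarrow> tame (exp z) \<and> tame (exp (- z))"
    unfolding eventually_nhds_metric by blast
  then show ?thesis using that by simp
qed

lemma continuous_on_csqrt_comp:
  assumes "continuous_on S f" "\<And>x. x \<in> S \<Longrightarrow> f x \<notin> \<real>\<^sub>\<le>\<^sub>0"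
  shows "continuous_on S (\<lambda>x. csqrt (f x))"
proof (rule continuous_on_compose2[OF _ assms(1)])
  show "continuous_on (- \<real>\<^sub>\<le>\<^sub>0) csqrt"
    by (intro continuous_at_imp_continuous_on ballI continuous_at_csqrt) auto
qed (use assms in auto)

lemma continuous_on_block_arch:
  fixes S :: "'a :: topological_space set"
  assumes "continuous_on S a" "continuous_on S t"
    "\<And>x. x \<in> S \<Longrightarrow> tame (a x)" "\<And>x. x \<in> S \<Longrightarrow> norm (t x) < R0"
  shows "continuous_on S (\<lambda>x. block (a x) (t x))" "continuous_on S (\<lambda>x. arch (a x) (t x))"
proof -
  have a: "norm (a x) \<le> 201 / 200" if "x \<in> S" for x using assms(3)[OF that] by (simp add: tame_def)
  have h: "continuous_on S (\<lambda>x. disc_root (a x) (t x))"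
    unfolding disc_root_def
    by (intro continuous_intros continuous_on_csqrt_comp assms)
      (use disc_factors_not_nonpos[OF a assms(4)] in auto)
  show "continuous_on S (\<lambda>x. block (a x) (t x))"
    unfolding block_def by (intro continuous_intros h assms) auto
  show "continuous_on S (\<lambda>x. arch (a x) (t x))"
    unfolding arch_def by (intro continuous_intros h assms) (use arch_denominator_nz assms in auto)
qed

lemma continuous_on_Num_Den:
  fixes S :: "'a :: topological_space set"
  assumes "continuous_on S x" "continuous_on S y" "continuous_on S t"
    "\<And>p. p \<in> S \<Longrightarrow> tame (x p)" "\<And>p. p \<in> S \<Longrightarrow> tame (y p)" "\<And>p. p \<in> S \<Longrightarrow> norm (t p) < R0"
  shows "continuous_on S (\<lambda>p. Den (x p) (y p) (t p))"
    "continuous_on S (\<lambda>p. Num_all (x p) (y p) (t p))"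
proof -
  have nz: "x p \<noteq> 0" "y p \<noteq> 0" if "p \<in> S" for p
    using assms(4,5)[OF that] by (auto simp: tame_def)
  show D: "continuous_on S (\<lambda>p. Den (x p) (y p) (t p))"
    unfolding Den_def by (intro continuous_intros continuous_on_block_arch assms)
  have I: "continuous_on S (\<lambda>p. Init (x p) (y p) (t p))"
    unfolding Init_def by (intro continuous_intros continuous_on_block_arch assms)
  have r: "continuous_on S (\<lambda>p. ratio (x p) (y p) (t p))" "continuous_on S (\<lambda>p. ratio (y p) (x p) (t p))"
    unfolding ratio_def
    by (intro continuous_intros continuous_on_block_arch assms; use nz block_ne_1 assms(6) in auto)+
  show "continuous_on S (\<lambda>p. Num_all (x p) (y p) (t p))"
    unfolding Num_def
    by (intro continuous_intros continuous_on_block_arch assms D I r)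
      (use ratio_ne_1 assms in auto)
qed

text \<open>
  At \<open>z = 0\<close> both weights are 1, so the hypotheses about the zero of the denominator are those already
  established for unweighted walks.
\<close>

lemma walk_family_limit:
  fixes x y :: "complex \<Rightarrow> complex"
  assumes xy: "x holomorphic_on UNIV" "y holomorphic_on UNIV" "x 0 = 1" "y 0 = 1"
    and \<delta>: "\<delta> > 0" "\<And>z. norm z < \<delta> \<Longrightarrow> tame (x z) \<and> tame (y z)"
    and hol: "\<And>n. (\<lambda>z. walk_sum (x z) (y z) n) holomorphic_on ball 0 \<delta>"
  obtains d r \<kappa> where "0 < d" "d \<le> \<delta>" "r holomorphic_on ball 0 d" "r 0 = crho"
    "\<And>z. norm z < d \<Longrightarrow> norm (r z) < R0 \<and> Den (x z) (y z) (r z) = 0"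
    "\<kappa> holomorphic_on ball 0 d" "\<kappa> 0 \<noteq> 0"
    "uniform_limit (ball 0 d) (\<lambda>n z. walk_sum (x z) (y z) n * r z ^ n) \<kappa> sequentially"
proof -
  have cont: "continuous_on S x" "continuous_on S y" for S
    using xy(1,2) holomorphic_on_imp_continuous_on holomorphic_on_subset by blast+
  have c: "continuous_on (ball 0 \<delta> \<times> ball 0 R0) (\<lambda>p :: complex \<times> complex. x (fst p))"
      "continuous_on (ball 0 \<delta> \<times> ball 0 R0) (\<lambda>p :: complex \<times> complex. y (fst p))"
      "continuous_on (ball 0 \<delta> \<times> ball 0 R0) (\<lambda>p :: complex \<times> complex. snd p)"
    by (auto intro!: continuous_on_compose2[OF cont(1)[of UNIV]] continuous_on_compose2[OF cont(2)[of UNIV]]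
        continuous_intros)
  have contD: "continuous_on (ball 0 \<delta> \<times> ball 0 R0) (\<lambda>(z, t). Den (x z) (y z) t)"
    and contN: "continuous_on (ball 0 \<delta> \<times> ball 0 R0) (\<lambda>(z, t). Num_all (x z) (y z) t)"
    unfolding case_prod_unfold
    by (rule continuous_on_Num_Den[OF c]; use \<delta> in auto)+
  have weights: "tame_weights (x z) (y z)" if "norm z < \<delta>" for z
    using \<delta>(2)[OF that] by unfold_locales auto
  have holD: "Den (x z) (y z) holomorphic_on ball 0 R0" if "norm z < \<delta>" for z
    by (rule tame_weights.holomorphic_Den[OF weights[OF that]])
  have holN: "Num_all (x z) (y z) holomorphic_on ball 0 R0" if "norm z < \<delta>" for z
    by (rule holomorphic_Num) (use \<delta>(2)[OF that] in \<open>auto intro!: holomorphic_intros\<close>)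
  have expansion: "(\<lambda>t. Num_all (x z) (y z) t / Den (x z) (y z) t) has_fps_expansion
      Abs_fps (\<lambda>n. walk_sum (x z) (y z) n)" if "norm z < \<delta>" for z
    using tame_weights.dist_sum_gf[OF weights[OF that] geometric_fps] by simp
  have at_0: "Den (x 0) (y 0) crho = 0" "deriv (Den (x 0) (y 0)) crho \<noteq> 0"
      "\<And>t. norm t < R0 \<Longrightarrow> Den (x 0) (y 0) t = 0 \<Longrightarrow> t = crho"
      "Num_all (x 0) (y 0) crho \<noteq> 0"
    unfolding xy(3,4) using Den_zero deriv_Den_nz Den_unique Num_1_rho_nz by blast+
  show ?thesis
  proof (rule simple_pole_perturbation[where D = "\<lambda>z. Den (x z) (y z)" and
        N = "\<lambda>z. Num_all (x z) (y z)" and p = "\<lambda>n z. walk_sum (x z) (y z) n",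
        OF \<delta>(1) crho_nz norm_crho contD contN holD holN at_0 expansion hol])
    fix d :: real and r \<kappa> :: "complex \<Rightarrow> complex"
    assume *: "0 < d" "d \<le> \<delta>" "r holomorphic_on ball 0 d" "r 0 = crho"
      and zero: "\<And>z. norm z < d \<Longrightarrow> norm (r z) < R0 \<and> Den (x z) (y z) (r z) = 0"
      and \<kappa>: "\<kappa> holomorphic_on ball 0 d"
        "\<kappa> 0 = - Num_all (x 0) (y 0) crho / (crho * deriv (Den (x 0) (y 0)) crho)"
      and lim: "uniform_limit (ball 0 d) (\<lambda>n z. walk_sum (x z) (y z) n * r z ^ n) \<kappa> sequentially"
    have "\<kappa> 0 \<noteq> 0"
      unfolding \<kappa>(2) using at_0 crho_nz by simp
    from * zero \<kappa>(1) this lim show thesis by (rule that)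
  qed
qed

section \<open>Derivatives of the moving pole\<close>

lemma deriv_eq_0_if_constant:
  assumes "\<And>z. norm z < d \<Longrightarrow> f z = c" "norm z < d" "(f has_field_derivative D) (at z)"
  shows "D = (0 :: complex)"
proof -
  have "((\<lambda>_. c) has_field_derivative D) (at z)"
    by (rule has_field_derivative_transform_within_open[OF assms(3) open_ball[of 0 d]])
      (use assms(1,2) in auto)
  then show ?thesis using DERIV_const DERIV_unique by blast
qed

lemma eq_neg_divideI: "a * c = - b \<Longrightarrow> c \<noteq> 0 \<Longrightarrow> a = - (b / c)" for a b c :: complex
  by (metis minus_divide_left nonzero_eq_divide_eq)

lemma holomorphic_mgf_sum: "mgf_sum S Z n holomorphic_on A"
  unfolding mgf_sum_def[abs_def] by (intro holomorphic_intros)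

definition sum_mean :: real where "sum_mean = (rho + 1) / (3 * rho + 1)"
definition sum_var :: real where "sum_var = 4 * (rho + 1)\<^sup>2 * rho / ((3 * rho + 1) ^ 3 * (1 - rho))"
definition diff_var :: real where
  "diff_var = rho * (rho\<^sup>2 - 2) * (1 + rho) / ((rho\<^sup>2 + rho - 1) * (3 * rho - 1) * (1 + 3 * rho))"

lemma crho_factors_nz: "1 - crho \<noteq> 0" "1 + 3 * crho \<noteq> 0" "crho\<^sup>2 + crho - 1 \<noteq> 0"
proof -
  have "1 - crho = of_real (1 - rho)" "1 + 3 * crho = of_real (1 + 3 * rho)"
    "crho\<^sup>2 + crho - 1 = of_real (rho\<^sup>2 + rho - 1)" by simp_all
  moreover have "1 - rho \<noteq> 0" "1 + 3 * rho \<noteq> 0" "rho\<^sup>2 + rho - 1 \<noteq> 0"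
    using rho rho_powers by auto
  ultimately show "1 - crho \<noteq> 0" "1 + 3 * crho \<noteq> 0" "crho\<^sup>2 + crho - 1 \<noteq> 0"
    by (simp_all only: of_real_eq_0_iff not_False_eq_True)
qed

text \<open>
  The equation \<open>eq\<close> is differentiated twice at 0. The auxiliary quantities \<open>k\<close> and \<open>w\<close> are the two
  derivatives of \<open>r\<close> divided by \<open>rho\<close>.
\<close>

lemma sum_pole_derivatives:
  assumes d: "d > 0" and r: "r holomorphic_on ball 0 d" "r 0 = crho"
    and eq: "\<And>z. norm z < d \<Longrightarrow> 2 * (1 - (r z)\<^sup>2) * (1 - r z * exp z) = 1"
  shows "deriv r 0 / r 0 = - of_real sum_mean"
    "deriv (deriv r) 0 / r 0 - (deriv r 0 / r 0)\<^sup>2 = - of_real sum_var"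
proof -
  define p where "p = crho"
  define q where "q = 1 + 3 * p"
  define r1 where "r1 = deriv r 0"
  define r2 where "r2 = deriv (deriv r) 0"
  have p: "p \<noteq> 0" "1 - p \<noteq> 0" "q \<noteq> 0"
    using crho_nz crho_factors_nz by (auto simp: p_def q_def)
  have D1: "(r has_field_derivative deriv r z) (at z)"
    and D2: "(deriv r has_field_derivative deriv (deriv r) z) (at z)" if "norm z < d" for z
    using that holomorphic_derivI[OF r(1) open_ball] holomorphic_derivI[OF holomorphic_deriv[OF r(1) open_ball] open_ball]
    by auto
  have D10: "(r has_field_derivative r1) (at 0)" "(deriv r has_field_derivative r2) (at 0)"
    using D1[of 0] D2[of 0] d by (simp_all add: r1_def r2_def)
  define H where "H = (\<lambda>z. 2 * r z * deriv r z * (1 - r z * exp z) + (1 - (r z)\<^sup>2) * ((deriv r z + r z) * exp z))"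
  have H0: "H z = 0" if z: "norm z < d" for z
  proof -
    have "((\<lambda>z. 2 * (1 - (r z)\<^sup>2) * (1 - r z * exp z)) has_field_derivative - 2 * H z) (at z)"
      unfolding H_def by (rule derivative_eq_intros D1[OF z] refl)+ (simp add: algebra_simps power2_eq_square)
    from deriv_eq_0_if_constant[OF eq z this] show ?thesis by simp
  qed
  have "(1 - p) * (r1 * q + p * (1 + p)) = H 0"
    by (simp add: H_def r(2) p_def[symmetric] r1_def[symmetric] q_def algebra_simps power2_eq_square)
  then have r1: "r1 * q = - (p * (1 + p))"
    using H0[of 0] d p by (simp add: add_eq_0_iff2)
  have "(H has_field_derivative
      (2 * (r1\<^sup>2 + p * r2) * (1 - p) - 4 * p * r1 * (r1 + p) + (1 - p\<^sup>2) * (r2 + 2 * r1 + p))) (at 0)"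
    unfolding H_def
    by (rule derivative_eq_intros D10 refl)+
      (simp add: r(2) p_def[symmetric] r1_def[symmetric] algebra_simps power2_eq_square)
  from deriv_eq_0_if_constant[OF H0 _ this] d
  have r2: "r2 * ((1 - p) * q) = - 2 * r1\<^sup>2 * (1 - p) + 4 * p * r1 * (r1 + p) - (1 - p\<^sup>2) * (2 * r1 + p)"
    by (simp add: q_def algebra_simps power2_eq_square)
  define k where "k = r1 / p"
  define w where "w = r2 / p"
  have rk: "r1 = k * p" "r2 = w * p" using p by (auto simp: k_def w_def)
  have kq: "k * q = - (1 + p)"
    using r1 p by (simp add: k_def field_simps)
  have "p * (w * ((1 - p) * q)) = p * (- 2 * k\<^sup>2 * p * (1 - p) + 4 * p\<^sup>2 * k * (k + 1) - (1 - p\<^sup>2) * (2 * k + 1))"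
    using r2 unfolding rk by (simp add: algebra_simps power2_eq_square)
  then have w: "w * ((1 - p) * q) = - 2 * k\<^sup>2 * p * (1 - p) + 4 * p\<^sup>2 * k * (k + 1) - (1 - p\<^sup>2) * (2 * k + 1)"
    by (rule mult_left_cancel[THEN iffD1, OF p(1)])
  have "(w - k\<^sup>2) * (q ^ 3 * (1 - p)) = (w * ((1 - p) * q)) * q\<^sup>2 - (k * q)\<^sup>2 * q * (1 - p)"
    by (simp add: algebra_simps power2_eq_square power3_eq_cube)
  also have "\<dots> = - 2 * (k * q)\<^sup>2 * p * (1 - p) + 4 * p\<^sup>2 * (k * q) * (k * q + q)
      - (1 - p\<^sup>2) * (2 * (k * q) + q) * q - (k * q)\<^sup>2 * q * (1 - p)"
    unfolding w by (simp add: algebra_simps power2_eq_square)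
  also have "\<dots> = - (4 * (p + 1)\<^sup>2 * p)"
    unfolding kq unfolding q_def by (simp add: algebra_simps power2_eq_square)
  finally have v: "w - k\<^sup>2 = - (4 * (p + 1)\<^sup>2 * p / (q ^ 3 * (1 - p)))"
    by (rule eq_neg_divideI) (use p in simp)
  have "k = - ((p + 1) / q)"
    by (rule eq_neg_divideI) (use kq p in \<open>simp_all add: add.commute\<close>)
  then show "deriv r 0 / r 0 = - of_real sum_mean"
    by (simp add: k_def r1_def r(2) p_def q_def sum_mean_def add.commute)
  show "deriv (deriv r) 0 / r 0 - (deriv r 0 / r 0)\<^sup>2 = - of_real sum_var"
    using v by (simp add: k_def w_def r1_def r2_def r(2) p_def q_def sum_var_def add.commute)
qed

text \<open>
  The values \<open>block x t = 1/2 + g\<close> and \<open>block y t = 1/2 - g\<close> satisfy quadratic equations in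
  \<open>g\<close> with the same leading coefficient. Their difference is therefore linear in \<open>g\<close>; elimination of \<open>g\<close>
  from the sum leaves a polynomial equation in \<open>t\<close> and \<open>u = (x + 1 / x) / 2\<close> alone.
\<close>

lemma diff_equation:
  fixes t x :: complex
  assumes "Den x (inverse x) t = 0" "t \<noteq> 0" "x \<noteq> 0" and c: "c = 1 - t\<^sup>2" and u: "u = (x + inverse x) / 2"
  shows "(1 - 2 * c + 2 * t * c * u) * (t - c * u)\<^sup>2 + c\<^sup>2 * (u\<^sup>2 - 1) * (1 + 2 * t\<^sup>2 - 2 * t * c * u) = 0"
proof -
  define y where "y = inverse x"
  define g where "g = block x t - 1 / 2"
  define \<sigma> where "\<sigma> = t * x + t * y"
  define \<Delta> where "\<Delta> = t * x - t * y"
  define H where "H = 2 * t\<^sup>2 - c * \<sigma>"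
  have xy: "x * y = 1" using assms by (simp add: y_def)
  have Gx: "block x t = 1 / 2 + g" and Gy: "block y t = 1 / 2 - g"
    using assms(1) by (auto simp: g_def Den_def y_def algebra_simps)
  have E1: "(1 / 2 + g)\<^sup>2 - (1 + t * x) * c * (1 / 2 + g) + t * x * c = 0"
    using block_quadratic[of x t] unfolding Gx c .
  have E2: "(1 / 2 - g)\<^sup>2 - (1 + t * y) * c * (1 / 2 - g) + t * y * c = 0"
    using block_quadratic[of y t] unfolding Gy c .
  have "g * H + c * \<Delta> / 2 = ((1 / 2 + g)\<^sup>2 - (1 + t * x) * c * (1 / 2 + g) + t * x * c) -
      ((1 / 2 - g)\<^sup>2 - (1 + t * y) * c * (1 / 2 - g) + t * y * c)"
    unfolding H_def \<sigma>_def \<Delta>_def c by (simp add: field_simps power2_eq_square)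
  then have gH: "g * H = - (c * \<Delta> / 2)"
    unfolding E1 E2 by (simp add: add_eq_0_iff2)
  have "1 / 2 - c + c * \<sigma> / 2 + 2 * g\<^sup>2 - c * g * \<Delta> =
      ((1 / 2 + g)\<^sup>2 - (1 + t * x) * c * (1 / 2 + g) + t * x * c) +
      ((1 / 2 - g)\<^sup>2 - (1 + t * y) * c * (1 / 2 - g) + t * y * c)"
    unfolding H_def \<sigma>_def \<Delta>_def by (simp add: field_simps power2_eq_square)
  then have "1 / 2 - c + c * \<sigma> / 2 + 2 * g\<^sup>2 - c * g * \<Delta> = 0"
    unfolding E1 E2 by simp
  then have "0 = (1 / 2 - c + c * \<sigma> / 2 + 2 * g\<^sup>2 - c * g * \<Delta>) * H\<^sup>2" by simp
  also have "\<dots> = (1 / 2 - c + c * \<sigma> / 2) * H\<^sup>2 + 2 * (g * H)\<^sup>2 - c * (g * H) * \<Delta> * H"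
    by (simp add: algebra_simps power2_eq_square)
  also have "\<dots> = (1 / 2 - c + c * \<sigma> / 2) * H\<^sup>2 + c\<^sup>2 * \<Delta>\<^sup>2 * (1 + H) / 2"
    unfolding gH by (simp add: field_simps power2_eq_square)
  also have "\<Delta>\<^sup>2 = \<sigma>\<^sup>2 - 4 * t\<^sup>2 * (x * y)"
    unfolding \<Delta>_def \<sigma>_def by (simp add: algebra_simps power2_eq_square)
  also have "\<dots> = 4 * t\<^sup>2 * (u\<^sup>2 - 1)"
    unfolding xy \<sigma>_def u y_def[symmetric] by (simp add: field_simps power2_eq_square)
  also have "\<sigma> = 2 * t * u" by (simp add: \<sigma>_def u y_def[symmetric] algebra_simps)
  also have "H = 2 * t * (t - c * u)"
    by (simp add: H_def \<open>\<sigma> = 2 * t * u\<close> algebra_simps power2_eq_square)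
  finally have "0 = 8 * t\<^sup>2 * ((1 - 2 * c + 2 * t * c * u) * (t - c * u)\<^sup>2 +
      c\<^sup>2 * (u\<^sup>2 - 1) * (1 + 2 * t\<^sup>2 - 2 * t * c * u))"
    by (simp add: field_simps power2_eq_square)
  then show ?thesis using assms(2) by simp
qed

text \<open>
  The partial derivatives of the polynomial in \<open>diff_equation\<close> with respect to \<open>t\<close> and \<open>u\<close>, where
  \<open>c = 1 - t\<^sup>2\<close>.
\<close>

definition psi_t :: "complex \<Rightarrow> complex \<Rightarrow> complex" where
  "psi_t t u = (4 * t + 2 * u * (1 - 3 * t\<^sup>2)) * (t - (1 - t\<^sup>2) * u)\<^sup>2 +
     (1 - 2 * (1 - t\<^sup>2) + 2 * t * (1 - t\<^sup>2) * u) * (2 * (t - (1 - t\<^sup>2) * u) * (1 + 2 * t * u)) +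
     (u\<^sup>2 - 1) * (- 4 * t * (1 - t\<^sup>2) * (1 + 2 * t\<^sup>2 - 2 * t * (1 - t\<^sup>2) * u) +
       (1 - t\<^sup>2)\<^sup>2 * (4 * t - 2 * u * (1 - 3 * t\<^sup>2)))"

definition psi_u :: "complex \<Rightarrow> complex \<Rightarrow> complex" where
  "psi_u t u = 2 * t * (1 - t\<^sup>2) * (t - (1 - t\<^sup>2) * u)\<^sup>2 -
     (1 - 2 * (1 - t\<^sup>2) + 2 * t * (1 - t\<^sup>2) * u) * (2 * (t - (1 - t\<^sup>2) * u) * (1 - t\<^sup>2)) +
     (1 - t\<^sup>2)\<^sup>2 * (2 * u * (1 + 2 * t\<^sup>2 - 2 * t * (1 - t\<^sup>2) * u) - (u\<^sup>2 - 1) * (2 * t * (1 - t\<^sup>2)))"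

lemma psi_chain_rule:
  assumes "(r has_field_derivative r') (at z)" "(s has_field_derivative s') (at z)"
  shows "((\<lambda>z. (1 - 2 * (1 - (r z)\<^sup>2) + 2 * r z * (1 - (r z)\<^sup>2) * s z) * (r z - (1 - (r z)\<^sup>2) * s z)\<^sup>2 +
      (1 - (r z)\<^sup>2)\<^sup>2 * ((s z)\<^sup>2 - 1) * (1 + 2 * (r z)\<^sup>2 - 2 * r z * (1 - (r z)\<^sup>2) * s z)) has_field_derivative
      psi_t (r z) (s z) * r' + psi_u (r z) (s z) * s') (at z)"
  unfolding psi_t_def psi_u_def
  by (rule derivative_eq_intros assms refl)+ (simp, algebra)

text \<open>
  The difference of the cross-multiplied sides is a multiple of the cubic that \<open>rho\<close> satisfies.
\<close>

lemma diff_var_alt: "diff_var = (1 + rho) * (1 + rho - rho\<^sup>2)\<^sup>2 / ((1 + 3 * rho) * (rho\<^sup>2 + rho - 1)\<^sup>2)"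
proof -
  have nz: "rho\<^sup>2 + rho - 1 \<noteq> 0" "3 * rho - 1 \<noteq> 0" "1 + 3 * rho \<noteq> 0"
    using rho rho_powers by auto
  have "rho * (rho\<^sup>2 - 2) * (rho\<^sup>2 + rho - 1) - (1 + rho - rho\<^sup>2)\<^sup>2 * (3 * rho - 1) =
      (1 + 3 * rho - rho\<^sup>2) * (1 - 2 * rho - 2 * rho\<^sup>2 + 2 * rho ^ 3)"
    by (simp add: algebra_simps power2_eq_square power3_eq_cube)
  then have key: "rho * (rho\<^sup>2 - 2) * (rho\<^sup>2 + rho - 1) = (1 + rho - rho\<^sup>2)\<^sup>2 * (3 * rho - 1)"
    unfolding rho(3) by simp
  have "a * b / (s * q * w) = b * u / (w * s\<^sup>2)"
    if "a * s = u * q" "s \<noteq> 0" "q \<noteq> 0" "w \<noteq> 0" for a b s q w u :: real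
  proof -
    have "a * b * (w * s\<^sup>2) = (a * s) * (b * w * s)" by (simp add: power2_eq_square)
    also have "\<dots> = b * u * (s * q * w)" unfolding that(1) by simp
    finally show ?thesis using that by (simp add: frac_eq_eq)
  qed
  from this[OF key nz, of "1 + rho"] show ?thesis by (simp add: diff_var_def mult_ac)
qed

text \<open>
  As \<open>s z = cosh z\<close> has derivative 0 at 0, the first derivative of \<open>r\<close> vanishes there. In the second
  derivative of the polynomial equation only the terms with the second derivatives of \<open>r\<close> and
  \<open>s\<close> survive.
\<close>

lemma diff_pole_derivatives:
  assumes d: "d > 0" and r: "r holomorphic_on ball 0 d" "r 0 = crho"
    and eq: "\<And>z. norm z < d \<Longrightarrow> Den (exp z) (exp (- z)) (r z) = 0"
  shows "deriv r 0 / r 0 = 0"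
    "deriv (deriv r) 0 / r 0 - (deriv r 0 / r 0)\<^sup>2 = - of_real diff_var"
proof -
  define p where "p = crho"
  define c where "c = 1 - p\<^sup>2"
  define s where "s = (\<lambda>z::complex. (exp z + exp (- z)) / 2)"
  define s' where "s' = (\<lambda>z::complex. (exp z - exp (- z)) / 2)"
  define r1 where "r1 = deriv r 0"
  define r2 where "r2 = deriv (deriv r) 0"
  have D1: "(r has_field_derivative deriv r z) (at z)"
    and D2: "(deriv r has_field_derivative deriv (deriv r) z) (at z)" if "norm z < d" for z
    using that holomorphic_derivI[OF r(1) open_ball] holomorphic_derivI[OF holomorphic_deriv[OF r(1) open_ball] open_ball]
    by auto
  have D20: "(deriv r has_field_derivative r2) (at 0)"
    using D2[of 0] d by (simp add: r2_def)
  have Ds: "(s has_field_derivative s' z) (at z)" "(s' has_field_derivative s z) (at z)" for z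
    unfolding s_def s'_def by (auto intro!: derivative_eq_intros)
  have s0: "s 0 = 1" "s' 0 = 0" by (auto simp: s_def s'_def)
  define K where "K = (\<lambda>z. psi_t (r z) (s z) * deriv r z + psi_u (r z) (s z) * s' z)"
  have K0: "K z = 0" if z: "norm z < d" for z
  proof (rule deriv_eq_0_if_constant[OF _ z])
    show "((\<lambda>z. (1 - 2 * (1 - (r z)\<^sup>2) + 2 * r z * (1 - (r z)\<^sup>2) * s z) * (r z - (1 - (r z)\<^sup>2) * s z)\<^sup>2 +
      (1 - (r z)\<^sup>2)\<^sup>2 * ((s z)\<^sup>2 - 1) * (1 + 2 * (r z)\<^sup>2 - 2 * r z * (1 - (r z)\<^sup>2) * s z)) has_field_derivative
      K z) (at z)"
      unfolding K_def by (rule psi_chain_rule[OF D1[OF z] Ds(1)])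
    show "(1 - 2 * (1 - (r z)\<^sup>2) + 2 * r z * (1 - (r z)\<^sup>2) * s z) * (r z - (1 - (r z)\<^sup>2) * s z)\<^sup>2 +
      (1 - (r z)\<^sup>2)\<^sup>2 * ((s z)\<^sup>2 - 1) * (1 + 2 * (r z)\<^sup>2 - 2 * r z * (1 - (r z)\<^sup>2) * s z) = 0"
      if "norm z < d" for z
    proof (rule diff_equation[where x = "exp z"])
      show "Den (exp z) (inverse (exp z)) (r z) = 0" using eq[OF that] by (simp add: exp_minus)
      show "r z \<noteq> 0" using eq[OF that] by (auto simp: Den_def)
    qed (auto simp: s_def exp_minus)
  qed
  have cubic: "1 - 2 * c + 2 * p * c = 0"
    using cubic_complex by (simp add: c_def p_def algebra_simps power2_eq_square power3_eq_cube)
  have pc: "p - c = p\<^sup>2 + p - 1" by (simp add: c_def)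
  have nz: "p \<noteq> 0" "1 - p \<noteq> 0" "1 + 3 * p \<noteq> 0" "p - c \<noteq> 0"
    using crho_nz crho_factors_nz by (auto simp: p_def pc[unfolded p_def])
  have "psi_t p 1 = (4 * p + 2 * (1 - 3 * p\<^sup>2)) * (p - c)\<^sup>2 +
      (1 - 2 * c + 2 * p * c) * (2 * (p - c) * (1 + 2 * p))"
    by (simp add: psi_t_def c_def)
  then have A: "psi_t p 1 = 2 * (1 - p) * (1 + 3 * p) * (p - c)\<^sup>2"
    unfolding cubic by (simp add: algebra_simps power2_eq_square)
  have e1: "psi_u p 1 = 2 * p * c * (p - c)\<^sup>2 - (1 - 2 * c + 2 * p * c) * (2 * (p - c) * c) +
      c\<^sup>2 * (2 * (1 + 2 * p\<^sup>2 - 2 * p * c))"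
    by (simp add: psi_u_def c_def)
  have e2: "1 + 2 * p\<^sup>2 - 2 * p * c = 4 * p\<^sup>2 - (1 - 2 * c + 2 * p * c)"
    by (simp add: c_def)
  have "psi_u p 1 = 2 * p * c * ((p - c)\<^sup>2 + 4 * p * c)"
    unfolding e1 e2 cubic by (simp add: algebra_simps power2_eq_square)
  then have Bu: "psi_u p 1 = 2 * p * c * (p + c)\<^sup>2"
    by (simp add: algebra_simps power2_eq_square)
  have "K 0 = psi_t p 1 * r1"
    by (simp add: K_def s0 r(2) p_def r1_def)
  then have r1: "r1 = 0"
    using K0[of 0] d nz by (simp add: A)
  then show "deriv r 0 / r 0 = 0" by (simp add: r1_def)
  have hs: "s holomorphic_on ball 0 d" unfolding s_def by (intro holomorphic_intros) auto
  have "(\<lambda>z. psi_t (r z) (s z)) holomorphic_on ball 0 d" "(\<lambda>z. psi_u (r z) (s z)) holomorphic_on ball 0 d"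
    unfolding psi_t_def psi_u_def by (intro holomorphic_intros r hs)+
  then obtain a b where ab: "((\<lambda>z. psi_t (r z) (s z)) has_field_derivative a) (at 0)"
      "((\<lambda>z. psi_u (r z) (s z)) has_field_derivative b) (at 0)"
    using d holomorphic_derivI[OF _ open_ball, of _ 0 d 0] by (metis centre_in_ball)
  have "(K has_field_derivative psi_t p 1 * r2 + psi_u p 1) (at 0)"
    unfolding K_def
    by (rule derivative_eq_intros ab D20 Ds refl)+
      (simp add: s0 r(2) p_def[symmetric] r1_def[symmetric] r1)
  from deriv_eq_0_if_constant[OF K0 _ this] d
  have "psi_t p 1 * r2 = - psi_u p 1" by (simp add: add_eq_0_iff2)
  then have "2 * (1 - p) * ((1 + 3 * p) * (p - c)\<^sup>2 * r2) = 2 * (1 - p) * (- (p * (1 + p) * (p + c)\<^sup>2))"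
    unfolding A Bu c_def by (simp add: algebra_simps power2_eq_square)
  then have "(1 + 3 * p) * (p - c)\<^sup>2 * r2 = - (p * (1 + p) * (p + c)\<^sup>2)"
    by (rule mult_left_cancel[THEN iffD1, rotated]) (use nz in simp)
  then have "r2 / p = - ((1 + p) * (p + c)\<^sup>2 / ((1 + 3 * p) * (p - c)\<^sup>2))"
    by (intro eq_neg_divideI) (use nz in \<open>simp_all add: mult_ac\<close>)
  also have "\<dots> = - of_real diff_var"
    unfolding diff_var_alt by (simp add: c_def p_def algebra_simps)
  finally show "deriv (deriv r) 0 / r 0 - (deriv r 0 / r 0)\<^sup>2 = - of_real diff_var"
    using r1 by (simp add: r1_def r2_def r(2) p_def)
qed

section \<open>The limit laws\<close>

lemma asymp_equiv_linearI:
  fixes a :: "nat \<Rightarrow> real"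
  assumes bound: "\<exists>C. \<forall>\<^sub>F n in sequentially. \<bar>a n - c * real n\<bar> \<le> C" and c: "c \<noteq> 0"
  shows "a \<sim>[at_top] (\<lambda>n. c * real n)"
proof (rule asymp_equivI')
  obtain C where C: "\<forall>\<^sub>F n in sequentially. \<bar>a n - c * real n\<bar> \<le> C"
    using bound by blast
  have "(\<lambda>n. a n / (c * real n) - 1) \<longlonglongrightarrow> 0"
  proof (rule Lim_null_comparison)
    show "\<forall>\<^sub>F n in sequentially. norm (a n / (c * real n) - 1) \<le> C / \<bar>c\<bar> * (1 / real n)"
      using C eventually_gt_at_top[of 0]
    proof eventually_elim
      case (elim n)
      then have "a n / (c * real n) - 1 = (a n - c * real n) / (c * real n)"
        using c by (simp add: diff_divide_distrib)
      then show ?case using elim by (simp add: abs_mult divide_right_mono)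
    qed
    show "(\<lambda>n. C / \<bar>c\<bar> * (1 / real n)) \<longlonglongrightarrow> 0"
      by (intro tendsto_mult_right_zero lim_1_over_n)
  qed
  then show "(\<lambda>n. a n / (c * real n)) \<longlonglongrightarrow> 1"
    by (rule LIM_zero_cancel)
qed

lemma sum_quasi_powers:
  obtains r \<kappa> d where "quasi_powers two_sided_walks (\<lambda>w. X w + Y w) r \<kappa> d sum_mean sum_var"
proof -
  obtain \<delta> where \<delta>: "\<delta> > 0" "\<And>z. norm z < \<delta> \<Longrightarrow> tame (exp z) \<and> tame (exp (- z))"
    using tame_near_1 by blast
  have hol: "(\<lambda>z. walk_sum (exp z) (exp z) n) holomorphic_on ball 0 \<delta>" for n
    unfolding mgf_sum_eq_dist_sum(1)[symmetric] by (rule holomorphic_mgf_sum)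
  have tame2: "tame (exp z) \<and> tame (exp z)" if "norm z < \<delta>" for z using \<delta>(2)[OF that] by simp
  show ?thesis
  proof (rule walk_family_limit[OF _ _ _ _ \<delta>(1) tame2 hol])
    fix d r \<kappa>
    assume *: "0 < d" "d \<le> \<delta>" "r holomorphic_on ball 0 d" "r 0 = crho"
      and zero: "\<And>z. norm z < d \<Longrightarrow> norm (r z) < R0 \<and> Den (exp z) (exp z) (r z) = 0"
      and \<kappa>: "\<kappa> holomorphic_on ball 0 d" "\<kappa> 0 \<noteq> 0"
      and lim: "uniform_limit (ball 0 d) (\<lambda>n z. walk_sum (exp z) (exp z) n * r z ^ n) \<kappa> sequentially"
    have "2 * (1 - (r z)\<^sup>2) * (1 - r z * exp z) = 1" if "norm z < d" for z
    proof (rule block_half_imp)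
      have "2 * block (exp z) (r z) = 1" using zero[OF that] by (simp add: Den_def algebra_simps)
      then show "block (exp z) (r z) = 1 / 2" by (metis nonzero_mult_div_cancel_left zero_neq_numeral)
    qed
    note derivs = sum_pole_derivatives[OF *(1,3,4) this]
    have "quasi_powers two_sided_walks (\<lambda>w. X w + Y w) r \<kappa> d sum_mean sum_var"
      by unfold_locales
        (use * \<kappa> lim derivs crho_nz finite_two_sided_walks two_sided_walks_nonempty in
          \<open>simp_all add: mgf_sum_eq_dist_sum(1)\<close>)
    then show thesis by (rule that)
  qed (auto intro!: holomorphic_intros)
qed

lemma diff_quasi_powers:
  obtains r \<kappa> d where "quasi_powers two_sided_walks (\<lambda>w. X w - Y w) r \<kappa> d 0 diff_var"
proof -
  obtain \<delta> where \<delta>: "\<delta> > 0" "\<And>z. norm z < \<delta> \<Longrightarrow> tame (exp z) \<and> tame (exp (- z))"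
    using tame_near_1 by blast
  have hol: "(\<lambda>z. walk_sum (exp z) (exp (- z)) n) holomorphic_on ball 0 \<delta>" for n
    unfolding mgf_sum_eq_dist_sum(2)[symmetric] by (rule holomorphic_mgf_sum)
  show ?thesis
  proof (rule walk_family_limit[OF _ _ _ _ \<delta> hol])
    fix d r \<kappa>
    assume *: "0 < d" "d \<le> \<delta>" "r holomorphic_on ball 0 d" "r 0 = crho"
      and zero: "\<And>z. norm z < d \<Longrightarrow> norm (r z) < R0 \<and> Den (exp z) (exp (- z)) (r z) = 0"
      and \<kappa>: "\<kappa> holomorphic_on ball 0 d" "\<kappa> 0 \<noteq> 0"
      and lim: "uniform_limit (ball 0 d) (\<lambda>n z. walk_sum (exp z) (exp (- z)) n * r z ^ n) \<kappa> sequentially"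
    note derivs = diff_pole_derivatives[OF *(1,3,4) conjunct2[OF zero]]
    have "quasi_powers two_sided_walks (\<lambda>w. X w - Y w) r \<kappa> d 0 diff_var"
      by unfold_locales
        (use * \<kappa> lim derivs crho_nz finite_two_sided_walks two_sided_walks_nonempty in
          \<open>simp_all add: mgf_sum_eq_dist_sum(2)\<close>)
    then show thesis by (rule that)
  qed (auto intro!: holomorphic_intros)
qed

text \<open>
  Reflection in the diagonal, read off from the symmetry of the generating function.
\<close>

lemma dist_sum_symmetric:
  assumes "tame x" "tame y"
  shows "walk_sum x y n = walk_sum y x n"
proof -
  let ?f = "\<lambda>u::complex. 1 / (1 - u)"
  have "(\<lambda>t. Num ?f x y t / Den x y t) has_fps_expansion Abs_fps (walk_sum x y)"
    "(\<lambda>t. Num ?f y x t / Den y x t) has_fps_expansion Abs_fps (walk_sum y x)"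
    by (intro tame_weights.dist_sum_gf geometric_fps tame_weights.intro assms)+
  moreover have "Num ?f y x t / Den y x t = Num ?f x y t / Den x y t" for t
    by (simp add: Num_def Den_def Init_def algebra_simps)
  ultimately have "Abs_fps (walk_sum x y) = Abs_fps (walk_sum y x)"
    using fps_expansion_unique_complex by auto
  then show ?thesis by (metis fps_nth_Abs_fps)
qed

text \<open>
  By symmetry the moment generating function of \<open>X - Y\<close> is even near 0, so its derivative at 0
  vanishes.
\<close>

theorem expectation_difference: "measure_pmf.expectation (random_walk n) (\<lambda>w. X w - Y w) = 0"
proof -
  obtain \<delta> where \<delta>: "\<delta> > 0" "\<And>z. norm z < \<delta> \<Longrightarrow> tame (exp z) \<and> tame (exp (- z))"
    using tame_near_1 by blast
  define f where "f = mgf_sum two_sided_walks (\<lambda>w. X w - Y w) n"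
  define D where "D = (\<Sum>w\<in>two_sided_walks n. complex_of_real (X w - Y w))"
  have sym: "f z - f (- z) = 0" if "norm z < \<delta>" for z
    using dist_sum_symmetric[of "exp z" "exp (- z)" n] \<delta>(2)[OF that]
    unfolding f_def mgf_sum_eq_dist_sum(2) by simp
  have f': "(f has_field_derivative D) (at 0)"
    unfolding f_def mgf_sum_def D_def
    by (rule DERIV_sum) (auto intro!: derivative_eq_intros)
  have "((\<lambda>z. f (- z)) has_field_derivative - D) (at 0)"
    using DERIV_chain'[of uminus "- 1" 0 UNIV f D] f' by (simp add: DERIV_minus[of "\<lambda>z. z" 1, simplified])
  from DERIV_diff[OF f' this] have "((\<lambda>z. f z - f (- z)) has_field_derivative D - - D) (at 0)" .
  from deriv_eq_0_if_constant[OF sym _ this] \<delta>(1) have "D = 0" by simp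
  then have "complex_of_real (\<Sum>w\<in>two_sided_walks n. X w - Y w) = 0"
    by (simp add: D_def)
  then have "(\<Sum>w\<in>two_sided_walks n. X w - Y w) = 0"
    by (simp only: of_real_eq_0_iff)
  then show ?thesis
    unfolding random_walk_def
    by (subst integral_pmf_of_set[OF two_sided_walks_nonempty finite_two_sided_walks]) simp
qed

text \<open>
  Again the difference of the cross-multiplied sides is a multiple of the cubic.
\<close>

lemma kappa_eq: "amplitude / (1 - 2 * rho) = rho * (3 * rho - 1) / ((3 * rho + 1) * (5 * rho - 2))"
proof -
  have nz: "1 - 2 * rho \<noteq> 0" "rho \<noteq> 0" "1 + 3 * rho \<noteq> 0" "3 * rho + 1 \<noteq> 0" "5 * rho - 2 \<noteq> 0"
    using rho by auto
  have "(1 - rho - rho\<^sup>2) * (5 * rho - 2) - rho\<^sup>2 * (3 * rho - 1) * (1 - 2 * rho) =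
      (3 * rho - 2) * (1 - 2 * rho - 2 * rho\<^sup>2 + 2 * rho ^ 3)"
    by (simp add: algebra_simps power2_eq_square power3_eq_cube)
  then have "(1 - rho - rho\<^sup>2) * (5 * rho - 2) = rho\<^sup>2 * (3 * rho - 1) * (1 - 2 * rho)"
    unfolding rho(3) by simp
  then have "(3 * rho + 1) * ((1 - rho - rho\<^sup>2) * (5 * rho - 2)) =
      (3 * rho + 1) * (rho\<^sup>2 * (3 * rho - 1) * (1 - 2 * rho))"
    by simp
  then have "(1 - rho - rho\<^sup>2) * ((3 * rho + 1) * (5 * rho - 2)) =
      rho * (3 * rho - 1) * (rho * (1 + 3 * rho) * (1 - 2 * rho))"
    by (simp only: power2_eq_square mult_ac add.commute)
  then show ?thesis
    using nz by (simp add: amplitude_def frac_eq_eq)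
qed

lemma numeric_bounds:
  "rho \<in> {0.403..<0.404}" "1 / rho \<in> {2.48..<2.49}"
  "rho * (3 * rho - 1) / ((3 * rho + 1) * (5 * rho - 2)) \<in> {2.51..<2.52}"
  "2 * rho / (1 - 2 * rho) \<in> {4.15..<4.16}" "sum_mean \<in> {0.63..<0.64}"
  "sum_var \<in> {0.49..<0.50}" "diff_var \<in> {5.17..<5.18}"
proof -
  show "rho \<in> {0.403..<0.404}" "1 / rho \<in> {2.48..<2.49}" "2 * rho / (1 - 2 * rho) \<in> {4.15..<4.16}"
    "sum_mean \<in> {0.63..<0.64}"
    using rho(1,2) by (auto simp: sum_mean_def field_simps)
  have "rho * (3 * rho - 1) = 3 * rho\<^sup>2 - rho" "(3 * rho + 1) * (5 * rho - 2) = 15 * rho\<^sup>2 - rho - 2"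
    by (simp_all add: algebra_simps power2_eq_square)
  then show "rho * (3 * rho - 1) / ((3 * rho + 1) * (5 * rho - 2)) \<in> {2.51..<2.52}"
    using rho(1,2) rho_powers by (simp add: pos_le_divide_eq pos_divide_less_eq)
  have num: "4 * (rho + 1)\<^sup>2 * rho = 4 * rho ^ 3 + 8 * rho\<^sup>2 + 4 * rho"
    and den: "(3 * rho + 1) ^ 3 * (1 - rho) = 1 + 8 * rho + 18 * rho\<^sup>2 - 27 * rho ^ 4"
    by (simp_all add: algebra_simps power2_eq_square power3_eq_cube power4_eq_xxxx)
  show "sum_var \<in> {0.49..<0.50}"
    unfolding sum_var_def num den
    using rho(1,2) rho_powers by (simp add: pos_le_divide_eq pos_divide_less_eq)
  have num: "rho * (rho\<^sup>2 - 2) * (1 + rho) = - (2 * rho + 2 * rho\<^sup>2 - rho ^ 3 - rho ^ 4)"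
    and den: "(rho\<^sup>2 + rho - 1) * (3 * rho - 1) * (1 + 3 * rho) = - (rho + 10 * rho\<^sup>2 - 9 * rho ^ 3 - 9 * rho ^ 4 - 1)"
    by (simp_all add: algebra_simps power2_eq_square power3_eq_cube power4_eq_xxxx)
  show "diff_var \<in> {5.17..<5.18}"
    unfolding diff_var_def num den minus_divide_divide
    using rho(1,2) rho_powers by (simp add: pos_le_divide_eq pos_divide_less_eq)
qed

theorem proposition6:
  shows "\<exists>\<rho> \<mu> \<kappa> m s s1 :: real.
    \<comment> \<open>part (1)\<close>
    {z. dominant_singularity two_sided_gf z} = {complex_of_real \<rho>} \<and>
    dominant_simple_pole two_sided_gf (complex_of_real \<rho>) \<and>
    \<rho> \<in> {0.403..<0.404} \<and>
    1 - 2 * \<rho> - 2 * \<rho>^2 + 2 * \<rho>^3 = 0 \<and>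
    \<mu> = 1 / \<rho> \<and> \<mu> \<in> {2.48..<2.49} \<and>
    \<kappa> = \<rho> * (3 * \<rho> - 1) / ((3 * \<rho> + 1) * (5 * \<rho> - 2)) \<and> \<kappa> \<in> {2.51..<2.52} \<and>
    (\<lambda>n. real (card (two_sided_walks n))) \<sim>[at_top] (\<lambda>n. \<kappa> * \<mu> ^ n) \<and>
    \<comment> \<open>part (2)\<close>
    (\<forall>k::nat. (\<lambda>n. measure_pmf.prob (random_walk n) {w. corner_dist w = real k})
        \<longlonglongrightarrow> (1 - 2 * \<rho>) * (2 * \<rho>) ^ k) \<and>
    (\<lambda>n. measure_pmf.expectation (random_walk n) corner_dist)
        \<longlonglongrightarrow> 2 * \<rho> / (1 - 2 * \<rho>) \<and>
    2 * \<rho> / (1 - 2 * \<rho>) \<in> {4.15..<4.16} \<and>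
    \<comment> \<open>part (3)\<close>
    m = (\<rho> + 1) / (3 * \<rho> + 1) \<and> m \<in> {0.63..<0.64} \<and>
    s > 0 \<and> s^2 = 4 * (\<rho> + 1)^2 * \<rho> / ((3 * \<rho> + 1)^3 * (1 - \<rho>)) \<and>
    s^2 \<in> {0.49..<0.50} \<and>
    (\<lambda>n. measure_pmf.expectation (random_walk n) (\<lambda>w. X w + Y w))
        \<sim>[at_top] (\<lambda>n. m * real n) \<and>
    (\<lambda>n. measure_pmf.variance (random_walk n) (\<lambda>w. X w + Y w))
        \<sim>[at_top] (\<lambda>n. s^2 * real n) \<and>
    weak_conv_m
      (\<lambda>n. walk_law n (\<lambda>w. (X w + Y w - m * real n) / (s * sqrt (real n))))
      std_normal_distribution \<and>
    \<comment> \<open>part (4)\<close>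
    s1 > 0 \<and>
    s1^2 = \<rho> * (\<rho>^2 - 2) * (1 + \<rho>) / ((\<rho>^2 + \<rho> - 1) * (3 * \<rho> - 1) * (1 + 3 * \<rho>)) \<and>
    s1^2 \<in> {5.17..<5.18} \<and>
    (\<forall>n. measure_pmf.expectation (random_walk n) (\<lambda>w. X w - Y w) = 0) \<and>
    (\<lambda>n. measure_pmf.variance (random_walk n) (\<lambda>w. X w - Y w))
        \<sim>[at_top] (\<lambda>n. s1^2 * real n) \<and>
    weak_conv_m
      (\<lambda>n. walk_law n (\<lambda>w. (X w - Y w) / (s1 * sqrt (real n))))
      std_normal_distribution"
proof -
  obtain r \<kappa> d where "quasi_powers two_sided_walks (\<lambda>w. X w + Y w) r \<kappa> d sum_mean sum_var"
    by (rule sum_quasi_powers)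
  then interpret sum: quasi_powers two_sided_walks "\<lambda>w. X w + Y w" r \<kappa> d sum_mean sum_var .
  obtain r' \<kappa>' d' where "quasi_powers two_sided_walks (\<lambda>w. X w - Y w) r' \<kappa>' d' 0 diff_var"
    by (rule diff_quasi_powers)
  then interpret diff: quasi_powers two_sided_walks "\<lambda>w. X w - Y w" r' \<kappa>' d' 0 diff_var .
  define s where "s = sqrt sum_var"
  define s1 where "s1 = sqrt diff_var"
  have s: "s > 0" "s\<^sup>2 = sum_var" and s1: "s1 > 0" "s1\<^sup>2 = diff_var"
    using numeric_bounds(6,7) by (auto simp: s_def s1_def)
  have sum_mean: "(\<lambda>n. measure_pmf.expectation (random_walk n) (\<lambda>w. X w + Y w)) \<sim>[at_top] (\<lambda>n. sum_mean * real n)"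
    using asymp_equiv_linearI[OF sum.mean_linear] numeric_bounds(5) by (auto simp: random_walk_def)
  have sum_variance: "(\<lambda>n. measure_pmf.variance (random_walk n) (\<lambda>w. X w + Y w)) \<sim>[at_top] (\<lambda>n. s\<^sup>2 * real n)"
    using asymp_equiv_linearI[OF sum.variance_linear] numeric_bounds(6) by (auto simp: random_walk_def s)
  have diff_variance: "(\<lambda>n. measure_pmf.variance (random_walk n) (\<lambda>w. X w - Y w)) \<sim>[at_top] (\<lambda>n. s1\<^sup>2 * real n)"
    using asymp_equiv_linearI[OF diff.variance_linear] numeric_bounds(7) by (auto simp: random_walk_def s1)
  have sum_law: "weak_conv_m (\<lambda>n. walk_law n (\<lambda>w. (X w + Y w - sum_mean * real n) / (s * sqrt (real n))))
      std_normal_distribution"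
    using sum.gaussian_limit[OF s] by (simp add: walk_law_def random_walk_def)
  have diff_law: "weak_conv_m (\<lambda>n. walk_law n (\<lambda>w. (X w - Y w) / (s1 * sqrt (real n)))) std_normal_distribution"
    using diff.gaussian_limit[OF s1] by (simp add: walk_law_def random_walk_def)
  show ?thesis
    by (rule exI[of _ rho], rule exI[of _ "1 / rho"],
        rule exI[of _ "rho * (3 * rho - 1) / ((3 * rho + 1) * (5 * rho - 2))"],
        rule exI[of _ sum_mean], rule exI[of _ s], rule exI[of _ s1], intro conjI allI)
      (rule dominant_singularity_iff dominant_pole rho(3) refl numeric_bounds corner_distance_geometric
        corner_distance_mean card_asymptotics[unfolded kappa_eq] sum_mean sum_variance diff_variance
        sum_law diff_law expectation_difference s(1) s1(1) sum_mean_def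
        s(2)[unfolded sum_var_def] s1(2)[unfolded diff_var_def]
        numeric_bounds(6)[folded s(2)] numeric_bounds(7)[folded s1(2)])+
qed

end
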